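(* All maximal open subalgebras of $L=E(3,6)$ are, up to conjugation, the graded subalgebras of type $(2,2,2,0)$, $(2,1,1,0)$ and $(1,1,1,\frac12)$.
   Context: The ground field is $\mathbb{C}$. $W_3$ is the Lie algebra of formal vector fields in $x_1,x_2,x_3$, $\Omega^k(3)$ the space of differential $k$-forms with coefficients in $\mathbb{C}[[x_1,x_2,x_3]]$; $\Omega^k(3)^\lambda$ denotes the same space with the twisted action $X\cdot\omega=\mathcal{L}_X\omega+\lambda\,\mathrm{div}(X)\omega$ of $X\in W_3$ ($\mathcal{L}_X$ the Lie derivative). $E(3,6)$ is the linearly compact Lie superalgebra with even part $W_3\oplus\Omega^0(3)\otimes sl_2$ ($W_3$ acting naturally on $\Omega^0(3)$, $[f\otimes A,g\otimes B]=fg\otimes[A,B]$) and odd part $\Omega^1(3)^{-1/2}\otimes\mathbb{C}^2$, with $W_3$ acting by the twisted action on the first factor and $[f\otimes A,\omega\otimes u]=f\omega\otimes Au$. Identify $\Omega^2(3)^{-1}$ with $W_3$ (via contraction of vector fields with the volume form $dx_1\wedge dx_2\wedge dx_3$) and $\Omega^3(3)^{-1}$ with $\Omega^0(3)$. The bracket of odd elements is $$[\omega_1\otimes u_1,\omega_2\otimes u_2]=(\omega_1\wedge\omega_2)\otimes(u_1\wedge u_2)+\tfrac12(d\omega_1\wedge\omega_2+\omega_1\wedge d\omega_2)\otimes u_1\cdot u_2,$$ where $u_1\cdot u_2\in S^2\mathbb{C}^2\cong sl_2$ and $u_1\wedge u_2\in\Lambda^2\mathbb{C}^2\cong\mathbb{C}$;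 with $v_1,v_2$ the standard basis of $\mathbb{C}^2$ and $E,F,H$ that of $sl_2$: $E=v_1^2/2$, $F=-v_2^2/2$, $H=-v_1\cdot v_2$, $v_1\wedge v_2=1$. The $\mathbb{Z}$-grading of type $(a_1,a_2,a_3,\varepsilon)$, $a_i\in\mathbb{N}$, $\varepsilon\in\frac12\mathbb{Z}$, $\varepsilon+\frac12\sum a_i\in\mathbb{Z}$: $\deg x_i=-\deg\frac{\partial}{\partial x_i}=a_i$, $\deg v_1=-\deg v_2=\varepsilon$, $\deg d=-\frac12\sum_ia_i$ (so $\deg dx_i=a_i+\deg d$), $\deg E=-\deg F=2\varepsilon$, $\deg H=0$. The graded subalgebra of this type is $\prod_{j\ge0}L_j$. Maximal open subalgebras are taken among proper subalgebras. "Conjugation" means conjugation by the group of inner automorphisms of $\mathrm{Der}\,L$ $(=L)$, generated by $\exp(\mathrm{ad}\,a)$ for exponentiable even elements $a$ (those for which $\exp(t\,\mathrm{ad}\,a)$ converges for all $t\in\mathbb{C}$ to a continuous automorphism). *)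

theory Defs
  imports "HOL-Analysis.Analysis" "HOL-Algebra.Bij" "HOL-Algebra.Generated_Groups"
begin

section \<open>Formal power series in three variables\<close>

text \<open>
  The variables are indexed by the type \<open>3\<close>, whose elements are \<open>1\<close>, \<open>2\<close> and \<open>3 = 0\<close>.
  An exponent vector is an element of \<open>nat^3\<close>, and a power series is its family of coefficients.
\<close>

typedef pser = "UNIV :: (nat^3 \<Rightarrow> complex) set"
  morphisms pcoeff Abs_pser ..

lemma pcoeff_Abs [simp]: "pcoeff (Abs_pser f) = f"
  by (simp add: Abs_pser_inverse)

lemma pser_eqI: "(\<And>m. pcoeff f m = pcoeff g m) \<Longrightarrow> f = g"
  by (metis ext pcoeff_inject)

lemma finite_vec_le: "finite {k :: nat^3. \<forall>i. k $ i \<le> m $ i}"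
proof -
  have "{k :: nat^3. \<forall>i. k $ i \<le> m $ i} \<subseteq> vec_lambda ` (Pi\<^sub>E UNIV (\<lambda>i. {..m $ i}))"
  proof
    fix k :: "nat^3" assume "k \<in> {k. \<forall>i. k $ i \<le> m $ i}"
    then have "vec_nth k \<in> Pi\<^sub>E UNIV (\<lambda>i. {..m $ i})"
      by auto
    then have "vec_lambda (vec_nth k) \<in> vec_lambda ` (Pi\<^sub>E UNIV (\<lambda>i. {..m $ i}))"
      by (rule imageI)
    then show "k \<in> vec_lambda ` (Pi\<^sub>E UNIV (\<lambda>i. {..m $ i}))"
      by (simp only: vec_nth_inverse)
  qed
  then show ?thesis
    by (rule finite_subset) (intro finite_imageI finite_PiE, auto)
qed

lemma finite_splits: "finite {(k, l). k + l = (m :: nat^3)}"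
proof (rule finite_subset)
  show "{(k, l). k + l = m} \<subseteq> {k. \<forall>i. k $ i \<le> m $ i} \<times> {l. \<forall>i. l $ i \<le> m $ i}"
    by auto
qed (simp add: finite_vec_le)

instantiation pser :: comm_ring_1
begin

definition "0 = Abs_pser (\<lambda>m. 0)"
definition "1 = Abs_pser (\<lambda>m. if m = 0 then 1 else 0)"
definition "f + g = Abs_pser (\<lambda>m. pcoeff f m + pcoeff g m)"
definition "f - g = Abs_pser (\<lambda>m. pcoeff f m - pcoeff g m)"
definition "- f = Abs_pser (\<lambda>m. - pcoeff f m)"
definition "f * g = Abs_pser (\<lambda>m. \<Sum>(k, l) | k + l = m. pcoeff f k * pcoeff g l)"

instance
proof
  fix a b c :: pser
  show "a * b = b * a"
  proof (rule pser_eqI)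
    fix m
    show "pcoeff (a * b) m = pcoeff (b * a) m"
      unfolding times_pser_def pcoeff_Abs
      by (rule sum.reindex_bij_witness[where i = prod.swap and j = prod.swap])
        (auto simp: add.commute)
  qed
  show "a * b * c = a * (b * c)"
  proof (rule pser_eqI)
    fix m
    have fin: "finite {(k, l). k + l = (n :: nat^3)}" for n
      by (rule finite_splits)
    have "pcoeff (a * b * c) m =
      (\<Sum>p\<in>{(n, l). n + l = m}. \<Sum>q\<in>{(j, k). j + k = fst p}.
         pcoeff a (fst q) * pcoeff b (snd q) * pcoeff c (snd p))"
      by (simp add: times_pser_def case_prod_unfold sum_distrib_right)
    also have "\<dots> = (\<Sum>(p, q)\<in>Sigma {(n, l). n + l = m} (\<lambda>p. {(j, k). j + k = fst p}).
         pcoeff a (fst q) * pcoeff b (snd q) * pcoeff c (snd p))"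
      using fin by (subst sum.Sigma) auto
    also have "\<dots> = (\<Sum>(p, q)\<in>Sigma {(j, n). j + n = m} (\<lambda>p. {(k, l). k + l = snd p}).
         pcoeff a (fst p) * (pcoeff b (fst q) * pcoeff c (snd q)))"
      by (rule sum.reindex_bij_witness[where
            i = "\<lambda>((j, n), (k, l)). ((j + k, l), (j, k))" and
            j = "\<lambda>((n, l), (j, k)). ((j, k + l), (k, l))"])
        (auto simp: add.assoc mult.assoc)
    also have "\<dots> = (\<Sum>p\<in>{(j, n). j + n = m}. \<Sum>q\<in>{(k, l). k + l = snd p}.
         pcoeff a (fst p) * (pcoeff b (fst q) * pcoeff c (snd q)))"
      using fin by (subst sum.Sigma) auto
    also have "\<dots> = pcoeff (a * (b * c)) m"
      by (simp add: times_pser_def case_prod_unfold sum_distrib_left)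
    finally show "pcoeff (a * b * c) m = pcoeff (a * (b * c)) m" .
  qed
  show "1 * a = a"
  proof (rule pser_eqI)
    fix m
    have "pcoeff (1 * a) m
        = (\<Sum>(k, l) | k + l = m. if (k, l) = (0, m) then pcoeff a m else 0)"
      unfolding times_pser_def one_pser_def pcoeff_Abs
      by (rule sum.cong) auto
    also have "\<dots> = (\<Sum>p\<in>{(k, l). k + l = m}. if p = (0, m) then pcoeff a m else 0)"
      by (rule sum.cong) (auto split: if_splits)
    also have "\<dots> = pcoeff a m"
      by (subst sum.delta[OF finite_splits]) auto
    finally show "pcoeff (1 * a) m = pcoeff a m" .
  qed
  show "(a + b) * c = a * c + b * c"
    by (rule pser_eqI)
      (simp add: times_pser_def plus_pser_def case_prod_unfold distrib_right sum.distrib)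
  show "(0 :: pser) \<noteq> 1"
  proof
    assume "(0 :: pser) = 1"
    then have "pcoeff 0 0 = pcoeff 1 0" by simp
    then show False by (simp add: zero_pser_def one_pser_def)
  qed
qed (auto intro!: pser_eqI simp: plus_pser_def zero_pser_def uminus_pser_def minus_pser_def)

end

definition pconst :: "complex \<Rightarrow> pser" where
  "pconst c = Abs_pser (\<lambda>m. if m = 0 then c else 0)"

definition pdiff :: "3 \<Rightarrow> pser \<Rightarrow> pser" where
  "pdiff i f = Abs_pser (\<lambda>m. of_nat (m $ i + 1) * pcoeff f (m + axis i 1))"

lemma pcoeff_pconst_mult: "pcoeff (pconst c * f) m = c * pcoeff f m"
proof -
  have "pcoeff (pconst c * f) m
      = (\<Sum>(k, l) | k + l = m. if (k, l) = (0, m) then c * pcoeff f m else 0)"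
    unfolding times_pser_def pconst_def pcoeff_Abs
    by (rule sum.cong) auto
  also have "\<dots> = (\<Sum>p\<in>{(k, l). k + l = m}. if p = (0, m) then c * pcoeff f m else 0)"
    by (rule sum.cong) (auto split: if_splits)
  also have "\<dots> = c * pcoeff f m"
    by (subst sum.delta[OF finite_splits]) auto
  finally show ?thesis .
qed


section \<open>Vector fields and differential forms\<close>

text \<open>\<open>X :: vfield\<close> stands for \<open>\<Sum>i. X $ i \<partial>/\<partial>x\<^sub>i\<close>.\<close>

type_synonym vfield = "pser^3"

definition vf_apply :: "vfield \<Rightarrow> pser \<Rightarrow> pser" where
  "vf_apply X f = (\<Sum>i\<in>UNIV. X $ i * pdiff i f)"

definition vf_bracket :: "vfield \<Rightarrow> vfield \<Rightarrow> vfield" where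
  "vf_bracket X Y = (\<chi> i. vf_apply X (Y $ i) - vf_apply Y (X $ i))"

definition divergence :: "vfield \<Rightarrow> pser" where
  "divergence X = (\<Sum>i\<in>UNIV. pdiff i (X $ i))"

text \<open>
  \<open>\<omega> :: form\<close> is a differential form of mixed degree: \<open>\<omega> $ I\<close> is its coefficient at
  \<open>dx\<^sub>I\<close>, the wedge product of the \<open>dx\<^sub>i\<close>, \<open>i \<in> I\<close>, in increasing order.  The order on the type \<open>3\<close>
  is \<open>0 < 1 < 2\<close>, i.e. \<open>x\<^sub>3\<close> comes first; as this is a cyclic rotation of the
  usual order, \<open>dx\<^bsub>UNIV\<^esub>\<close> is still the volume form \<open>dx\<^sub>1 \<and> dx\<^sub>2 \<and> dx\<^sub>3\<close>.
\<close>

type_synonym form = "pser^(3 set)"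

definition is_form :: "nat \<Rightarrow> form \<Rightarrow> bool" where
  "is_form k \<omega> \<longleftrightarrow> (\<forall>I. card I \<noteq> k \<longrightarrow> \<omega> $ I = 0)"

text \<open>\<open>dx\<^sub>I \<and> dx\<^sub>J = shuffle_sign I J dx\<^bsub>I \<union> J\<^esub>\<close> for disjoint \<open>I\<close> and \<open>J\<close>.\<close>

definition shuffle_sign :: "3 set \<Rightarrow> 3 set \<Rightarrow> pser" where
  "shuffle_sign I J = (-1) ^ card {(i, j). i \<in> I \<and> j \<in> J \<and> j < i}"

definition wedge :: "form \<Rightarrow> form \<Rightarrow> form"  (infixl "\<and>\<^sub>f" 70) where
  "\<alpha> \<and>\<^sub>f \<beta> = (\<chi> K. \<Sum>I\<in>Pow K. shuffle_sign I (K - I) * \<alpha> $ I * \<beta> $ (K - I))"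

definition ext_d :: "form \<Rightarrow> form" where
  "ext_d \<omega> = (\<chi> K. \<Sum>i\<in>K. shuffle_sign {i} (K - {i}) * pdiff i (\<omega> $ (K - {i})))"

definition contract :: "vfield \<Rightarrow> form \<Rightarrow> form" where
  "contract X \<omega> = (\<chi> K. \<Sum>i\<in>- K. shuffle_sign {i} K * X $ i * \<omega> $ (insert i K))"

definition lie_deriv :: "vfield \<Rightarrow> form \<Rightarrow> form" where
  "lie_deriv X \<omega> = ext_d (contract X \<omega>) + contract X (ext_d \<omega>)"

definition twisted_action :: "complex \<Rightarrow> vfield \<Rightarrow> form \<Rightarrow> form" where
  "twisted_action l X \<omega> = lie_deriv X \<omega> + (pconst l * divergence X) *s \<omega>"

text \<open>A one-form is stored as its triple of coefficients at \<open>dx\<^sub>1, dx\<^sub>2, dx\<^sub>3\<close>.\<close>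

definition form_of_1form :: "pser^3 \<Rightarrow> form" where
  "form_of_1form \<alpha> = (\<chi> I. \<Sum>i | I = {i}. \<alpha> $ i)"

definition coeffs_of_1form :: "form \<Rightarrow> pser^3" where
  "coeffs_of_1form \<omega> = (\<chi> i. \<omega> $ {i})"

definition volume_form :: form where
  "volume_form = (\<chi> I. if I = UNIV then 1 else 0)"

text \<open>
  The identifications of two-forms with vector fields (by contraction with the volume form; see the
  lemma below) and of three-forms with functions.
\<close>

definition vf_of_2form :: "form \<Rightarrow> vfield" where
  "vf_of_2form \<omega> = (\<chi> i. shuffle_sign {i} (- {i}) * \<omega> $ (- {i}))"

definition fun_of_3form :: "form \<Rightarrow> pser" where
  "fun_of_3form \<omega> = \<omega> $ UNIV"

lemma shuffle_sign_square: "shuffle_sign I J * shuffle_sign I J = 1"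
  by (simp add: shuffle_sign_def flip: power_mult_distrib)

lemma contract_volume_form:
  assumes "is_form 2 \<omega>"
  shows "contract X volume_form = \<omega> \<longleftrightarrow> X = vf_of_2form \<omega>"
proof -
  have ins: "insert i K = UNIV \<longleftrightarrow> K = - {i}" if "i \<notin> K" for i :: 3 and K
    using that by auto
  have *: "contract X volume_form $ K
      = (\<Sum>i\<in>- K. if K = - {i} then shuffle_sign {i} K * X $ i else 0)" for K
    unfolding contract_def volume_form_def by (auto intro!: sum.cong simp: ins)
  have at: "contract X volume_form $ (- {i}) = shuffle_sign {i} (- {i}) * X $ i" for i
    by (simp add: *)
  have off: "contract X volume_form $ K = 0" if "card K \<noteq> 2" for K
  proof -
    have "card (- {i} :: 3 set) = 2" for i
      by (simp add: Compl_eq_Diff_UNIV)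
    then show ?thesis using that unfolding * by (intro sum.neutral) auto
  qed
  show ?thesis
  proof
    assume "contract X volume_form = \<omega>"
    then have "\<omega> $ (- {i}) = shuffle_sign {i} (- {i}) * X $ i" for i
      using at by simp
    then show "X = vf_of_2form \<omega>"
      by (simp add: vf_of_2form_def vec_eq_iff mult.assoc[symmetric] shuffle_sign_square)
  next
    assume X: "X = vf_of_2form \<omega>"
    have "contract X volume_form $ K = \<omega> $ K" for K
    proof (cases "card K = 2")
      case True
      then have "card (- K) = 1"
        by (simp add: Compl_eq_Diff_UNIV card_Diff_subset)
      then obtain i where "- K = {i}" by (auto simp: card_1_singleton_iff)
      then have K: "K = - {i}" by auto
      show ?thesis
        unfolding K using at[of i]
        by (simp add: X vf_of_2form_def mult.assoc[symmetric] shuffle_sign_square)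
    next
      case False
      then show ?thesis using assms off by (simp add: is_form_def)
    qed
    then show "contract X volume_form = \<omega>" by (simp add: vec_eq_iff)
  qed
qed


section \<open>Currents with values in \<open>sl\<^sub>2\<close>\<close>

text \<open>\<open>(e, f, h)\<close> stands for \<open>e \<otimes> E + f \<otimes> F + h \<otimes> H\<close>.\<close>

type_synonym sl2 = "pser \<times> pser \<times> pser"

fun sl2_matrix :: "sl2 \<Rightarrow> pser^2^2" where
  "sl2_matrix (e, f, h) = vector [vector [h, e], vector [f, - h]]"

definition sl2_of_matrix :: "pser^2^2 \<Rightarrow> sl2" where
  "sl2_of_matrix M = (M $ 1 $ 2, M $ 2 $ 1, M $ 1 $ 1)"

definition sl2_bracket :: "sl2 \<Rightarrow> sl2 \<Rightarrow> sl2" where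
  "sl2_bracket A B =
     sl2_of_matrix (sl2_matrix A ** sl2_matrix B - sl2_matrix B ** sl2_matrix A)"

fun sl2_vf_apply :: "vfield \<Rightarrow> sl2 \<Rightarrow> sl2" where
  "sl2_vf_apply X (e, f, h) = (vf_apply X e, vf_apply X f, vf_apply X h)"

definition C2_wedge :: "complex^2 \<Rightarrow> complex^2 \<Rightarrow> complex" where
  "C2_wedge u w = u $ 1 * w $ 2 - u $ 2 * w $ 1"

text \<open>
  \<open>C2_dot g u w\<close> is \<open>g \<otimes> u \<cdot> w\<close>, where \<open>v\<^sub>1\<^sup>2 = 2 E\<close>, \<open>v\<^sub>2\<^sup>2 = - 2 F\<close> and
  \<open>v\<^sub>1 \<cdot> v\<^sub>2 = - H\<close>.
\<close>

definition C2_dot :: "pser \<Rightarrow> complex^2 \<Rightarrow> complex^2 \<Rightarrow> sl2" where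
  "C2_dot g u w =
     (pconst (2 * (u $ 1 * w $ 1)) * g,
      pconst (- 2 * (u $ 2 * w $ 2)) * g,
      pconst (- (u $ 1 * w $ 2 + u $ 2 * w $ 1)) * g)"


section \<open>The Lie superalgebra \<open>E(3,6)\<close>\<close>

text \<open>
  \<open>(X, A, \<theta>)\<close> has even part \<open>X + A\<close> and odd part \<open>\<Sum>k. \<theta> $ k \<otimes> v\<^sub>k\<close>, where \<open>\<theta> $ k\<close> is a
  one-form and \<open>v\<^sub>k = axis k 1\<close>.
\<close>

type_synonym odd36 = "(pser^3)^2"
type_synonym e36 = "vfield \<times> sl2 \<times> odd36"

fun scale36 :: "complex \<Rightarrow> e36 \<Rightarrow> e36" where
  "scale36 c (X, (e, f, h), \<theta>) =
     (pconst c *s X, (pconst c * e, pconst c * f, pconst c * h), \<chi> k. pconst c *s \<theta> $ k)"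

fun even_part :: "e36 \<Rightarrow> e36" where
  "even_part (X, A, \<theta>) = (X, A, 0)"

fun odd_part :: "e36 \<Rightarrow> e36" where
  "odd_part (X, A, \<theta>) = (0, 0, \<theta>)"

definition even_on_odd :: "vfield \<Rightarrow> sl2 \<Rightarrow> odd36 \<Rightarrow> odd36" where
  "even_on_odd X A \<theta> =
     (\<chi> k. coeffs_of_1form (twisted_action (- 1 / 2) X (form_of_1form (\<theta> $ k)))
           + (\<Sum>l\<in>UNIV. sl2_matrix A $ k $ l *s \<theta> $ l))"

definition odd_odd_vf :: "odd36 \<Rightarrow> odd36 \<Rightarrow> vfield" where
  "odd_odd_vf \<theta> \<eta> =
     (\<Sum>k\<in>UNIV. \<Sum>l\<in>UNIV. pconst (C2_wedge (axis k 1) (axis l 1)) *s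
        vf_of_2form (form_of_1form (\<theta> $ k) \<and>\<^sub>f form_of_1form (\<eta> $ l)))"

definition odd_odd_sl2 :: "odd36 \<Rightarrow> odd36 \<Rightarrow> sl2" where
  "odd_odd_sl2 \<theta> \<eta> =
     (\<Sum>k\<in>UNIV. \<Sum>l\<in>UNIV.
        C2_dot
          (pconst (1 / 2) *
             fun_of_3form (ext_d (form_of_1form (\<theta> $ k)) \<and>\<^sub>f form_of_1form (\<eta> $ l)
                         + form_of_1form (\<theta> $ k) \<and>\<^sub>f ext_d (form_of_1form (\<eta> $ l))))
          (axis k 1) (axis l 1))"

fun bracket36 :: "e36 \<Rightarrow> e36 \<Rightarrow> e36" where
  "bracket36 (X, A, \<theta>) (Y, B, \<eta>) =
     (vf_bracket X Y + odd_odd_vf \<theta> \<eta>,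
      sl2_vf_apply X B - sl2_vf_apply Y A + sl2_bracket A B + odd_odd_sl2 \<theta> \<eta>,
      even_on_odd X A \<eta> - even_on_odd Y B \<theta>)"

lemma pconst_add: "pconst (c + d) = pconst c + pconst d"
  by (rule pser_eqI) (simp add: pconst_def plus_pser_def)

lemma pconst_mult: "pconst (c * d) = pconst c * pconst d"
  by (rule pser_eqI) (unfold pcoeff_pconst_mult, simp add: pconst_def)

lemma pconst_1: "pconst 1 = 1"
  by (rule pser_eqI) (simp add: pconst_def one_pser_def)

interpretation e36: vector_space scale36
proof
  fix c d :: complex and x y :: e36
  obtain X e f h \<theta> where x: "x = (X, (e, f, h), \<theta>)"
    by (cases x) auto
  obtain Y e' f' h' \<eta> where y: "y = (Y, (e', f', h'), \<eta>)"
    by (cases y) auto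
  show "scale36 c (x + y) = scale36 c x + scale36 c y"
    by (simp add: x y vec_eq_iff distrib_left)
  show "scale36 (c + d) x = scale36 c x + scale36 d x"
    by (simp add: x vec_eq_iff pconst_add distrib_right)
  show "scale36 c (scale36 d x) = scale36 (c * d) x"
    by (simp add: x vec_eq_iff pconst_mult mult.assoc)
  show "scale36 1 x = x"
    by (simp add: x vec_eq_iff pconst_1)
qed


section \<open>Coordinates, topology and subalgebras\<close>

text \<open>
  The elements \<open>x\<^sup>m \<partial>/\<partial>x\<^sub>i\<close>, \<open>x\<^sup>m \<otimes> E\<close>, \<open>x\<^sup>m \<otimes> F\<close>, \<open>x\<^sup>m \<otimes> H\<close> and \<open>x\<^sup>m dx\<^sub>i \<otimes> v\<^sub>k\<close>, of which every
  element is a formal infinite linear combination.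
\<close>

datatype monomial36 =
    MonVF "nat^3" 3
  | MonE "nat^3"
  | MonF "nat^3"
  | MonH "nat^3"
  | MonOdd "nat^3" 3 2

fun coeff36 :: "e36 \<Rightarrow> monomial36 \<Rightarrow> complex" where
  "coeff36 (X, (e, f, h), \<theta>) (MonVF m i) = pcoeff (X $ i) m"
| "coeff36 (X, (e, f, h), \<theta>) (MonE m) = pcoeff e m"
| "coeff36 (X, (e, f, h), \<theta>) (MonF m) = pcoeff f m"
| "coeff36 (X, (e, f, h), \<theta>) (MonH m) = pcoeff h m"
| "coeff36 (X, (e, f, h), \<theta>) (MonOdd m i k) = pcoeff (\<theta> $ k $ i) m"

text \<open>
  The linearly compact topology: coordinatewise, with the field carrying the discrete topology.
  A fundamental system of neighbourhoods of \<open>0\<close> is given by the subspaces of elements all of whose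
  coefficients up to a given order vanish.
\<close>

definition lc_topology :: "e36 topology" where
  "lc_topology =
     pullback_topology UNIV coeff36 (product_topology (\<lambda>_. discrete_topology UNIV) UNIV)"

text \<open>As usual, subalgebras of a Lie superalgebra are compatible with the parity.\<close>

definition subalgebra36 :: "e36 set \<Rightarrow> bool" where
  "subalgebra36 S \<longleftrightarrow>
     e36.subspace S \<and>
     (\<forall>x\<in>S. even_part x \<in> S \<and> odd_part x \<in> S) \<and>
     (\<forall>x\<in>S. \<forall>y\<in>S. bracket36 x y \<in> S)"

definition maximal_open_subalgebra36 :: "e36 set \<Rightarrow> bool" where
  "maximal_open_subalgebra36 S \<longleftrightarrow>
     subalgebra36 S \<and> openin lc_topology S \<and> S \<noteq> UNIV \<and>
     (\<forall>T. subalgebra36 T \<and> openin lc_topology T \<and> T \<noteq> UNIV \<and> S \<subseteq> T \<longrightarrow> T = S)"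


section \<open>Inner automorphisms\<close>

definition continuous_automorphism36 :: "(e36 \<Rightarrow> e36) \<Rightarrow> bool" where
  "continuous_automorphism36 \<phi> \<longleftrightarrow>
     bij \<phi> \<and> Vector_Spaces.linear scale36 scale36 \<phi> \<and>
     (\<forall>x. \<phi> (even_part x) = even_part (\<phi> x)) \<and>
     (\<forall>x y. \<phi> (bracket36 x y) = bracket36 (\<phi> x) (\<phi> y)) \<and>
     continuous_map lc_topology lc_topology \<phi>"

text \<open>
  \<open>is_exp_ad t a \<phi>\<close> says that \<open>exp(t ad a)\<close> converges to \<open>\<phi>\<close>.  Each coefficient of the exponential
  series converges in the usual topology of the complex numbers; with the discrete topology
  not even \<open>exp(t ad H)\<close> would converge.
\<close>

definition is_exp_ad :: "complex \<Rightarrow> e36 \<Rightarrow> (e36 \<Rightarrow> e36) \<Rightarrow> bool" where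
  "is_exp_ad t a \<phi> \<longleftrightarrow>
     (\<forall>x \<beta>. (\<lambda>n. t ^ n / fact n * coeff36 ((bracket36 a ^^ n) x) \<beta>) sums coeff36 (\<phi> x) \<beta>)"

definition exponentiable :: "e36 \<Rightarrow> bool" where
  "exponentiable a \<longleftrightarrow>
     even_part a = a \<and> (\<forall>t. \<exists>\<phi>. is_exp_ad t a \<phi> \<and> continuous_automorphism36 \<phi>)"

definition inner_automorphisms36 :: "(e36 \<Rightarrow> e36) set" where
  "inner_automorphisms36 =
     generate (BijGroup UNIV) {\<phi>. \<exists>a. exponentiable a \<and> is_exp_ad 1 a \<phi>}"

definition conjugate36 :: "e36 set \<Rightarrow> e36 set \<Rightarrow> bool" where
  "conjugate36 S T \<longleftrightarrow> (\<exists>\<phi>\<in>inner_automorphisms36. S = \<phi> ` T)"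


section \<open>Gradings\<close>

text \<open>
  The degree of a monomial in the grading of type \<open>(a\<^sub>1, a\<^sub>2, a\<^sub>3, \<epsilon>)\<close>.  It is an integer when
  \<open>2 \<epsilon>\<close> and \<open>\<epsilon> + (a\<^sub>1 + a\<^sub>2 + a\<^sub>3) / 2\<close> are.
\<close>

definition deg_x :: "nat^3 \<Rightarrow> nat^3 \<Rightarrow> rat" where
  "deg_x a m = (\<Sum>i\<in>UNIV. of_nat (m $ i * a $ i))"

definition deg_d :: "nat^3 \<Rightarrow> rat" where
  "deg_d a = - (\<Sum>i\<in>UNIV. of_nat (a $ i)) / 2"

fun deg36 :: "nat^3 \<Rightarrow> rat \<Rightarrow> monomial36 \<Rightarrow> rat" where
  "deg36 a \<epsilon> (MonVF m i) = deg_x a m - of_nat (a $ i)"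
| "deg36 a \<epsilon> (MonE m) = deg_x a m + 2 * \<epsilon>"
| "deg36 a \<epsilon> (MonF m) = deg_x a m - 2 * \<epsilon>"
| "deg36 a \<epsilon> (MonH m) = deg_x a m"
| "deg36 a \<epsilon> (MonOdd m i k) =
     deg_x a m + (of_nat (a $ i) + deg_d a) + (if k = 1 then \<epsilon> else - \<epsilon>)"

text \<open>
  The subalgebra \<open>\<Prod>j\<ge>0. L\<^sub>j\<close>: the component of \<open>x\<close> in \<open>L\<^sub>j\<close> collects the monomials of degree \<open>j\<close>.
\<close>

definition graded_subalgebra36 :: "nat^3 \<Rightarrow> rat \<Rightarrow> e36 set" where
  "graded_subalgebra36 a \<epsilon> = {x. \<forall>\<beta>. coeff36 x \<beta> \<noteq> 0 \<longrightarrow> 0 \<le> deg36 a \<epsilon> \<beta>}"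

end

theory Submission
  imports Defs "HOL-Complex_Analysis.Cauchy_Integral_Formula"
begin

text \<open>
  A proper open subalgebra \<open>S\<close> contains no even element whose vector field is nonzero at the
  origin: bracketing with such an element lowers orders of vanishing, so from the elements of high
  order one would reach everything.  Hence brackets of odd elements of \<open>S\<close> have vector
  fields vanishing at the origin, which says that the values at the origin of the odd elements form
  a subspace of \<open>\<complex>\<^sup>3 \<otimes> \<complex>\<^sup>2\<close> isotropic for the pairing into \<open>\<Lambda>\<^sup>2 \<complex>\<^sup>3\<close>.
  Such a subspace consists of tensors of rank at most one, so it is \<open>0\<close>, or it is contained in
  \<open>\<complex>\<^sup>3 \<otimes> u\<close> or in \<open>\<alpha> \<otimes> \<complex>\<^sup>2\<close>; as it is invariant under the even part of \<open>S\<close>,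
  so is the line of \<open>u\<close>, respectively of \<open>\<alpha>\<close>.  Exponentials of linear vector fields and of constant
  matrices move \<open>\<alpha> \<otimes> u\<close> to a multiple of \<open>dx\<^sub>1 \<otimes> v\<^sub>1\<close>, and the three cases become inclusions
  in the graded subalgebras of type \<open>(2,2,2,0)\<close>, \<open>(1,1,1,1/2)\<close> and \<open>(2,1,1,0)\<close>.  The same pairing
  shows that these are maximal.
\<close>

text \<open>Reaching everything from one element requires a leading term. Give one variable x_i
  weight 2 and the other two weight 1. An even element whose field has i-th component c at the
  origin then acts as c times the derivative in x_i, up to terms that lower the weight by at most 1.
  If c is nonzero, antidifferentiation inverts this leading term, whatever the remaining data of the
  element are. Two notions of convergence meet in the conjugations: openness refers to orders of
  vanishing, whereas exponential series converge coefficientwise in the complex numbers. The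
  exponentials that are constructed come from square-zero matrices acting on C^3 and C^2, so that
  each of their coefficients is a finite sum. For an arbitrary exponentiable element a, Taylor
  expansion of the entire functions given by the coefficients of exp(t ad a) x shows that exp(- ad
  a) is the inverse of exp(ad a); hence conjugation preserves openness and maximality.\<close>

lemma pcoeff_add: "pcoeff (f + g) m = pcoeff f m + pcoeff g m"
  by (simp add: plus_pser_def)

lemma pcoeff_diff: "pcoeff (f - g) m = pcoeff f m - pcoeff g m"
  by (simp add: minus_pser_def)

lemma pcoeff_uminus: "pcoeff (- f) m = - pcoeff f m"
  by (simp add: uminus_pser_def)

lemma pcoeff_0: "pcoeff 0 m = 0"
  by (simp add: zero_pser_def)

lemma pcoeff_1: "pcoeff 1 m = (if m = 0 then 1 else 0)"
  by (simp add: one_pser_def)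

lemma pcoeff_mult: "pcoeff (f * g) m = (\<Sum>(k, l) | k + l = m. pcoeff f k * pcoeff g l)"
  by (simp add: times_pser_def)

lemma pcoeff_sum: "pcoeff (sum f A) m = (\<Sum>a\<in>A. pcoeff (f a) m)"
  by (induction A rule: infinite_finite_induct) (auto simp: pcoeff_0 pcoeff_add)

lemmas pcoeff_simps = pcoeff_add pcoeff_diff pcoeff_uminus pcoeff_0 pcoeff_pconst_mult

lemma pconst_0: "pconst 0 = 0"
  by (rule pser_eqI) (simp add: pconst_def zero_pser_def)

lemma pconst_uminus: "pconst (- c) = - pconst c"
  by (rule pser_eqI) (simp add: pconst_def uminus_pser_def)

lemma pconst_numeral: "pconst (numeral n) = numeral n"
proof -
  have "pconst (of_nat k) = of_nat k" for k
    by (induction k) (simp_all add: pconst_0 pconst_1 pconst_add)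
  from this[of "numeral n"] show ?thesis by simp
qed

section \<open>Partial derivatives\<close>

lemma pcoeff_pdiff: "pcoeff (pdiff i f) m = of_nat (m $ i + 1) * pcoeff f (m + axis i 1)"
  by (simp add: pdiff_def)

lemma pdiff_add: "pdiff i (f + g) = pdiff i f + pdiff i g"
  by (rule pser_eqI) (simp add: pcoeff_pdiff pcoeff_simps algebra_simps)

lemma pdiff_diff: "pdiff i (f - g) = pdiff i f - pdiff i g"
  by (rule pser_eqI) (simp add: pcoeff_pdiff pcoeff_simps algebra_simps)

lemma pdiff_uminus: "pdiff i (- f) = - pdiff i f"
  by (rule pser_eqI) (simp add: pcoeff_pdiff pcoeff_simps algebra_simps)

lemma pdiff_0: "pdiff i 0 = 0"
  by (rule pser_eqI) (simp add: pcoeff_pdiff pcoeff_simps algebra_simps)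

lemma pdiff_pconst: "pdiff i (pconst c) = 0"
  by (rule pser_eqI) (auto simp add: pcoeff_pdiff pconst_def pcoeff_0 vec_eq_iff axis_def)

text \<open>A coefficient of the product at \<open>m + axis i 1\<close> is a sum over pairs of
  exponents whose i-th entries add up to \<open>m $ i + 1\<close>. Distributing this factor over the
  two entries gives the two terms of the product rule.\<close>

lemma pdiff_mult: "pdiff i (f * g) = pdiff i f * g + f * pdiff i g"
proof (rule pser_eqI)
  fix m :: "nat^3"
  define T where "T = (\<lambda>m :: nat^3. {(k, l). k + l = m})"
  have fin: "finite (T n)" for n
    unfolding T_def by (rule finite_splits)
  \<comment> \<open>Pairs whose first exponent has i-th entry 0 carry the factor 0, so
    \<open>axis i 1\<close> is subtracted only where the truncated subtraction is exact.\<close>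
  have left: "(\<Sum>p\<in>T (m + axis i 1). of_nat (fst p $ i) * (pcoeff f (fst p) * pcoeff g (snd p)))
      = pcoeff (pdiff i f * g) m" for f g
  proof -
    have "(\<Sum>p\<in>T (m + axis i 1). of_nat (fst p $ i) * (pcoeff f (fst p) * pcoeff g (snd p)))
        = (\<Sum>p\<in>{p\<in>T (m + axis i 1). fst p $ i \<noteq> 0}.
             of_nat (fst p $ i) * (pcoeff f (fst p) * pcoeff g (snd p)))"
      using fin by (intro sum.mono_neutral_right) auto
    also have "\<dots> = (\<Sum>p\<in>T m. pcoeff (pdiff i f) (fst p) * pcoeff g (snd p))"
    proof (rule sum.reindex_bij_witness[where
            i = "\<lambda>p. (fst p + axis i 1, snd p)" and j = "\<lambda>p. (fst p - axis i 1, snd p)"])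
      fix p assume p: "p \<in> {p \<in> T (m + axis i 1). fst p $ i \<noteq> 0}"
      then have *: "fst p - axis i 1 + axis i 1 = fst p"
        by (auto simp: vec_eq_iff axis_def)
      then show "(fst (fst p - axis i 1, snd p) + axis i 1, snd (fst p - axis i 1, snd p)) = p"
        by simp
      have "fst p - axis i 1 + snd p + axis i 1 = m + axis i 1"
        using p * by (auto simp: T_def ac_simps)
      then show "(fst p - axis i 1, snd p) \<in> T m"
        by (simp add: T_def)
      have "(fst p - axis i 1) $ i + 1 = fst p $ i"
        using p by simp
      then show "pcoeff (pdiff i f) (fst (fst p - axis i 1, snd p)) *
            pcoeff g (snd (fst p - axis i 1, snd p)) =
          of_nat (fst p $ i) * (pcoeff f (fst p) * pcoeff g (snd p))"
        by (simp only: pcoeff_pdiff fst_conv snd_conv * mult.assoc)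
    next
      fix p assume "p \<in> T m"
      then have "fst p + snd p = m"
        by (auto simp: T_def)
      then show "(fst p + axis i 1, snd p) \<in> {p \<in> T (m + axis i 1). fst p $ i \<noteq> 0}"
        by (auto simp: T_def add.assoc add.commute[of _ "axis i _"])
    qed (simp add: T_def)
    finally show ?thesis
      by (simp add: pcoeff_mult T_def case_prod_unfold)
  qed
  have right: "(\<Sum>p\<in>T (m + axis i 1). of_nat (snd p $ i) * (pcoeff f (fst p) * pcoeff g (snd p)))
      = pcoeff (f * pdiff i g) m"
  proof -
    have "(\<Sum>p\<in>T (m + axis i 1). of_nat (snd p $ i) * (pcoeff f (fst p) * pcoeff g (snd p)))
        = (\<Sum>p\<in>T (m + axis i 1). of_nat (fst p $ i) * (pcoeff g (fst p) * pcoeff f (snd p)))"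
      by (rule sum.reindex_bij_witness[where i = prod.swap and j = prod.swap])
        (auto simp: T_def add.commute)
    then show ?thesis by (simp add: left mult.commute[of f] del: One_nat_def)
  qed
  have "pcoeff (pdiff i (f * g)) m
      = (\<Sum>p\<in>T (m + axis i 1). of_nat (m $ i + 1) * (pcoeff f (fst p) * pcoeff g (snd p)))"
    by (simp add: pcoeff_pdiff pcoeff_mult T_def case_prod_unfold sum_distrib_left)
  also have "\<dots> = (\<Sum>p\<in>T (m + axis i 1).
        of_nat (fst p $ i) * (pcoeff f (fst p) * pcoeff g (snd p))
      + of_nat (snd p $ i) * (pcoeff f (fst p) * pcoeff g (snd p)))"
  proof (rule sum.cong)
    fix p assume "p \<in> T (m + axis i 1)"
    then have "fst p + snd p = m + axis i 1" by (auto simp: T_def)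
    then have "fst p $ i + snd p $ i = m $ i + 1"
      by (metis axis_nth vector_add_component)
    then show "of_nat (m $ i + 1) * (pcoeff f (fst p) * pcoeff g (snd p)) =
        of_nat (fst p $ i) * (pcoeff f (fst p) * pcoeff g (snd p)) +
        of_nat (snd p $ i) * (pcoeff f (fst p) * pcoeff g (snd p))"
      by (metis distrib_right of_nat_add)
  qed simp
  also have "\<dots> = pcoeff (pdiff i f * g + f * pdiff i g) m"
    by (simp only: sum.distrib left right pcoeff_add)
  finally show "pcoeff (pdiff i (f * g)) m = pcoeff (pdiff i f * g + f * pdiff i g) m" .
qed

lemma pdiff_commute: "pdiff i (pdiff j f) = pdiff j (pdiff i f)"
proof (cases "i = j")
  case False
  have "pcoeff (pdiff i (pdiff j f)) m = pcoeff (pdiff j (pdiff i f)) m" for m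
  proof -
    have "m + axis i 1 + axis j 1 = m + axis j 1 + axis i 1"
      by (simp only: add.assoc add.commute[of "axis i _"])
    moreover have "(m + axis i 1) $ j = m $ j" "(m + axis j 1) $ i = m $ i"
      using False by (auto simp: axis_def)
    ultimately show ?thesis
      by (simp only: pcoeff_pdiff mult.left_commute)
  qed
  then show ?thesis by (rule pser_eqI)
qed simp

lemma pdiff_pconst_mult: "pdiff i (pconst c * f) = pconst c * pdiff i f"
  by (simp add: pdiff_mult pdiff_pconst)

lemmas pdiff_simps = pdiff_add pdiff_diff pdiff_uminus pdiff_0 pdiff_pconst pdiff_mult

section \<open>Coordinate functions and antiderivatives\<close>

definition pvar :: "3 \<Rightarrow> pser" where
  "pvar i = Abs_pser (\<lambda>m. if m = axis i 1 then 1 else 0)"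

lemma pdiff_pvar: "pdiff i (pvar j) = (if i = j then 1 else 0)"
proof (rule pser_eqI)
  fix m :: "nat^3"
  have "m + axis i 1 = axis j 1 \<longleftrightarrow> i = j \<and> m = 0"
  proof
    assume *: "m + axis i 1 = axis j 1"
    then have "m $ i + 1 = axis j 1 $ i"
      by (metis axis_nth vector_add_component)
    then have "i = j" by (auto simp: axis_def split: if_splits)
    then show "i = j \<and> m = 0" using * by simp
  qed simp
  then show "pcoeff (pdiff i (pvar j)) m = pcoeff (if i = j then 1 else 0) m"
    by (simp add: pcoeff_pdiff pvar_def pcoeff_1 pcoeff_0 del: One_nat_def)
qed

text \<open>The antiderivative in x_i that vanishes on x_i = 0. It inverts the leading part of the
  bracket with a field that moves the origin.\<close>

definition pint :: "3 \<Rightarrow> pser \<Rightarrow> pser" where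
  "pint i f = Abs_pser (\<lambda>m. if m $ i = 0 then 0 else pcoeff f (m - axis i 1) / of_nat (m $ i))"

lemma pdiff_pint: "pdiff i (pint i f) = f"
proof (rule pser_eqI)
  fix m :: "nat^3"
  have "m + axis i 1 - axis i 1 = m"
    by (simp add: vec_eq_iff)
  moreover have "(of_nat (m $ i) + 1 :: complex) \<noteq> 0"
    by (metis of_nat_Suc of_nat_neq_0 add.commute)
  ultimately show "pcoeff (pdiff i (pint i f)) m = pcoeff f m"
    by (simp add: pcoeff_pdiff pint_def axis_def add.commute)
qed

section \<open>Value at the origin\<close>

definition ev :: "pser \<Rightarrow> complex" where
  "ev f = pcoeff f 0"

lemma ev_add: "ev (f + g) = ev f + ev g"
  and ev_diff: "ev (f - g) = ev f - ev g"
  and ev_uminus: "ev (- f) = - ev f"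
  and ev_0: "ev 0 = 0"
  and ev_1: "ev 1 = 1"
  and ev_pconst: "ev (pconst c) = c"
  by (simp_all add: ev_def pcoeff_simps pcoeff_1 pconst_def)

lemma ev_mult: "ev (f * g) = ev f * ev g"
proof -
  have "{(k, l). k + l = (0 :: nat^3)} = {(0, 0)}"
    by (auto simp: vec_eq_iff)
  then show ?thesis
    by (simp add: ev_def pcoeff_mult)
qed

lemma ev_pvar: "ev (pvar i) = 0"
  by (auto simp: ev_def pvar_def vec_eq_iff axis_def)

lemmas ev_simps = ev_add ev_diff ev_uminus ev_0 ev_1 ev_pconst ev_mult ev_pvar

section \<open>Weights\<close>

text \<open>Taking \<open>s = 0\<close> gives the order of vanishing at the origin.\<close>

definition weight :: "nat^3 \<Rightarrow> nat^3 \<Rightarrow> nat" where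
  "weight s m = (\<Sum>i\<in>UNIV. (s $ i + 1) * m $ i)"

lemma weight_0: "weight s 0 = 0"
  by (simp add: weight_def)

lemma weight_add: "weight s (m + n) = weight s m + weight s n"
  by (simp add: weight_def algebra_simps sum.distrib)

lemma weight_axis: "weight s (axis i 1) = s $ i + 1"
proof -
  have "weight s (axis i 1) = (\<Sum>j\<in>UNIV. if j = i then s $ i + 1 else 0)"
    unfolding weight_def by (rule sum.cong) (auto simp: axis_def)
  then show ?thesis by simp
qed

lemma le_weight: "m $ i \<le> weight s m"
proof -
  have "m $ i \<le> (s $ i + 1) * m $ i" by simp
  also have "\<dots> \<le> weight s m"
    unfolding weight_def by (rule member_le_sum) auto
  finally show ?thesis .
qed

lemma weight_eq_0_iff: "weight s m = 0 \<longleftrightarrow> m = 0"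
  by (auto simp: weight_def vec_eq_iff)

lemma finite_weight_le: "finite {m. weight s m \<le> n}"
proof (rule finite_subset)
  show "{m. weight s m \<le> n} \<subseteq> {k. \<forall>i. k $ i \<le> (\<chi> i. n) $ i}"
    by (auto intro: order_trans[OF le_weight])
qed (rule finite_vec_le)

text \<open>The filtration by weight. For \<open>s = axis i 1\<close> the variable x_i has weight 2
  and the others weight 1, so that the derivative in x_i lowers weights more than those in the other
  variables.\<close>

definition wge :: "nat^3 \<Rightarrow> nat \<Rightarrow> pser \<Rightarrow> bool" where
  "wge s n f \<longleftrightarrow> (\<forall>m. weight s m < n \<longrightarrow> pcoeff f m = 0)"

lemma wge_0: "wge s n 0"
  by (simp add: wge_def pcoeff_0)

lemma wge_zero: "wge s 0 f"
  by (simp add: wge_def)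

lemma wge_mono: "wge s n f \<Longrightarrow> k \<le> n \<Longrightarrow> wge s k f"
  unfolding wge_def using less_le_trans by blast

lemma wge_add: "wge s n f \<Longrightarrow> wge s n g \<Longrightarrow> wge s n (f + g)"
  by (simp add: wge_def pcoeff_add)

lemma wge_diff: "wge s n f \<Longrightarrow> wge s n g \<Longrightarrow> wge s n (f - g)"
  by (simp add: wge_def pcoeff_diff)

lemma wge_uminus: "wge s n f \<Longrightarrow> wge s n (- f)"
  by (simp add: wge_def pcoeff_uminus)

lemma wge_sum: "(\<And>a. a \<in> A \<Longrightarrow> wge s n (f a)) \<Longrightarrow> wge s n (sum f A)"
  by (simp add: wge_def pcoeff_sum)

lemma wge_mult:
  assumes "wge s k f" "wge s n g"
  shows "wge s (k + n) (f * g)"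
  unfolding wge_def pcoeff_mult
proof (intro allI impI sum.neutral ballI)
  fix m p assume m: "weight s m < k + n" "p \<in> {(i, j). i + j = m}"
  then have "weight s (fst p) + weight s (snd p) < k + n"
    by (auto simp: weight_add)
  then have "weight s (fst p) < k \<or> weight s (snd p) < n"
    by linarith
  then show "(case p of (i, j) \<Rightarrow> pcoeff f i * pcoeff g j) = 0"
    using assms by (auto simp: wge_def split: prod.split)
qed

lemma wge_mult_left: "wge s n g \<Longrightarrow> wge s n (f * g)"
  using wge_mult[OF wge_zero] by simp

lemma wge_mult_right: "wge s n f \<Longrightarrow> wge s n (f * g)"
  using wge_mult[OF _ wge_zero] by simp

lemma wge_pdiff: "wge s (n + s $ i + 1) f \<Longrightarrow> wge s n (pdiff i f)"
  by (auto simp: wge_def pcoeff_pdiff weight_add weight_axis simp del: One_nat_def)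

lemma wge_pint: "wge s n f \<Longrightarrow> wge s (n + s $ i + 1) (pint i f)"
proof -
  have "weight s m = weight s (m - axis i 1) + s $ i + 1" if "m $ i \<noteq> 0" for m
  proof -
    have "m = (m - axis i 1) + axis i 1"
      using that by (auto simp: vec_eq_iff axis_def)
    then show ?thesis
      by (metis weight_add weight_axis add.assoc)
  qed
  then show "wge s n f \<Longrightarrow> wge s (n + s $ i + 1) (pint i f)"
    by (auto simp: wge_def pint_def)
qed

lemma wge_1_iff: "wge s 1 f \<longleftrightarrow> ev f = 0"
  by (auto simp: wge_def ev_def weight_eq_0_iff)

section \<open>The bracket in coordinates\<close>

text \<open>The numeral 3 denotes the element 0 of the type, hence the least one; the signs below
  are computed in the order 3 < 1 < 2.\<close>

lemma less_3: "(3::3) < 1" "(1::3) < 2" "(3::3) < 2" "\<not> (1::3) < 3" "\<not> (2::3) < 1" "\<not> (2::3) < 3"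
  by (simp_all add: less_bit1_def bit1.Rep_numeral bit1.Rep_1)

lemma shuffle_sign_singletons: "shuffle_sign {i} {j} = (if j < i then - 1 else 1)"
proof -
  have "{(a, b). a \<in> {i} \<and> b \<in> {j} \<and> b < a} = (if j < i then {(i, j)} else {})"
    by auto
  then show ?thesis by (simp add: shuffle_sign_def)
qed

lemma shuffle_sign_swap: "i \<noteq> j \<Longrightarrow> shuffle_sign {j} {i} = - shuffle_sign {i} {j}"
  by (auto simp: shuffle_sign_singletons)

lemma shuffle_sign_empty: "shuffle_sign {} I = 1" "shuffle_sign I {} = 1"
  by (simp_all add: shuffle_sign_def)

lemma form_of_1form_singleton: "form_of_1form \<alpha> $ {i} = \<alpha> $ i"
  by (simp add: form_of_1form_def)

lemma form_of_1form_other: "card I \<noteq> 1 \<Longrightarrow> form_of_1form \<alpha> $ I = 0"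
  by (auto simp: form_of_1form_def intro!: sum.neutral)

lemma ext_d_singleton: "ext_d \<omega> $ {i} = pdiff i (\<omega> $ {})"
  by (simp add: ext_d_def shuffle_sign_empty)

lemma ext_d_pair:
  assumes "i \<noteq> j"
  shows "ext_d (form_of_1form \<alpha>) $ {i, j}
    = shuffle_sign {i} {j} * (pdiff i (\<alpha> $ j) - pdiff j (\<alpha> $ i))"
proof -
  have "{i, j} - {i} = {j}" "{i, j} - {j} = {i}" using assms by auto
  then show ?thesis
    using assms
    by (simp add: ext_d_def form_of_1form_singleton shuffle_sign_swap[OF assms] right_diff_distrib)
qed

text \<open>Cartan's formula: the derivatives \<open>pdiff k (\<alpha> $ l)\<close> enter both terms
  with opposite signs and cancel.\<close>

lemma lie_deriv_form_of_1form:
  "lie_deriv X (form_of_1form \<alpha>) $ {k}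
    = vf_apply X (\<alpha> $ k) + (\<Sum>l\<in>UNIV. \<alpha> $ l * pdiff k (X $ l))"
proof -
  have "ext_d (contract X (form_of_1form \<alpha>)) $ {k}
      = (\<Sum>l\<in>UNIV. pdiff k (X $ l) * \<alpha> $ l + X $ l * pdiff k (\<alpha> $ l))"
    by (simp add: ext_d_singleton contract_def shuffle_sign_empty form_of_1form_singleton
        pdiff_mult sum_3 pdiff_add)
  moreover have "contract X (ext_d (form_of_1form \<alpha>)) $ {k}
      = (\<Sum>l\<in>- {k}. X $ l * (pdiff l (\<alpha> $ k) - pdiff k (\<alpha> $ l)))"
    unfolding contract_def vec_lambda_beta
  proof (rule sum.cong)
    fix l assume "l \<in> - {k}"
    then show "shuffle_sign {l} {k} * X $ l * ext_d (form_of_1form \<alpha>) $ {l, k}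
        = X $ l * (pdiff l (\<alpha> $ k) - pdiff k (\<alpha> $ l))"
      by (simp add: ext_d_pair shuffle_sign_singletons algebra_simps)
  qed simp
  \<comment> \<open>The summand at \<open>l = k\<close> is zero by antisymmetry, so the sum may run
    over all indices.\<close>
  moreover have "\<dots> = (\<Sum>l\<in>UNIV. X $ l * (pdiff l (\<alpha> $ k) - pdiff k (\<alpha> $ l)))"
    by (rule sum.mono_neutral_left) auto
  ultimately show ?thesis
    by (simp add: lie_deriv_def vf_apply_def sum.distrib[symmetric] algebra_simps)
qed

lemma even_on_odd_nth:
  "even_on_odd X A \<theta> $ k $ j =
     vf_apply X (\<theta> $ k $ j) + (\<Sum>l\<in>UNIV. \<theta> $ k $ l * pdiff j (X $ l))
     - pconst (1 / 2) * divergence X * \<theta> $ k $ j + (\<Sum>l\<in>UNIV. sl2_matrix A $ k $ l * \<theta> $ l $ j)"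
  by (simp add: even_on_odd_def coeffs_of_1form_def twisted_action_def lie_deriv_form_of_1form
      form_of_1form_singleton pconst_uminus[symmetric])
    (simp add: pconst_uminus)

section \<open>Cross product and curl as coordinates for wedge product and exterior derivative of
  one-forms\<close>

definition pcross :: "pser^3 \<Rightarrow> pser^3 \<Rightarrow> pser^3" where
  "pcross a b = vector [a $ 2 * b $ 3 - a $ 3 * b $ 2, a $ 3 * b $ 1 - a $ 1 * b $ 3,
     a $ 1 * b $ 2 - a $ 2 * b $ 1]"

definition curl :: "pser^3 \<Rightarrow> pser^3" where
  "curl a = vector [pdiff 2 (a $ 3) - pdiff 3 (a $ 2), pdiff 3 (a $ 1) - pdiff 1 (a $ 3),
     pdiff 1 (a $ 2) - pdiff 2 (a $ 1)]"

text \<open>The coefficient of da wedge b plus a wedge db, with two-forms read as vector fields. It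
  is symmetric in a and b, as the symmetric product on C^2 demands.\<close>

definition curl_pairing :: "pser^3 \<Rightarrow> pser^3 \<Rightarrow> pser" where
  "curl_pairing a b = (\<Sum>i\<in>UNIV. curl a $ i * b $ i + a $ i * curl b $ i)"

lemma Compl_singleton_3: "- {1::3} = {2, 3}" "- {2::3} = {1, 3}" "- {3::3} = {1, 2}"
  using exhaust_3 by auto

lemma wedge_1form_pair:
  assumes "i \<noteq> j"
  shows "(form_of_1form a \<and>\<^sub>f form_of_1form b) $ {i, j}
    = shuffle_sign {i} {j} * (a $ i * b $ j - a $ j * b $ i)"
proof -
  have "Pow {i, j} = {{}, {i}, {j}, {i, j}}" by auto
  moreover have "{i, j} - {i} = {j}" "{i, j} - {j} = {i}" using assms by auto
  ultimately show ?thesis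
    using assms
    by (simp add: wedge_def form_of_1form_singleton form_of_1form_other
        shuffle_sign_swap[OF assms] right_diff_distrib mult.assoc)
qed

lemma shuffle_sign_pair:
  assumes "i \<noteq> j"
  shows "shuffle_sign {k} {i, j} = shuffle_sign {k} {i} * shuffle_sign {k} {j}"
proof -
  have "{(a, b). a \<in> {k} \<and> b \<in> {i, j} \<and> b < a}
      = (if i < k then {(k, i)} else {}) \<union> (if j < k then {(k, j)} else {})"
    by auto
  then show ?thesis
    using assms by (simp only: shuffle_sign_singletons) (simp add: shuffle_sign_def)
qed

lemma shuffle_sign_pair':
  assumes "i \<noteq> j"
  shows "shuffle_sign {i, j} {k} = shuffle_sign {i} {k} * shuffle_sign {j} {k}"
proof -
  have "{(a, b). a \<in> {i, j} \<and> b \<in> {k} \<and> b < a}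
      = (if k < i then {(i, k)} else {}) \<union> (if k < j then {(j, k)} else {})"
    by auto
  then show ?thesis
    using assms by (simp only: shuffle_sign_singletons) (simp add: shuffle_sign_def)
qed

lemma vf_of_2form_wedge: "vf_of_2form (form_of_1form a \<and>\<^sub>f form_of_1form b) = pcross a b"
  by (simp add: vec_eq_iff forall_3 vf_of_2form_def Compl_singleton_3 wedge_1form_pair
      shuffle_sign_pair shuffle_sign_singletons less_3 pcross_def)

lemma sum_Pow_insert:
  assumes "finite A" "a \<notin> A"
  shows "sum f (Pow (insert a A)) = (\<Sum>B\<in>Pow A. f B) + (\<Sum>B\<in>Pow A. f (insert a B))"
proof -
  have "inj_on (insert a) (Pow A)"
    using assms(2) by (auto simp: inj_on_def insert_ident dest!: PowD)
  moreover have "Pow A \<inter> insert a ` Pow A = {}"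
    using assms(2) by auto
  ultimately show ?thesis
    using assms(1) by (simp add: Pow_insert sum.union_disjoint sum.reindex)
qed

lemma sum_Pow_3:
  "sum f (Pow (UNIV :: 3 set)) = f {} + f {1} + f {2} + f {3} + f {1, 2} + f {1, 3} + f {2, 3} + f UNIV"
  unfolding UNIV_3 by (simp add: sum_Pow_insert insert_commute ac_simps)

lemma fun_of_3form_curl:
  "fun_of_3form (ext_d (form_of_1form a) \<and>\<^sub>f form_of_1form b
     + form_of_1form a \<and>\<^sub>f ext_d (form_of_1form b)) = curl_pairing a b"
proof -
  have d: "UNIV - {1} = {2, 3::3}" "UNIV - {2} = {1, 3::3}" "UNIV - {3} = {1, 2::3}"
    "UNIV - {1, 2} = {3::3}" "UNIV - {1, 3} = {2::3}" "UNIV - {2, 3} = {1::3}"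
    using exhaust_3 by auto
  have "ext_d (form_of_1form c) $ {i} = 0" for c i
    by (simp add: ext_d_singleton form_of_1form_other pdiff_0)
  then show ?thesis
    by (simp add: fun_of_3form_def wedge_def sum_Pow_3[simplified] d form_of_1form_singleton form_of_1form_other
        ext_d_pair shuffle_sign_pair shuffle_sign_pair' shuffle_sign_singletons less_3
        curl_pairing_def sum_3 curl_def left_diff_distrib right_diff_distrib)
qed

text \<open>Only the pairs (v_1, v_2) and (v_2, v_1) contribute, with opposite signs.\<close>

lemma odd_odd_vf_eq: "odd_odd_vf \<theta> \<eta> = pcross (\<theta> $ 1) (\<eta> $ 2) - pcross (\<theta> $ 2) (\<eta> $ 1)"
  by (simp add: odd_odd_vf_def sum_2 vf_of_2form_wedge C2_wedge_def axis_def pconst_0 pconst_1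
      pconst_uminus vec_eq_iff)

lemma pconst_half: "pconst (1 / 2) * (2 * f) = f" "2 * (pconst (1 / 2) * f) = f"
proof -
  have *: "pconst (1 / 2) * 2 = 1"
    using pconst_mult[of "1 / 2" 2] by (simp add: pconst_1 pconst_numeral)
  then show "pconst (1 / 2) * (2 * f) = f"
    by (simp flip: mult.assoc)
  then show "2 * (pconst (1 / 2) * f) = f"
    by (simp only: mult.left_commute)
qed

lemma odd_odd_sl2_eq:
  "odd_odd_sl2 \<theta> \<eta> = (curl_pairing (\<theta> $ 1) (\<eta> $ 1), - curl_pairing (\<theta> $ 2) (\<eta> $ 2),
     - (pconst (1 / 2) * (curl_pairing (\<theta> $ 1) (\<eta> $ 2) + curl_pairing (\<theta> $ 2) (\<eta> $ 1))))"
  by (simp add: odd_odd_sl2_def sum_2 fun_of_3form_curl C2_dot_def axis_def pconst_0 pconst_1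
      pconst_uminus pconst_numeral pconst_half distrib_left zero_prod_def)

lemma sl2_bracket_eq:
  "sl2_bracket (e, f, h) (e', f', h') =
     (2 * (h * e' - h' * e), 2 * (f * h' - f' * h), e * f' - e' * f)"
  by (simp add: sl2_bracket_def sl2_of_matrix_def matrix_matrix_mult_def sum_2 algebra_simps)

section \<open>Nilpotent linear vector fields\<close>

lemma vf_apply_add: "vf_apply X (f + g) = vf_apply X f + vf_apply X g"
  by (simp add: vf_apply_def sum_3 pdiff_add algebra_simps)

lemma vf_apply_diff: "vf_apply X (f - g) = vf_apply X f - vf_apply X g"
  by (simp add: vf_apply_def sum_3 pdiff_diff algebra_simps)

lemma vf_apply_uminus: "vf_apply X (- f) = - vf_apply X f"
  by (simp add: vf_apply_def sum_3 pdiff_uminus algebra_simps)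

lemma vf_apply_mult: "vf_apply X (f * g) = vf_apply X f * g + f * vf_apply X g"
  by (simp add: vf_apply_def sum_3 pdiff_mult algebra_simps)

lemma vf_apply_pconst: "vf_apply X (pconst c) = 0"
  by (simp add: vf_apply_def pdiff_pconst)

lemma vf_apply_0: "vf_apply X 0 = 0"
  by (simp add: vf_apply_def pdiff_0)

lemma vf_apply_numeral: "vf_apply X (numeral n) = 0"
  using vf_apply_pconst[of X "numeral n"] by (simp add: pconst_numeral)

lemmas vf_apply_simps = vf_apply_add vf_apply_diff vf_apply_uminus vf_apply_mult vf_apply_pconst
  vf_apply_0 vf_apply_numeral

text \<open>The linear field l(x) w: its matrix has rank at most one, and square zero because l(w) =
  0. Its flow consists of transvections, which are able to move any nonzero covector to a multiple
  of dx_1.\<close>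

locale nilpotent_field =
  fixes l w :: "complex^3"
  assumes ortho: "(\<Sum>i\<in>UNIV. l $ i * w $ i) = 0"
begin

definition ell :: pser where
  "ell = (\<Sum>i\<in>UNIV. pconst (l $ i) * pvar i)"

definition field :: vfield where
  "field = (\<chi> k. pconst (w $ k) * ell)"

definition dw :: "pser \<Rightarrow> pser" where
  "dw f = (\<Sum>k\<in>UNIV. pconst (w $ k) * pdiff k f)"

abbreviation D :: "pser \<Rightarrow> pser" where
  "D \<equiv> vf_apply field"

lemma D_eq: "D f = ell * dw f"
  by (simp add: vf_apply_def field_def dw_def sum_distrib_left ac_simps)

lemma pdiff_ell: "pdiff k ell = pconst (l $ k)"
  using exhaust_3[of k]
  by (auto simp: ell_def sum_3 pdiff_add pdiff_pconst_mult pdiff_pvar)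

lemma dw_pdiff: "pdiff k (dw f) = dw (pdiff k f)"
  by (simp add: dw_def sum_3 pdiff_add pdiff_pconst_mult pdiff_commute[of k])

text \<open>The field has linear coefficients, so its commutator with a partial derivative has
  constant ones: it is a multiple of the derivative along w.\<close>

lemma pdiff_D: "pdiff k (D f) = D (pdiff k f) + pconst (l $ k) * dw f"
  by (simp add: D_eq pdiff_mult pdiff_ell dw_pdiff)

lemma ortho': "pconst (l $ 1) * pconst (w $ 1) + pconst (l $ 2) * pconst (w $ 2)
    + pconst (l $ 3) * pconst (w $ 3) = 0"
  using ortho by (simp add: sum_3 pconst_0 flip: pconst_mult pconst_add)

section \<open>Lie derivatives along the linear field and their compatibility with the natural
  operations\<close>

definition on_vf :: "vfield \<Rightarrow> vfield" where
  "on_vf Y = (\<chi> k. D (Y $ k) - pconst (w $ k) * (\<Sum>i\<in>UNIV. pconst (l $ i) * Y $ i))"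

definition on_1form :: "pser^3 \<Rightarrow> pser^3" where
  "on_1form a = (\<chi> j. D (a $ j) + pconst (l $ j) * (\<Sum>i\<in>UNIV. pconst (w $ i) * a $ i))"

lemma dw_eq: "dw f = pconst (w $ 1) * pdiff 1 f + pconst (w $ 2) * pdiff 2 f + pconst (w $ 3) * pdiff 3 f"
  by (simp add: dw_def sum_3)

text \<open>\<open>on_vf Y\<close> is the commutator of the derivations \<open>D\<close> and Y: the
  constant part of \<open>on_vf\<close> accounts for the commutators of \<open>D\<close> with the
  partial derivatives.\<close>

lemma D_vf_apply: "D (vf_apply Y f) = vf_apply (on_vf Y) f + vf_apply Y (D f)"
proof -
  have "vf_apply Y (D f) = (\<Sum>k\<in>UNIV. Y $ k * D (pdiff k f)) + (\<Sum>i\<in>UNIV. pconst (l $ i) * Y $ i) * dw f"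
    by (simp add: vf_apply_def[of Y] pdiff_D sum_3 algebra_simps)
  moreover have "vf_apply (on_vf Y) f
      = (\<Sum>k\<in>UNIV. D (Y $ k) * pdiff k f) - (\<Sum>i\<in>UNIV. pconst (l $ i) * Y $ i) * dw f"
    by (simp add: vf_apply_def[of "on_vf Y"]) (simp add: on_vf_def sum_3 dw_eq algebra_simps)
  ultimately show ?thesis
    by (simp add: vf_apply_def[of Y] sum_3 vf_apply_add vf_apply_mult)
qed

lemma on_vf_bracket: "on_vf (vf_bracket Y Z) = vf_bracket (on_vf Y) Z + vf_bracket Y (on_vf Z)"
  by (simp add: vec_eq_iff vf_bracket_def on_vf_def[of "\<chi> i. _ i"] vf_apply_diff D_vf_apply)
    (simp add: on_vf_def vf_apply_simps sum_3 algebra_simps)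

lemma vf_bracket_field: "vf_bracket field Y = on_vf Y"
proof -
  have "vf_apply Y (field $ k) = pconst (w $ k) * (\<Sum>i\<in>UNIV. pconst (l $ i) * Y $ i)" for k
    by (simp add: field_def vf_apply_mult vf_apply_pconst) (simp add: vf_apply_def pdiff_ell mult.commute)
  then show ?thesis
    by (simp add: vf_bracket_def on_vf_def vec_eq_iff)
qed

text \<open>Identifying two-forms with vector fields involves a twist by the divergence, so the
  product rule has a defect proportional to the divergence l(w) of the field, which is zero.\<close>

lemma on_vf_pcross: "on_vf (pcross a b) = pcross (on_1form a) b + pcross a (on_1form b)"
proof -
  have "pcross (on_1form a) b $ k + pcross a (on_1form b) $ k
      = on_vf (pcross a b) $ k
      + (pconst (l $ 1) * pconst (w $ 1) + pconst (l $ 2) * pconst (w $ 2) + pconst (l $ 3) * pconst (w $ 3)) * pcross a b $ k" for k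
    using exhaust_3[of k]
    by (elim disjE; simp add: pcross_def on_vf_def on_1form_def vf_apply_simps sum_3 algebra_simps)
  then show ?thesis
    by (simp add: ortho' vec_eq_iff)
qed

text \<open>Naturality of the exterior derivative; the defect is again a multiple of l(w).\<close>

lemma curl_on_1form: "curl (on_1form a) = on_vf (curl a)"
proof -
  have "curl (on_1form a) $ k
      = on_vf (curl a) $ k
      + (pconst (l $ 1) * pconst (w $ 1) + pconst (l $ 2) * pconst (w $ 2) + pconst (l $ 3) * pconst (w $ 3)) * curl a $ k" for k
    using exhaust_3[of k]
    by (elim disjE; simp add: curl_def on_vf_def on_1form_def vf_apply_simps sum_3
      pdiff_add pdiff_D pdiff_mult pdiff_pconst dw_eq algebra_simps)
  then show ?thesis
    by (simp add: ortho' vec_eq_iff)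
qed

lemma D_curl_pairing: "D (curl_pairing a b) = curl_pairing (on_1form a) b + curl_pairing a (on_1form b)"
  unfolding curl_pairing_def curl_on_1form
  by (simp add: sum_3 on_vf_def on_1form_def vf_apply_simps algebra_simps)

lemma D_divergence: "D (divergence Y) = divergence (on_vf Y)"
  by (simp add: divergence_def sum_3 on_vf_def vf_apply_simps pdiff_diff pdiff_add pdiff_D pdiff_mult
      pdiff_pconst dw_eq algebra_simps)

definition lie :: "vfield \<Rightarrow> pser^3 \<Rightarrow> pser^3" where
  "lie X a = (\<chi> j. vf_apply X (a $ j) + (\<Sum>i\<in>UNIV. a $ i * pdiff j (X $ i)))"

lemma on_1form_lie: "on_1form (lie Y a) = lie (on_vf Y) a + lie Y (on_1form a)"
  by (simp add: vec_eq_iff lie_def on_1form_def[of "\<chi> j. _ j"] vf_apply_add D_vf_apply)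
    (simp add: on_1form_def on_vf_def vf_apply_simps sum_3 pdiff_diff pdiff_D pdiff_add pdiff_pconst
      dw_eq vf_apply_def[of Y] pdiff_mult algebra_simps)

lemma divergence_field: "divergence field = 0"
proof -
  have "divergence field = (\<Sum>k\<in>UNIV. pconst (l $ k) * pconst (w $ k))"
    by (simp add: divergence_def field_def pdiff_mult pdiff_pconst pdiff_ell mult.commute)
  then show ?thesis
    using ortho' by (simp add: sum_3)
qed

lemma lie_field: "lie field a = on_1form a"
  by (simp add: lie_def on_1form_def field_def pdiff_mult pdiff_pconst pdiff_ell sum_distrib_left ac_simps)

lemma D_pconst_mult: "D (pconst c * f) = pconst c * D f"
  by (simp add: vf_apply_mult vf_apply_pconst)

definition ad_field :: "e36 \<Rightarrow> e36" where
  "ad_field = bracket36 (field, 0, 0)"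

lemma ad_field_eq:
  "ad_field (Y, (e, f, h), \<eta>) = (on_vf Y, (D e, D f, D h), \<chi> k. on_1form (\<eta> $ k))"
proof -
  have "even_on_odd field (0, 0, 0) \<eta> = (\<chi> k. on_1form (\<eta> $ k))"
    by (simp add: vec_eq_iff even_on_odd_nth divergence_field lie_field[symmetric] lie_def
       forall_2 sum_2)
  moreover have "even_on_odd Y (e, f, h) 0 = 0"
    by (simp add: vec_eq_iff even_on_odd_nth vf_apply_0)
  moreover have "odd_odd_vf 0 \<eta> = 0"
    by (simp add: odd_odd_vf_eq pcross_def vec_eq_iff forall_3)
  moreover have "odd_odd_sl2 0 \<eta> = 0"
    by (simp add: odd_odd_sl2_eq curl_pairing_def curl_def sum_3 pdiff_0 zero_prod_def)
  ultimately show ?thesis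
    by (simp add: ad_field_def zero_prod_def vf_bracket_field sl2_bracket_eq vf_apply_0)
qed

text \<open>The Jacobi identity for the one element that is to be exponentiated. The components of
  the bracket are built from wedge product, exterior derivative, divergence and Lie derivatives,
  with which the action of the field is compatible.\<close>

lemma ad_field_derivation:
  "ad_field (bracket36 x y) = bracket36 (ad_field x) y + bracket36 x (ad_field y)"
proof -
  obtain X e f h \<theta> where x: "x = (X, (e, f, h), \<theta>)"
    by (cases x) auto
  obtain Y e' f' h' \<eta> where y: "y = (Y, (e', f', h'), \<eta>)"
    by (cases y) auto
  have add: "on_vf (U + V) = on_vf U + on_vf V" "on_vf (U - V) = on_vf U - on_vf V" for U V
    by (simp_all add: on_vf_def vec_eq_iff vf_apply_simps sum_3 algebra_simps)
  have vf: "on_vf (vf_bracket X Y + odd_odd_vf \<theta> \<eta>) = vf_bracket (on_vf X) Y + vf_bracket X (on_vf Y)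
     + odd_odd_vf (\<chi> k. on_1form (\<theta> $ k)) \<eta> + odd_odd_vf \<theta> (\<chi> k. on_1form (\<eta> $ k))"
    by (simp add: odd_odd_vf_eq add on_vf_bracket on_vf_pcross)
  have odd: "on_1form (even_on_odd X (e, f, h) \<eta> $ k)
      = even_on_odd (on_vf X) (D e, D f, D h) \<eta> $ k + even_on_odd X (e, f, h) (\<chi> k. on_1form (\<eta> $ k)) $ k"
    for X e f h \<eta> k
  proof -
    define M where "M = sl2_matrix (e, f, h) $ k"
    have M: "sl2_matrix (D e, D f, D h) $ k $ i = D (M $ i)" for i
      using exhaust_2[of k] exhaust_2[of i] by (auto simp: M_def vf_apply_uminus)
    have *: "even_on_odd X (e, f, h) \<eta> $ k = lie X (\<eta> $ k) - (pconst (1 / 2) * divergence X) *s \<eta> $ k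
        + (M $ 1 *s \<eta> $ 1 + M $ 2 *s \<eta> $ 2)" for \<eta>
      by (simp add: vec_eq_iff even_on_odd_nth lie_def sum_2 M_def del: sl2_matrix.simps)
    have **: "even_on_odd (on_vf X) (D e, D f, D h) \<eta> $ k
        = lie (on_vf X) (\<eta> $ k) - (pconst (1 / 2) * D (divergence X)) *s \<eta> $ k
        + (D (M $ 1) *s \<eta> $ 1 + D (M $ 2) *s \<eta> $ 2)"
      by (simp add: vec_eq_iff even_on_odd_nth lie_def sum_2 M D_divergence del: sl2_matrix.simps)
    have add: "on_1form (a + b) = on_1form a + on_1form b" "on_1form (a - b) = on_1form a - on_1form b"
      "on_1form (c *s a) = D c *s a + c *s on_1form a" for a b c
      by (simp_all add: on_1form_def vec_eq_iff vf_apply_simps sum_3 algebra_simps)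
    show ?thesis
      by (simp add: * ** add on_1form_lie D_pconst_mult vec_eq_iff)
  qed
  have add1: "on_1form (a - b) = on_1form a - on_1form b" for a b
    by (simp add: on_1form_def vec_eq_iff vf_apply_simps sum_3 algebra_simps)
  show ?thesis
    by (simp add: x y ad_field_eq vf odd add1 sl2_bracket_eq odd_odd_sl2_eq
        vf_apply_simps D_vf_apply D_curl_pairing)
      (simp add: vec_eq_iff algebra_simps)
qed

section \<open>Powers of the linear form and topological nilpotency\<close>

lemma dw_mult: "dw (f * g) = dw f * g + f * dw g"
  by (simp add: dw_def sum_3 pdiff_mult algebra_simps)

lemma dw_ell: "dw ell = 0"
  using ortho' by (simp add: dw_def sum_3 pdiff_ell mult.commute)

text \<open>\<open>D\<close> is \<open>ell\<close> times the derivative along w; that derivative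
  kills \<open>ell\<close> and so passes through its powers.\<close>

lemma power_ell_dvd_D:
  assumes "ell ^ n dvd f"
  shows "ell ^ Suc n dvd D f"
proof -
  obtain g where f: "f = ell ^ n * g" using assms by (auto simp: dvd_def)
  have "dw (ell ^ n) = 0"
    by (induction n) (simp_all add: dw_mult dw_ell, simp add: dw_def pdiff_pconst flip: pconst_1)
  then have "D f = ell ^ Suc n * dw g"
    by (simp add: f D_eq dw_mult)
  then show ?thesis by simp
qed

text \<open>
  \<open>ad field\<close> is \<open>D\<close> plus a constant matrix of square \<open>0\<close>, whose image is killed by the
  contractions with \<open>l\<close> and \<open>w\<close> below.  Hence powers of \<open>ad field\<close> gain factors \<open>ell\<close>.
\<close>

fun ell_divisible :: "nat \<Rightarrow> e36 \<Rightarrow> bool" where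
  "ell_divisible n (Y, (e, f, h), \<eta>) \<longleftrightarrow>
     (\<forall>k. ell ^ (n - 1) dvd Y $ k) \<and> ell ^ n dvd (\<Sum>i\<in>UNIV. pconst (l $ i) * Y $ i) \<and>
     ell ^ n dvd e \<and> ell ^ n dvd f \<and> ell ^ n dvd h \<and>
     (\<forall>k j. ell ^ (n - 1) dvd \<eta> $ k $ j) \<and> (\<forall>k. ell ^ n dvd (\<Sum>i\<in>UNIV. pconst (w $ i) * \<eta> $ k $ i))"

lemma ell_divisible_ad_field:
  assumes "ell_divisible n x"
  shows "ell_divisible (Suc n) (ad_field x)"
proof -
  obtain Y e f h \<eta> where x: "x = (Y, (e, f, h), \<eta>)"
    by (cases x) auto
  \<comment> \<open>For \<open>n = 0\<close> the claim is trivial; otherwise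
    \<open>Suc (n - 1) = n\<close>.\<close>
  have *: "ell ^ n dvd D g" if "ell ^ (n - 1) dvd g" for g
    using power_ell_dvd_D[OF that] by (cases n) auto
  \<comment> \<open>Contracting the constant part with l or w produces the factor l(w) = 0. The
    contracted components therefore see only \<open>D\<close> and gain a full factor
    \<open>ell\<close>.\<close>
  have zero: "(\<Sum>i\<in>UNIV. pconst (l $ i) * (pconst (w $ i) * g)) = 0"
    "(\<Sum>i\<in>UNIV. pconst (w $ i) * (pconst (l $ i) * g)) = 0" for g
  proof -
    have "(\<Sum>i\<in>UNIV. pconst (l $ i) * (pconst (w $ i) * g))
        = (pconst (l $ 1) * pconst (w $ 1) + pconst (l $ 2) * pconst (w $ 2) + pconst (l $ 3) * pconst (w $ 3)) * g"
      "(\<Sum>i\<in>UNIV. pconst (w $ i) * (pconst (l $ i) * g))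
        = (pconst (l $ 1) * pconst (w $ 1) + pconst (l $ 2) * pconst (w $ 2) + pconst (l $ 3) * pconst (w $ 3)) * g"
      by (simp_all add: sum_3 algebra_simps)
    then show "(\<Sum>i\<in>UNIV. pconst (l $ i) * (pconst (w $ i) * g)) = 0"
      "(\<Sum>i\<in>UNIV. pconst (w $ i) * (pconst (l $ i) * g)) = 0"
      by (simp_all only: ortho' mult_zero_left)
  qed
  have "(\<Sum>i\<in>UNIV. pconst (l $ i) * on_vf Y $ i) = D (\<Sum>i\<in>UNIV. pconst (l $ i) * Y $ i)"
    by (simp add: on_vf_def right_diff_distrib sum_subtractf zero)
      (simp add: sum_3 vf_apply_add D_pconst_mult)
  moreover have "(\<Sum>i\<in>UNIV. pconst (w $ i) * on_1form a $ i) = D (\<Sum>i\<in>UNIV. pconst (w $ i) * a $ i)" for a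
    by (simp add: on_1form_def distrib_left sum.distrib zero)
      (simp add: sum_3 vf_apply_add D_pconst_mult)
  moreover have "ell ^ n dvd on_vf Y $ k" for k
    using assms by (auto simp: x on_vf_def intro!: dvd_diff *)
  moreover have "ell ^ n dvd on_1form (\<eta> $ k) $ j" for k j
    using assms by (auto simp: x on_1form_def intro!: dvd_add *)
  ultimately show ?thesis
    using assms power_ell_dvd_D by (simp add: x ad_field_eq del: power_Suc)
qed

lemma ell_divisible_ad_field_power: "ell_divisible n ((ad_field ^^ n) x)"
proof (induction n)
  case 0
  then show ?case by (cases x) auto
qed (simp add: ell_divisible_ad_field)

end

fun wge36 :: "nat^3 \<Rightarrow> nat \<Rightarrow> e36 \<Rightarrow> bool" where
  "wge36 s n (Y, (e, f, h), \<eta>) \<longleftrightarrow> (\<forall>i. wge s n (Y $ i)) \<and>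
     wge s n e \<and> wge s n f \<and> wge s n h \<and> (\<forall>k j. wge s n (\<eta> $ k $ j))"

lemma (in nilpotent_field) wge_ell_power: "wge s n (ell ^ n)"
proof (induction n)
  case (Suc n)
  have "wge s 1 ell"
    by (simp only: wge_1_iff) (simp add: ell_def sum_3 ev_simps)
  from wge_mult[OF this Suc] show ?case by simp
qed (rule wge_zero)

text \<open>One application may be spent on the constant nilpotent part; each further one
  contributes a factor \<open>ell\<close>, which vanishes at the origin.\<close>

lemma (in nilpotent_field) wge36_ad_field_power: "wge36 s n ((ad_field ^^ Suc n) x)"
proof -
  have dvd: "wge s n f" if "ell ^ n dvd f" for f
    using that wge_ell_power wge_mult_right by (auto simp: dvd_def)
  obtain Y e f h \<eta> where x: "(ad_field ^^ Suc n) x = (Y, (e, f, h), \<eta>)"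
    by (cases "(ad_field ^^ Suc n) x") auto
  then show ?thesis
    using ell_divisible_ad_field_power[of "Suc n" x] dvd dvd_mult_right[of ell "ell ^ n"]
    by (simp add: x del: funpow.simps)
qed

section \<open>Nilpotent constant matrices\<close>

text \<open>The condition says that the traceless matrix with rows (H, E) and (F, -H) has
  determinant zero, equivalently square zero.\<close>

locale nilpotent_matrix =
  fixes E F H :: complex
  assumes nilpotent: "H * H + E * F = 0"
begin

definition matrix :: e36 where
  "matrix = (0, (pconst E, pconst F, pconst H), 0)"

lemma nilpotent': "pconst H * pconst H + pconst E * pconst F = 0"
  using nilpotent by (simp add: pconst_0 flip: pconst_mult pconst_add)

definition on_odd :: "odd36 \<Rightarrow> odd36" where
  "on_odd \<eta> = vector [pconst H *s \<eta> $ 1 + pconst E *s \<eta> $ 2, pconst F *s \<eta> $ 1 - pconst H *s \<eta> $ 2]"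

lemma ad_matrix_eq:
  "bracket36 matrix (Y, B, \<eta>) = (0, sl2_bracket (pconst E, pconst F, pconst H) B, on_odd \<eta>)"
proof -
  obtain e f h where B: "B = (e, f, h)" by (cases B) auto
  have "even_on_odd 0 (pconst E, pconst F, pconst H) \<eta> = on_odd \<eta>"
    by (simp add: vec_eq_iff even_on_odd_nth divergence_def vf_apply_def
       forall_2 sum_2 on_odd_def pdiff_0)
  moreover have "even_on_odd Y (e, f, h) 0 = 0"
    by (simp add: vec_eq_iff even_on_odd_nth vf_apply_0)
  moreover have "odd_odd_vf 0 \<eta> = 0"
    by (simp add: odd_odd_vf_eq pcross_def vec_eq_iff forall_3)
  moreover have "odd_odd_sl2 0 \<eta> = 0"
    by (simp add: odd_odd_sl2_eq curl_pairing_def curl_def sum_3 pdiff_0 zero_prod_def)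
  moreover have "vf_apply 0 g = 0" for g
    by (simp add: vf_apply_def)
  ultimately show ?thesis
    by (simp add: B matrix_def sl2_bracket_eq vf_apply_pconst vf_apply_0 vf_bracket_def vec_eq_iff)
qed

lemma ad_matrix_derivation:
  "bracket36 matrix (bracket36 x y) = bracket36 (bracket36 matrix x) y + bracket36 x (bracket36 matrix y)"
proof -
  obtain X e f h \<theta> where x: "x = (X, (e, f, h), \<theta>)"
    by (cases x) auto
  obtain Y e' f' h' \<eta> where y: "y = (Y, (e', f', h'), \<eta>)"
    by (cases y) auto
  have pcross: "pcross (a + b) c = pcross a c + pcross b c" "pcross (a - b) c = pcross a c - pcross b c"
    "pcross c (a + b) = pcross c a + pcross c b" "pcross c (a - b) = pcross c a - pcross c b"
    "pcross (g *s a) c = g *s pcross a c" "pcross c (g *s a) = g *s pcross c a" for a b c g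
    by (simp_all add: pcross_def vec_eq_iff forall_3 algebra_simps)
  \<comment> \<open>The wedge product on C^2 is invariant under traceless matrices.\<close>
  have vf: "odd_odd_vf (on_odd \<theta>) \<eta> + odd_odd_vf \<theta> (on_odd \<eta>) = 0"
    by (simp add: odd_odd_vf_eq on_odd_def pcross)
  have pair: "curl_pairing (a + b) c = curl_pairing a c + curl_pairing b c"
    "curl_pairing (a - b) c = curl_pairing a c - curl_pairing b c"
    "curl_pairing c (a + b) = curl_pairing c a + curl_pairing c b"
    "curl_pairing c (a - b) = curl_pairing c a - curl_pairing c b"
    "curl_pairing (pconst z *s a) c = pconst z * curl_pairing a c"
    "curl_pairing c (pconst z *s a) = pconst z * curl_pairing c a" for a b c z
    by (simp_all add: curl_pairing_def curl_def sum_3 pdiff_simps algebra_simps)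
  have vf_bracket_0: "vf_bracket 0 U = 0" "vf_bracket U 0 = 0" for U
    by (simp_all add: vf_bracket_def vec_eq_iff vf_apply_0) (simp_all add: vf_apply_def)
  have vf_apply_0': "vf_apply 0 g = 0" "divergence 0 = 0" for g
    by (simp_all add: vf_apply_def divergence_def pdiff_0)
  have odd: "on_odd (even_on_odd X (e, f, h) \<eta>)
      = even_on_odd 0 (sl2_bracket (pconst E, pconst F, pconst H) (e, f, h)) \<eta>
      + even_on_odd X (e, f, h) (on_odd \<eta>)" for X e f h \<eta>
    by (simp add: vec_eq_iff even_on_odd_nth forall_2 sum_2 sl2_bracket_eq on_odd_def sum_3
        vf_apply_simps vf_apply_0' pdiff_0 algebra_simps)
  have diff: "on_odd (a - b) = on_odd a - on_odd b" for a b
    by (simp add: on_odd_def vec_eq_iff forall_2 algebra_simps)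
  have on_odd_nth: "on_odd \<eta> $ 1 = pconst H *s \<eta> $ 1 + pconst E *s \<eta> $ 2"
    "on_odd \<eta> $ 2 = pconst F *s \<eta> $ 1 - pconst H *s \<eta> $ 2" for \<eta>
    by (simp_all add: on_odd_def)
  have sl2: "sl2_bracket (pconst E, pconst F, pconst H)
        (sl2_vf_apply X (e', f', h') - sl2_vf_apply Y (e, f, h)
         + sl2_bracket (e, f, h) (e', f', h') + odd_odd_sl2 \<theta> \<eta>)
     = (- sl2_vf_apply Y (sl2_bracket (pconst E, pconst F, pconst H) (e, f, h))
         + sl2_bracket (sl2_bracket (pconst E, pconst F, pconst H) (e, f, h)) (e', f', h')
         + odd_odd_sl2 (on_odd \<theta>) \<eta>)
     + (sl2_vf_apply X (sl2_bracket (pconst E, pconst F, pconst H) (e', f', h'))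
         + sl2_bracket (e, f, h) (sl2_bracket (pconst E, pconst F, pconst H) (e', f', h'))
         + odd_odd_sl2 \<theta> (on_odd \<eta>))"
    by (simp add: sl2_bracket_eq odd_odd_sl2_eq on_odd_nth pair vf_apply_simps)
      (simp add: algebra_simps pconst_half)
  have "vf_apply 0 g = 0" for g
    by (simp add: vf_apply_def)
  then have "sl2_vf_apply 0 A = 0" for A
    by (cases A) (auto simp: zero_prod_def)
  then show ?thesis
    using vf by (simp add: x y ad_matrix_eq sl2 diff odd vf_bracket_0 del: sl2_vf_apply.simps)
qed

end

section \<open>Bilinearity of the bracket\<close>

lemma vf_apply_add_left: "vf_apply (X + Y) f = vf_apply X f + vf_apply Y f"
  by (simp add: vf_apply_def sum_3 algebra_simps)

lemma vf_apply_scale_left: "vf_apply (g *s X) f = g * vf_apply X f"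
  by (simp add: vf_apply_def sum_3 algebra_simps)

lemma even_part_plus_odd_part: "even_part x + odd_part x = x"
  by (cases x) simp

lemma bracket36_add_right: "bracket36 x (y + z) = bracket36 x y + bracket36 x z"
proof -
  obtain X e f h \<theta> where x: "x = (X, (e, f, h), \<theta>)" by (cases x) auto
  obtain Y e' f' h' \<eta> where y: "y = (Y, (e', f', h'), \<eta>)" by (cases y) auto
  obtain Z e'' f'' h'' \<zeta> where z: "z = (Z, (e'', f'', h''), \<zeta>)" by (cases z) auto
  have "vf_bracket X (Y + Z) + odd_odd_vf \<theta> (\<eta> + \<zeta>)
      = (vf_bracket X Y + odd_odd_vf \<theta> \<eta>) + (vf_bracket X Z + odd_odd_vf \<theta> \<zeta>)"
    by (simp add: vec_eq_iff forall_3 vf_bracket_def odd_odd_vf_eq pcross_def vf_apply_add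
        vf_apply_add_left algebra_simps)
  moreover have "sl2_vf_apply X (e' + e'', f' + f'', h' + h'') - sl2_vf_apply (Y + Z) (e, f, h)
      + sl2_bracket (e, f, h) (e' + e'', f' + f'', h' + h'') + odd_odd_sl2 \<theta> (\<eta> + \<zeta>)
      = sl2_vf_apply X (e', f', h') - sl2_vf_apply Y (e, f, h)
      + sl2_bracket (e, f, h) (e', f', h') + odd_odd_sl2 \<theta> \<eta> +
      (sl2_vf_apply X (e'', f'', h'') - sl2_vf_apply Z (e, f, h)
      + sl2_bracket (e, f, h) (e'', f'', h'') + odd_odd_sl2 \<theta> \<zeta>)"
    by (simp add: sl2_bracket_eq odd_odd_sl2_eq vf_apply_add vf_apply_add_left curl_pairing_def curl_def
        sum_3 pdiff_add algebra_simps)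
  moreover have "even_on_odd X (e, f, h) (\<eta> + \<zeta>) - even_on_odd (Y + Z) (e' + e'', f' + f'', h' + h'') \<theta>
     = even_on_odd X (e, f, h) \<eta> - even_on_odd Y (e', f', h') \<theta>
     + (even_on_odd X (e, f, h) \<zeta> - even_on_odd Z (e'', f'', h'') \<theta>)"
    by (simp add: vec_eq_iff even_on_odd_nth forall_2 sum_2 sum_3 vf_apply_add vf_apply_add_left
        divergence_def pdiff_add algebra_simps)
  ultimately show ?thesis
    by (simp add: x y z del: sl2_vf_apply.simps)
qed

lemma bracket36_add_left: "bracket36 (x + z) y = bracket36 x y + bracket36 z y"
proof -
  obtain X e f h \<theta> where x: "x = (X, (e, f, h), \<theta>)" by (cases x) auto
  obtain Y e' f' h' \<eta> where y: "y = (Y, (e', f', h'), \<eta>)" by (cases y) auto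
  obtain Z e'' f'' h'' \<zeta> where z: "z = (Z, (e'', f'', h''), \<zeta>)" by (cases z) auto
  have "vf_bracket (X + Z) Y + odd_odd_vf (\<theta> + \<zeta>) \<eta>
      = (vf_bracket X Y + odd_odd_vf \<theta> \<eta>) + (vf_bracket Z Y + odd_odd_vf \<zeta> \<eta>)"
    by (simp add: vec_eq_iff forall_3 vf_bracket_def odd_odd_vf_eq pcross_def vf_apply_add
        vf_apply_add_left algebra_simps)
  moreover have "sl2_vf_apply (X + Z) (e', f', h') - sl2_vf_apply Y (e + e'', f + f'', h + h'')
      + sl2_bracket (e + e'', f + f'', h + h'') (e', f', h') + odd_odd_sl2 (\<theta> + \<zeta>) \<eta>
      = sl2_vf_apply X (e', f', h') - sl2_vf_apply Y (e, f, h)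
      + sl2_bracket (e, f, h) (e', f', h') + odd_odd_sl2 \<theta> \<eta> +
      (sl2_vf_apply Z (e', f', h') - sl2_vf_apply Y (e'', f'', h'')
      + sl2_bracket (e'', f'', h'') (e', f', h') + odd_odd_sl2 \<zeta> \<eta>)"
    by (simp add: sl2_bracket_eq odd_odd_sl2_eq vf_apply_add vf_apply_add_left curl_pairing_def curl_def
        sum_3 pdiff_add algebra_simps)
  moreover have "even_on_odd (X + Z) (e + e'', f + f'', h + h'') \<eta> - even_on_odd Y (e', f', h') (\<theta> + \<zeta>)
     = even_on_odd X (e, f, h) \<eta> - even_on_odd Y (e', f', h') \<theta>
     + (even_on_odd Z (e'', f'', h'') \<eta> - even_on_odd Y (e', f', h') \<zeta>)"
    by (simp add: vec_eq_iff even_on_odd_nth forall_2 sum_2 sum_3 vf_apply_add vf_apply_add_left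
        divergence_def pdiff_add algebra_simps)
  ultimately show ?thesis
    by (simp add: x y z del: sl2_vf_apply.simps)
qed

lemma bracket36_scale_right: "bracket36 x (scale36 c y) = scale36 c (bracket36 x y)"
proof -
  obtain X e f h \<theta> where x: "x = (X, (e, f, h), \<theta>)" by (cases x) auto
  obtain Y e' f' h' \<eta> where y: "y = (Y, (e', f', h'), \<eta>)" by (cases y) auto
  have p: "pdiff i (pconst c * g) = pconst c * pdiff i g" "vf_apply X (pconst c * g) = pconst c * vf_apply X g" for i X g
    by (simp_all add: pdiff_pconst_mult vf_apply_mult vf_apply_pconst)
  show ?thesis
    by (simp add: x y sl2_bracket_eq odd_odd_sl2_eq vec_eq_iff forall_2 forall_3 sum_2 sum_3
       vf_bracket_def odd_odd_vf_eq pcross_def p vf_apply_scale_left even_on_odd_nth divergence_def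
       curl_pairing_def curl_def)
      (simp add: algebra_simps)
qed

lemma bracket36_scale_left: "bracket36 (scale36 c x) y = scale36 c (bracket36 x y)"
proof -
  obtain X e f h \<theta> where x: "x = (X, (e, f, h), \<theta>)" by (cases x) auto
  obtain Y e' f' h' \<eta> where y: "y = (Y, (e', f', h'), \<eta>)" by (cases y) auto
  have p: "pdiff i (pconst c * g) = pconst c * pdiff i g" "vf_apply X (pconst c * g) = pconst c * vf_apply X g" for i X g
    by (simp_all add: pdiff_pconst_mult vf_apply_mult vf_apply_pconst)
  show ?thesis
    by (simp add: x y sl2_bracket_eq odd_odd_sl2_eq vec_eq_iff forall_2 forall_3 sum_2 sum_3
       vf_bracket_def odd_odd_vf_eq pcross_def p vf_apply_scale_left even_on_odd_nth divergence_def
       curl_pairing_def curl_def)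
      (simp add: algebra_simps)
qed

lemma bracket36_diff_right: "bracket36 x (y - z) = bracket36 x y - bracket36 x z"
  by (metis add_diff_cancel bracket36_add_right diff_add_cancel)

lemma bracket36_diff_left: "bracket36 (x - z) y = bracket36 x y - bracket36 z y"
  by (metis add_diff_cancel bracket36_add_left diff_add_cancel)

lemma bracket36_0_right: "bracket36 x 0 = 0"
  using bracket36_diff_right[of x 0 0] by simp

lemma bracket36_0_left: "bracket36 0 x = 0"
  using bracket36_diff_left[of 0 0 x] by simp

lemma bracket36_sum_right: "bracket36 x (sum f A) = (\<Sum>i\<in>A. bracket36 x (f i))"
  by (induction A rule: infinite_finite_induct) (auto simp: bracket36_0_right bracket36_add_right)

lemma bracket36_sum_left: "bracket36 (sum f A) x = (\<Sum>i\<in>A. bracket36 (f i) x)"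
  by (induction A rule: infinite_finite_induct) (auto simp: bracket36_0_left bracket36_add_left)

lemma bracket36_even_part:
  assumes "even_part a = a"
  shows "bracket36 a (even_part x) = even_part (bracket36 a x)"
proof -
  obtain X A where a: "a = (X, A, 0)" using assms by (cases a) auto
  obtain Y B \<eta> where x: "x = (Y, B, \<eta>)" by (cases x) auto
  have "odd_odd_vf 0 \<eta> = 0" for \<eta>
    by (simp add: odd_odd_vf_eq pcross_def vec_eq_iff forall_3)
  moreover have "odd_odd_sl2 0 \<eta> = 0" for \<eta>
    by (simp add: odd_odd_sl2_eq curl_pairing_def curl_def sum_3 pdiff_0 zero_prod_def)
  moreover have "even_on_odd X A 0 = 0" for X A
    by (simp add: vec_eq_iff even_on_odd_nth vf_apply_0)
  ultimately show ?thesis by (simp add: a x)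
qed

section \<open>Coefficients\<close>

fun mon_exp :: "monomial36 \<Rightarrow> nat^3" where
  "mon_exp (MonVF m i) = m"
| "mon_exp (MonE m) = m"
| "mon_exp (MonF m) = m"
| "mon_exp (MonH m) = m"
| "mon_exp (MonOdd m i k) = m"

lemma wge36_iff: "wge36 s n x \<longleftrightarrow> (\<forall>\<beta>. weight s (mon_exp \<beta>) < n \<longrightarrow> coeff36 x \<beta> = 0)"
proof -
  obtain X e f h \<theta> where x: "x = (X, (e, f, h), \<theta>)" by (cases x) auto
  show ?thesis
  proof
    assume w: "wge36 s n x"
    show "\<forall>\<beta>. weight s (mon_exp \<beta>) < n \<longrightarrow> coeff36 x \<beta> = 0"
    proof
      fix \<beta>
      show "weight s (mon_exp \<beta>) < n \<longrightarrow> coeff36 x \<beta> = 0"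
        using w by (cases \<beta>) (auto simp: x wge_def)
    qed
  next
    assume "\<forall>\<beta>. weight s (mon_exp \<beta>) < n \<longrightarrow> coeff36 x \<beta> = 0"
    then have *: "weight s (mon_exp \<beta>) < n \<Longrightarrow> coeff36 x \<beta> = 0" for \<beta> by blast
    show "wge36 s n x"
      using *[of "MonVF _ _"] *[of "MonE _"] *[of "MonF _"] *[of "MonH _"] *[of "MonOdd _ _ _"]
      by (auto simp: x wge_def)
  qed
qed

definition of_coeffs :: "(monomial36 \<Rightarrow> complex) \<Rightarrow> e36" where
  "of_coeffs c = (\<chi> i. Abs_pser (\<lambda>m. c (MonVF m i)),
     (Abs_pser (\<lambda>m. c (MonE m)), Abs_pser (\<lambda>m. c (MonF m)), Abs_pser (\<lambda>m. c (MonH m))),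
     \<chi> k i. Abs_pser (\<lambda>m. c (MonOdd m i k)))"

lemma coeff36_of_coeffs: "coeff36 (of_coeffs c) \<beta> = c \<beta>"
  by (cases \<beta>) (simp_all add: of_coeffs_def)

lemma coeff36_eqI:
  assumes "\<And>\<beta>. coeff36 x \<beta> = coeff36 y \<beta>"
  shows "x = y"
proof -
  obtain X e f h \<theta> where x: "x = (X, (e, f, h), \<theta>)" by (cases x) auto
  obtain Y e' f' h' \<eta> where y: "y = (Y, (e', f', h'), \<eta>)" by (cases y) auto
  show ?thesis
    using assms[of "MonVF _ _"] assms[of "MonE _"] assms[of "MonF _"] assms[of "MonH _"]
      assms[of "MonOdd _ _ _"]
    by (auto simp: x y vec_eq_iff intro!: pser_eqI)
qed

lemma coeff36_add: "coeff36 (x + y) \<beta> = coeff36 x \<beta> + coeff36 y \<beta>"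
proof -
  obtain X e f h \<theta> where x: "x = (X, (e, f, h), \<theta>)" by (cases x) auto
  obtain Y e' f' h' \<eta> where y: "y = (Y, (e', f', h'), \<eta>)" by (cases y) auto
  show ?thesis by (cases \<beta>) (simp_all add: x y pcoeff_add)
qed

lemma coeff36_scale: "coeff36 (scale36 c x) \<beta> = c * coeff36 x \<beta>"
proof -
  obtain X e f h \<theta> where x: "x = (X, (e, f, h), \<theta>)" by (cases x) auto
  show ?thesis by (cases \<beta>) (simp_all add: x pcoeff_pconst_mult)
qed

lemma coeff36_0: "coeff36 0 \<beta> = 0"
  by (cases \<beta>) (simp_all add: zero_prod_def pcoeff_0)

lemma coeff36_diff: "coeff36 (x - y) \<beta> = coeff36 x \<beta> - coeff36 y \<beta>"
  by (metis add_diff_cancel coeff36_add diff_add_cancel)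

lemma coeff36_sum: "coeff36 (sum f A) \<beta> = (\<Sum>a\<in>A. coeff36 (f a) \<beta>)"
  by (induction A rule: infinite_finite_induct) (auto simp: coeff36_0 coeff36_add)

lemma coeff36_even_part: "coeff36 (even_part x) \<beta> = (case \<beta> of MonOdd m i k \<Rightarrow> 0 | _ \<Rightarrow> coeff36 x \<beta>)"
proof -
  obtain X e f h \<theta> where x: "x = (X, (e, f, h), \<theta>)" by (cases x) auto
  show ?thesis by (cases \<beta>) (simp_all add: x pcoeff_0)
qed

lemma finite_mon_exp: "finite {\<beta>. weight s (mon_exp \<beta>) < n}"
proof (rule finite_subset)
  let ?M = "{m. weight s m \<le> n}"
  show "{\<beta>. weight s (mon_exp \<beta>) < n} \<subseteq> (\<lambda>(m, i). MonVF m i) ` (?M \<times> UNIV) \<union> MonE ` ?M \<union> MonF ` ?M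
      \<union> MonH ` ?M \<union> (\<lambda>(m, i, k). MonOdd m i k) ` (?M \<times> UNIV \<times> UNIV)"
  proof
    fix \<beta> assume "\<beta> \<in> {\<beta>. weight s (mon_exp \<beta>) < n}"
    then show "\<beta> \<in> (\<lambda>(m, i). MonVF m i) ` (?M \<times> UNIV) \<union> MonE ` ?M \<union> MonF ` ?M
      \<union> MonH ` ?M \<union> (\<lambda>(m, i, k). MonOdd m i k) ` (?M \<times> UNIV \<times> UNIV)"
      by (cases \<beta>) (auto simp: image_iff)
  qed
qed (simp add: finite_weight_le)

lemma wge36_add: "wge36 s n x \<Longrightarrow> wge36 s n y \<Longrightarrow> wge36 s n (x + y)"
  and wge36_diff: "wge36 s n x \<Longrightarrow> wge36 s n y \<Longrightarrow> wge36 s n (x - y)"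
  and wge36_scale: "wge36 s n x \<Longrightarrow> wge36 s n (scale36 c x)"
  and wge36_0: "wge36 s n 0"
  and wge36_sum: "(\<And>a. a \<in> A \<Longrightarrow> wge36 s n (g a)) \<Longrightarrow> wge36 s n (sum g A)"
  by (simp_all add: wge36_iff coeff36_add coeff36_diff coeff36_scale coeff36_0 coeff36_sum)

lemma wge36_mono: "wge36 s n x \<Longrightarrow> k \<le> n \<Longrightarrow> wge36 s k x"
  unfolding wge36_iff using less_le_trans by blast

lemma wge36_eqI: "(\<And>n. wge36 s n (x - y)) \<Longrightarrow> x = y"
  by (rule coeff36_eqI) (metis wge36_iff coeff36_diff lessI right_minus_eq)

section \<open>Continuity of the bracket\<close>

lemmas wge_intros = wge_0 wge_add wge_diff wge_uminus wge_sum

lemma wge_vf_apply: "(\<And>i. wge 0 n (X $ i)) \<Longrightarrow> wge 0 n (vf_apply X f)"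
  by (simp add: vf_apply_def wge_sum wge_mult_right)

lemma wge_pdiff_0: "wge 0 (Suc n) f \<Longrightarrow> wge 0 n (pdiff i f)"
  using wge_pdiff[of 0 n i f] by simp

lemma wge_vf_apply': "wge 0 (Suc n) f \<Longrightarrow> wge 0 n (vf_apply X f)"
  by (simp add: vf_apply_def wge_sum wge_mult_left wge_pdiff_0)

lemma wge_curl_pairing:
  assumes "\<And>i. wge 0 (Suc n) (a $ i)"
  shows "wge 0 n (curl_pairing a b)" "wge 0 n (curl_pairing b a)"
proof -
  have "wge 0 n (a $ i)" for i
    using assms wge_mono le_SucI by blast
  then show "wge 0 n (curl_pairing a b)" "wge 0 n (curl_pairing b a)"
    by (auto simp: curl_pairing_def curl_def sum_3 assms wge_pdiff_0
        intro!: wge_intros intro: wge_mult_left wge_mult_right)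
qed

text \<open>Every term of the bracket differentiates \<open>y\<close> at most once, so at most one
  order of vanishing is lost.\<close>

lemma wge36_bracket_right:
  assumes "wge36 0 (Suc n) y"
  shows "wge36 0 n (bracket36 x y)"
proof -
  obtain X e f h \<theta> where x: "x = (X, (e, f, h), \<theta>)" by (cases x) auto
  obtain Y e' f' h' \<eta> where y: "y = (Y, (e', f', h'), \<eta>)" by (cases y) auto
  have S: "\<And>i. wge 0 (Suc n) (Y $ i)" "wge 0 (Suc n) e'" "wge 0 (Suc n) f'" "wge 0 (Suc n) h'"
    "\<And>k j. wge 0 (Suc n) (\<eta> $ k $ j)"
    using assms by (auto simp: y)
  then have n: "\<And>i. wge 0 n (Y $ i)" "wge 0 n e'" "wge 0 n f'" "wge 0 n h'" "\<And>k j. wge 0 n (\<eta> $ k $ j)"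
    using wge_mono le_SucI by blast+
  have vf: "wge 0 n ((vf_bracket X Y + odd_odd_vf \<theta> \<eta>) $ i)" for i
    using exhaust_3[of i] S n
    by (auto simp: vf_bracket_def odd_odd_vf_eq pcross_def wge_vf_apply wge_vf_apply'
        wge_mult_left wge_mult_right intro!: wge_intros)
  have div: "wge 0 n (divergence Y)"
    using S by (simp add: divergence_def wge_sum wge_pdiff_0)
  have odd: "wge 0 n (even_on_odd X (e, f, h) \<eta> $ k $ j - even_on_odd Y (e', f', h') \<theta> $ k $ j)" for k j
    using exhaust_2[of k] S n div
    by (auto simp: even_on_odd_nth sum_2 sum_3 wge_vf_apply wge_vf_apply' wge_pdiff_0
        intro!: wge_intros intro: wge_mult_left wge_mult_right)
  have two: "wge 0 n (2 * g)" if "wge 0 n g" for g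
    using that by (rule wge_mult_left)
  show ?thesis
    using vf odd S n
    by (auto simp: x y sl2_bracket_eq odd_odd_sl2_eq wge_vf_apply wge_vf_apply' wge_curl_pairing
        intro!: wge_intros two intro: wge_mult_left wge_mult_right)
qed

text \<open>Super skew-symmetry: symmetric on two odd arguments, antisymmetric otherwise. It carries
  estimates from the right argument over to the left one.\<close>

lemma bracket36_swap: "bracket36 x y = bracket36 (odd_part y) (odd_part x) + bracket36 (odd_part y) (odd_part x)
    - bracket36 y x"
proof -
  obtain X e f h \<theta> where x: "x = (X, (e, f, h), \<theta>)" by (cases x) auto
  obtain Y e' f' h' \<eta> where y: "y = (Y, (e', f', h'), \<eta>)" by (cases y) auto
  have "curl_pairing a b = curl_pairing b a" for a b
    by (simp add: curl_pairing_def ac_simps)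
  then have sl2: "odd_odd_sl2 \<eta> \<theta> = odd_odd_sl2 \<theta> \<eta>"
    by (simp add: odd_odd_sl2_eq add.commute)
  have vf: "odd_odd_vf \<eta> \<theta> = odd_odd_vf \<theta> \<eta>"
    by (simp add: odd_odd_vf_eq pcross_def vec_eq_iff forall_3)
  have zero: "vf_bracket 0 0 = 0" "sl2_vf_apply 0 0 = 0" "sl2_bracket 0 0 = 0" "even_on_odd 0 0 \<zeta> = 0" for \<zeta>
    by (simp_all add: zero_prod_def vf_bracket_def vf_apply_def sl2_bracket_eq vec_eq_iff
        even_on_odd_nth pdiff_0 divergence_def sum_2 forall_2)
  show ?thesis
    by (simp add: x y vf sl2 zero)
      (simp add: vf_bracket_def sl2_bracket_eq vec_eq_iff odd_odd_sl2_eq)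
qed

lemma wge36_bracket_left:
  assumes "wge36 0 (Suc n) x"
  shows "wge36 0 n (bracket36 x y)"
proof -
  have "wge36 0 (Suc n) (odd_part x)"
    using assms by (cases x) (auto simp: wge_0 zero_prod_def)
  then show ?thesis
    unfolding bracket36_swap[of x y]
    by (intro wge36_diff wge36_add wge36_bracket_right assms)
qed

section \<open>The topology\<close>

text \<open>Any finite set of coordinates lies below some order, and only finitely many monomials
  lie below a given order; so the filtration by order and the product topology have the same
  neighbourhoods.\<close>

lemma openin_lc_topology_iff:
  "openin lc_topology U \<longleftrightarrow> (\<forall>x\<in>U. \<exists>n. \<forall>y. wge36 0 n (y - x) \<longrightarrow> y \<in> U)"
proof
  assume "openin lc_topology U"
  then obtain V where V: "openin (product_topology (\<lambda>_. discrete_topology UNIV) UNIV) V"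
    and U: "U = coeff36 -` V"
    by (auto simp: lc_topology_def openin_pullback_topology)
  show "\<forall>x\<in>U. \<exists>n. \<forall>y. wge36 0 n (y - x) \<longrightarrow> y \<in> U"
  proof
    fix x assume "x \<in> U"
    with V U obtain B where fin: "finite {\<beta>. B \<beta> \<noteq> UNIV}"
      and x: "coeff36 x \<in> Pi\<^sub>E UNIV B" and sub: "Pi\<^sub>E UNIV B \<subseteq> V"
      unfolding openin_product_topology_alt by fastforce
    define n where "n = Suc (Max (insert 0 ((\<lambda>\<beta>. weight 0 (mon_exp \<beta>)) ` {\<beta>. B \<beta> \<noteq> UNIV})))"
    have n: "weight 0 (mon_exp \<beta>) < n" if "B \<beta> \<noteq> UNIV" for \<beta>
      using fin that by (auto simp: n_def less_Suc_eq_le intro!: Max_ge)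
    have "y \<in> U" if "wge36 0 n (y - x)" for y
    proof -
      have "coeff36 y \<beta> = coeff36 x \<beta>" if "B \<beta> \<noteq> UNIV" for \<beta>
        using \<open>wge36 0 n (y - x)\<close> n[OF that] by (simp add: wge36_iff coeff36_diff)
      then have "coeff36 y \<in> Pi\<^sub>E UNIV B"
        using x unfolding PiE_UNIV_domain Pi_iff by (metis UNIV_I)
      then show ?thesis using sub U by auto
    qed
    then show "\<exists>n. \<forall>y. wge36 0 n (y - x) \<longrightarrow> y \<in> U" by blast
  qed
next
  assume *: "\<forall>x\<in>U. \<exists>n. \<forall>y. wge36 0 n (y - x) \<longrightarrow> y \<in> U"
  \<comment> \<open>The topology is a pullback, so an open set of coefficient functions with
    preimage \<open>U\<close> has to be exhibited: the union of all cylinders around points of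
    \<open>U\<close> whose preimages stay in \<open>U\<close>.\<close>
  define V where "V = {g. \<exists>x\<in>U. \<exists>n. (\<forall>y. wge36 0 n (y - x) \<longrightarrow> y \<in> U) \<and>
      (\<forall>\<beta>. weight 0 (mon_exp \<beta>) < n \<longrightarrow> g \<beta> = coeff36 x \<beta>)}"
  have "openin (product_topology (\<lambda>_. discrete_topology UNIV) UNIV) V"
    unfolding openin_product_topology_alt
  proof
    fix g assume "g \<in> V"
    then obtain x n where x: "x \<in> U" "\<forall>y. wge36 0 n (y - x) \<longrightarrow> y \<in> U"
      "\<forall>\<beta>. weight 0 (mon_exp \<beta>) < n \<longrightarrow> g \<beta> = coeff36 x \<beta>"
      by (auto simp: V_def)
    define B where "B = (\<lambda>\<beta>. if weight 0 (mon_exp \<beta>) < n then {g \<beta>} else UNIV)"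
    have "finite {\<beta>. B \<beta> \<noteq> UNIV}"
      by (rule finite_subset[OF _ finite_mon_exp[of 0 n]]) (auto simp: B_def)
    moreover have "g \<in> Pi\<^sub>E UNIV B" by (auto simp: B_def)
    moreover have "Pi\<^sub>E UNIV B \<subseteq> V"
    proof
      fix g' assume "g' \<in> Pi\<^sub>E UNIV B"
      then have "\<forall>\<beta>. g' \<beta> \<in> B \<beta>" by (auto simp: PiE_UNIV_domain)
      then have "\<forall>\<beta>. weight 0 (mon_exp \<beta>) < n \<longrightarrow> g' \<beta> = coeff36 x \<beta>"
        using x(3) by (metis B_def singletonD)
      then show "g' \<in> V" using x(1,2) by (auto simp: V_def)
    qed
    ultimately show "\<exists>B. finite {i \<in> UNIV. B i \<noteq> topspace (discrete_topology UNIV)} \<and>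
        (\<forall>i\<in>UNIV. openin (discrete_topology UNIV) (B i)) \<and> g \<in> Pi\<^sub>E UNIV B \<and> Pi\<^sub>E UNIV B \<subseteq> V"
      by (intro exI[of _ B]) simp
  qed
  moreover have "U = coeff36 -` V"
  proof (intro equalityI subsetI)
    fix x assume "x \<in> U"
    then show "x \<in> coeff36 -` V" using * unfolding V_def vimage_def mem_Collect_eq by blast
  next
    fix y assume "y \<in> coeff36 -` V"
    then show "y \<in> U" by (auto simp: V_def wge36_iff coeff36_diff simp del: split_paired_All)
  qed
  ultimately show "openin lc_topology U"
    by (auto simp: lc_topology_def openin_pullback_topology)
qed

lemma topspace_lc_topology: "topspace lc_topology = UNIV"
  using openin_lc_topology_iff[of UNIV] openin_subset by blast

lemma openin_subspace_iff:
  assumes "e36.subspace S"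
  shows "openin lc_topology S \<longleftrightarrow> (\<exists>n. \<forall>x. wge36 0 n x \<longrightarrow> x \<in> S)"
proof
  assume "openin lc_topology S"
  then show "\<exists>n. \<forall>x. wge36 0 n x \<longrightarrow> x \<in> S"
    using e36.subspace_0[OF assms] unfolding openin_lc_topology_iff by (metis diff_zero)
next
  assume "\<exists>n. \<forall>x. wge36 0 n x \<longrightarrow> x \<in> S"
  then show "openin lc_topology S"
    unfolding openin_lc_topology_iff
    by (metis assms diff_add_cancel e36.subspace_add)
qed

lemma continuous_map_lc_topologyI:
  assumes "Vector_Spaces.linear scale36 scale36 \<phi>"
    and "\<And>n. \<exists>m. \<forall>x. wge36 0 m x \<longrightarrow> wge36 0 n (\<phi> x)"
  shows "continuous_map lc_topology lc_topology \<phi>"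
proof -
  interpret Vector_Spaces.linear scale36 scale36 \<phi> by fact
  have "openin lc_topology {x. \<phi> x \<in> U}" if U: "openin lc_topology U" for U
    unfolding openin_lc_topology_iff
  proof
    fix x assume "x \<in> {x. \<phi> x \<in> U}"
    then obtain n where n: "\<forall>y. wge36 0 n (y - \<phi> x) \<longrightarrow> y \<in> U"
      using U unfolding openin_lc_topology_iff by blast
    obtain m where "\<forall>x. wge36 0 m x \<longrightarrow> wge36 0 n (\<phi> x)" using assms(2) by blast
    then show "\<exists>n. \<forall>y. wge36 0 n (y - x) \<longrightarrow> y \<in> {x. \<phi> x \<in> U}"
      using n by (intro exI[of _ m]) (metis diff mem_Collect_eq)
  qed
  then show ?thesis by (simp add: continuous_map_def topspace_lc_topology)
qed

section \<open>Exponentials\<close>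

lemma linear36I:
  assumes "\<And>x y. \<phi> (x + y) = \<phi> x + \<phi> y" "\<And>c x. \<phi> (scale36 c x) = scale36 c (\<phi> x)"
  shows "Vector_Spaces.linear scale36 scale36 \<phi>"
  using assms e36.vector_space_axioms
  by (simp add: Vector_Spaces.linear_def module_hom_def module_hom_axioms_def e36.module_axioms)

abbreviation adpow :: "e36 \<Rightarrow> nat \<Rightarrow> e36 \<Rightarrow> e36" where
  "adpow a n \<equiv> bracket36 a ^^ n"

lemma adpow_add: "adpow a n (x + y) = adpow a n x + adpow a n y"
  by (induction n) (simp_all add: bracket36_add_right)

lemma adpow_scale: "adpow a n (scale36 c x) = scale36 c (adpow a n x)"
  by (induction n) (simp_all add: bracket36_scale_right)

lemma adpow_0: "adpow a n 0 = 0"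
  by (induction n) (simp_all add: bracket36_0_right)

lemma adpow_sum: "adpow a n (sum g A) = (\<Sum>i\<in>A. adpow a n (g i))"
  by (induction A rule: infinite_finite_induct) (auto simp: adpow_0 adpow_add)

lemma wge36_adpow: "wge36 0 (n + k) x \<Longrightarrow> wge36 0 n (adpow a k x)"
  by (induction k arbitrary: n) (simp_all add: wge36_bracket_right)

lemma adpow_even_part:
  "even_part a = a \<Longrightarrow> adpow a n (even_part x) = even_part (adpow a n x)"
  by (induction n) (simp_all add: bracket36_even_part)

text \<open>The condition makes every coefficient of the exponential series a finite sum. The shift
  by 3 is the nilpotency order of the adjoint action of a nilpotent matrix in sl_2.\<close>

locale topologically_nilpotent =
  fixes a :: e36
  assumes even: "even_part a = a"
    and derivation: "\<And>x y. bracket36 a (bracket36 x y)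
      = bracket36 (bracket36 a x) y + bracket36 x (bracket36 a y)"
    and nilpotent: "\<And>n x. wge36 0 n (adpow a (n + 3) x)"
begin

lemma nilpotent_le:
  assumes "n + 3 \<le> k"
  shows "wge36 0 n (adpow a k x)"
proof -
  have "adpow a k x = adpow a (n + 3) (adpow a (k - (n + 3)) x)"
    using assms by (simp flip: funpow_add comp_apply[of "adpow a _"])
  then show ?thesis by (simp only: nilpotent)
qed

text \<open>A coefficient of order d is unaffected by the terms from \<open>n = d + 4\<close> on,
  because these vanish to order d + 1.\<close>

definition exp_ad :: "complex \<Rightarrow> e36 \<Rightarrow> e36" where
  "exp_ad t x = of_coeffs (\<lambda>\<beta>. \<Sum>n<weight 0 (mon_exp \<beta>) + 4. t ^ n / fact n * coeff36 (adpow a n x) \<beta>)"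

definition exp_trunc :: "nat \<Rightarrow> complex \<Rightarrow> e36 \<Rightarrow> e36" where
  "exp_trunc N t x = (\<Sum>n<N. scale36 (t ^ n / fact n) (adpow a n x))"

lemma coeff36_exp_ad:
  assumes "weight 0 (mon_exp \<beta>) + 4 \<le> N"
  shows "coeff36 (exp_ad t x) \<beta> = (\<Sum>n<N. t ^ n / fact n * coeff36 (adpow a n x) \<beta>)"
  unfolding exp_ad_def coeff36_of_coeffs
proof (rule sum.mono_neutral_left)
  show "\<forall>n\<in>{..<N} - {..<weight 0 (mon_exp \<beta>) + 4}. t ^ n / fact n * coeff36 (adpow a n x) \<beta> = 0"
  proof
    fix n assume "n \<in> {..<N} - {..<weight 0 (mon_exp \<beta>) + 4}"
    then have "wge36 0 (Suc (weight 0 (mon_exp \<beta>))) (adpow a n x)"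
      by (intro nilpotent_le) auto
    then show "t ^ n / fact n * coeff36 (adpow a n x) \<beta> = 0"
      by (simp add: wge36_iff)
  qed
qed (use assms in auto)

lemma exp_ad_approx:
  assumes "n + 3 \<le> N"
  shows "wge36 0 n (exp_ad t x - exp_trunc N t x)"
  unfolding wge36_iff
proof (intro allI impI)
  fix \<beta> assume "weight 0 (mon_exp \<beta>) < n"
  then show "coeff36 (exp_ad t x - exp_trunc N t x) \<beta> = 0"
    using assms
    by (subst coeff36_diff, subst coeff36_exp_ad[where N = N])
      (auto simp: exp_trunc_def coeff36_sum coeff36_scale)
qed

lemma is_exp_ad: "is_exp_ad t a (exp_ad t)"
  unfolding is_exp_ad_def
proof (intro allI)
  fix x \<beta>
  have "coeff36 (adpow a n x) \<beta> = 0" if "n \<notin> {..<weight 0 (mon_exp \<beta>) + 4}" for n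
    using nilpotent_le[of "Suc (weight 0 (mon_exp \<beta>))" n x] that by (simp add: wge36_iff)
  then show "(\<lambda>n. t ^ n / fact n * coeff36 (adpow a n x) \<beta>) sums coeff36 (exp_ad t x) \<beta>"
    unfolding coeff36_exp_ad[OF order_refl] by (intro sums_finite) auto
qed

lemma linear_exp_ad: "Vector_Spaces.linear scale36 scale36 (exp_ad t)"
  by (rule linear36I; rule coeff36_eqI)
    (simp_all add: coeff36_exp_ad[OF order_refl] adpow_add adpow_scale coeff36_add coeff36_scale
      distrib_left sum.distrib sum_distrib_left mult.left_commute)

lemma exp_ad_even_part: "exp_ad t (even_part x) = even_part (exp_ad t x)"
proof (rule coeff36_eqI)
  fix \<beta>
  show "coeff36 (exp_ad t (even_part x)) \<beta> = coeff36 (even_part (exp_ad t x)) \<beta>"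
    by (cases \<beta>) (simp_all add: coeff36_even_part coeff36_exp_ad[OF order_refl] adpow_even_part[OF even])
qed

lemma continuous_exp_ad: "continuous_map lc_topology lc_topology (exp_ad t)"
proof (rule continuous_map_lc_topologyI[OF linear_exp_ad])
  fix n
  \<comment> \<open>The truncation has \<open>n + 3\<close> terms, which lose at most
    \<open>n + 2\<close> orders; the remainder has order \<open>n\<close> for every x.\<close>
  have "wge36 0 n (exp_ad t x)" if x: "wge36 0 (n + (n + 3)) x" for x
  proof -
    have "wge36 0 n (adpow a k x)" if "k < n + 3" for k
      using that by (intro wge36_adpow wge36_mono[OF x]) auto
    then have "wge36 0 n (exp_trunc (n + 3) t x)"
      unfolding exp_trunc_def by (intro wge36_sum wge36_scale) auto
    from wge36_add[OF exp_ad_approx[OF order_refl, of n t x] this] show ?thesis by simp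
  qed
  then show "\<exists>m. \<forall>x. wge36 0 m x \<longrightarrow> wge36 0 n (exp_ad t x)" by blast
qed

lemma leibniz:
  "adpow a n (bracket36 x y)
    = (\<Sum>k\<le>n. scale36 (of_nat (n choose k)) (bracket36 (adpow a k x) (adpow a (n - k) y)))"
proof (induction n)
  case (Suc n)
  let ?b = "\<lambda>i j. bracket36 (adpow a i x) (adpow a j y)"
  have "adpow a (Suc n) (bracket36 x y) = (\<Sum>k\<le>n. scale36 (of_nat (n choose k)) (?b (Suc k) (n - k)))
      + (\<Sum>k\<le>n. scale36 (of_nat (n choose k)) (?b k (Suc n - k)))"
    by (simp add: Suc.IH bracket36_sum_right bracket36_scale_right derivation e36.scale_right_distrib
        sum.distrib Suc_diff_le)
  also have "(\<Sum>k\<le>n. scale36 (of_nat (n choose k)) (?b k (Suc n - k)))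
      = ?b 0 (Suc n) + (\<Sum>k\<le>n. scale36 (of_nat (n choose Suc k)) (?b (Suc k) (n - k)))"
  proof -
    have "(\<Sum>k\<le>n. scale36 (of_nat (n choose k)) (?b k (Suc n - k)))
        = (\<Sum>k\<le>Suc n. scale36 (of_nat (n choose k)) (?b k (Suc n - k)))"
      by (simp add: binomial_eq_0)
    also have "\<dots> = ?b 0 (Suc n) + (\<Sum>k\<le>n. scale36 (of_nat (n choose Suc k)) (?b (Suc k) (n - k)))"
      by (subst sum.atMost_Suc_shift) simp
    finally show ?thesis .
  qed
  also have "(\<Sum>k\<le>n. scale36 (of_nat (n choose k)) (?b (Suc k) (n - k)))
      + (?b 0 (Suc n) + (\<Sum>k\<le>n. scale36 (of_nat (n choose Suc k)) (?b (Suc k) (n - k))))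
      = ?b 0 (Suc n) + (\<Sum>k\<le>n. scale36 (of_nat (Suc n choose Suc k)) (?b (Suc k) (n - k)))"
    by (simp add: e36.scale_left_distrib sum.distrib)
  also have "\<dots> = (\<Sum>k\<le>Suc n. scale36 (of_nat (Suc n choose k)) (?b k (Suc n - k)))"
    by (subst sum.atMost_Suc_shift) simp
  finally show ?case .
qed simp

text \<open>A Cauchy product modulo order \<open>M\<close>. The triangle i + j < 2N contains the
  square i, j < N, and a term outside the square has an index of at least \<open>N\<close>, so it is
  negligible.\<close>

lemma exp_ad_bracket: "exp_ad t (bracket36 x y) = bracket36 (exp_ad t x) (exp_ad t y)"
proof (rule wge36_eqI)
  fix M :: nat
  \<comment> \<open>The bracket costs one order, so its arguments are approximated to order
    \<open>M + 1\<close>, which takes \<open>M + 1 + 3\<close> terms.\<close>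
  define N where "N = M + 4"
  define g where "g = (\<lambda>(i, j). scale36 (t ^ (i + j) / (fact i * fact j))
      (bracket36 (adpow a i x) (adpow a j y)))"
  have small: "wge36 0 M (g p)" if "N \<le> fst p \<or> N \<le> snd p" for p
  proof -
    have "wge36 0 (Suc M) (adpow a (fst p) x) \<or> wge36 0 (Suc M) (adpow a (snd p) y)"
      using that nilpotent_le[of "Suc M" "fst p" x] nilpotent_le[of "Suc M" "snd p" y]
      by (auto simp: N_def)
    then have "wge36 0 M (bracket36 (adpow a (fst p) x) (adpow a (snd p) y))"
      using wge36_bracket_left wge36_bracket_right by blast
    then show ?thesis by (simp add: g_def case_prod_unfold wge36_scale)
  qed
  let ?A = "{(i, j). i + j < 2 * N}"
  have fin: "finite ?A"
    by (rule finite_subset[of _ "{..<2 * N} \<times> {..<2 * N}"]) auto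
  have "exp_trunc (2 * N) t (bracket36 x y) = (\<Sum>n<2 * N. \<Sum>k\<le>n. g (k, n - k))"
    unfolding exp_trunc_def
  proof (rule sum.cong)
    fix n
    have "t ^ n / fact n * of_nat (n choose k) = t ^ (k + (n - k)) / (fact k * fact (n - k))"
      if "k \<le> n" for k
      using that by (simp add: binomial_fact)
    then show "scale36 (t ^ n / fact n) (adpow a n (bracket36 x y)) = (\<Sum>k\<le>n. g (k, n - k))"
      by (auto simp only: leibniz e36.scale_sum_right e36.scale_scale g_def case_prod_conv
          intro!: sum.cong)
  qed simp
  also have "\<dots> = (\<Sum>(i, j) | i + j < 2 * N. g (i, j))"
    by (rule sum.triangle_reindex[symmetric])
  finally have trunc: "exp_trunc (2 * N) t (bracket36 x y) = (\<Sum>p\<in>?A. g p)"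
    by (simp add: case_prod_unfold)
  have prod: "bracket36 (exp_trunc N t x) (exp_trunc N t y) = (\<Sum>p\<in>{..<N} \<times> {..<N}. g p)"
  proof -
    have "bracket36 (exp_trunc N t x) (exp_trunc N t y) = (\<Sum>i<N. \<Sum>j<N. g (i, j))"
      unfolding exp_trunc_def bracket36_sum_left
      by (simp add: bracket36_sum_right bracket36_scale_left bracket36_scale_right g_def power_add
          mult.commute)
    then show ?thesis by (simp add: sum.cartesian_product)
  qed
  have "?A = ({..<N} \<times> {..<N}) \<union> (?A - {..<N} \<times> {..<N})" by auto
  then have "(\<Sum>p\<in>?A. g p) = (\<Sum>p\<in>{..<N} \<times> {..<N}. g p) + (\<Sum>p\<in>?A - {..<N} \<times> {..<N}. g p)"
    using fin by (metis (no_types, lifting) Diff_disjoint finite_Diff finite_SigmaI finite_lessThan sum.union_disjoint)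
  moreover have "wge36 0 M (\<Sum>p\<in>?A - {..<N} \<times> {..<N}. g p)"
    by (intro wge36_sum small) auto
  ultimately have 1: "wge36 0 M (exp_trunc (2 * N) t (bracket36 x y)
      - bracket36 (exp_trunc N t x) (exp_trunc N t y))"
    by (simp add: trunc prod)
  have 2: "wge36 0 M (exp_ad t (bracket36 x y) - exp_trunc (2 * N) t (bracket36 x y))"
    by (rule exp_ad_approx) (simp add: N_def)
  have approx: "wge36 0 (Suc M) (exp_ad t z - exp_trunc N t z)" for z
    by (rule exp_ad_approx) (simp add: N_def)
  have 3: "wge36 0 M (bracket36 (exp_ad t x - exp_trunc N t x) (exp_ad t y)
      + bracket36 (exp_trunc N t x) (exp_ad t y - exp_trunc N t y))"
    using approx by (intro wge36_add wge36_bracket_left wge36_bracket_right)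
  have "exp_ad t (bracket36 x y) - bracket36 (exp_ad t x) (exp_ad t y)
     = (exp_ad t (bracket36 x y) - exp_trunc (2 * N) t (bracket36 x y))
     + (exp_trunc (2 * N) t (bracket36 x y) - bracket36 (exp_trunc N t x) (exp_trunc N t y))
     - (bracket36 (exp_ad t x - exp_trunc N t x) (exp_ad t y)
      + bracket36 (exp_trunc N t x) (exp_ad t y - exp_trunc N t y))"
    by (simp add: bracket36_diff_left bracket36_diff_right)
  then show "wge36 0 M (exp_ad t (bracket36 x y) - bracket36 (exp_ad t x) (exp_ad t y))"
    using wge36_diff[OF wge36_add[OF 2 1] 3] by (simp only:)
qed

end

section \<open>Inverse exponentials\<close>

lemma is_exp_adD:
  "is_exp_ad t a \<phi> \<Longrightarrow> (\<lambda>n. t ^ n / fact n * coeff36 (adpow a n x) \<beta>) sums coeff36 (\<phi> x) \<beta>"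
  unfolding is_exp_ad_def by blast

lemma is_exp_ad_unique:
  assumes "is_exp_ad t a \<phi>" "is_exp_ad t a \<psi>"
  shows "\<phi> = \<psi>"
proof (intro ext coeff36_eqI)
  fix x \<beta>
  show "coeff36 (\<phi> x) \<beta> = coeff36 (\<psi> x) \<beta>"
    using assms[THEN is_exp_adD] by (rule sums_unique2)
qed

lemma exponential_derivatives:
  fixes c :: "nat \<Rightarrow> complex"
  assumes "\<And>z. summable (\<lambda>n. c n / fact n * z ^ n)"
  defines "g \<equiv> \<lambda>k z. \<Sum>n. c (n + k) / fact n * z ^ n"
  shows "(\<lambda>n. c (n + k) / fact n * z ^ n) sums g k z"
    and "(g k has_field_derivative g (Suc k) z) (at z)"
proof -
  have diffs: "diffs (\<lambda>n. c (n + k) / fact n) = (\<lambda>n. c (n + Suc k) / fact n)" for k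
    by (simp add: diffs_def fun_eq_iff del: of_nat_Suc)
  have summable: "summable (\<lambda>n. c (n + k) / fact n * z ^ n)" for k z
  proof (induction k arbitrary: z)
    case (Suc k)
    show ?case
      using termdiff_converges_all[of "\<lambda>n. c (n + k) / fact n", OF Suc] by (simp add: diffs)
  qed (use assms in simp)
  then show "(\<lambda>n. c (n + k) / fact n * z ^ n) sums g k z"
    by (simp add: g_def summable_sums)
  show "(g k has_field_derivative g (Suc k) z) (at z)"
    using termdiffs_strong_converges_everywhere[of "\<lambda>n. c (n + k) / fact n", OF summable]
    by (simp add: diffs g_def)
qed

text \<open>The entire function with derivatives \<open>c n\<close> at 0 is expanded around t and
  evaluated at 0, that is, with increment -t.\<close>

lemma exponential_taylor:
  fixes c :: "nat \<Rightarrow> complex"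
  assumes "\<And>z. summable (\<lambda>n. c n / fact n * z ^ n)"
  shows "(\<lambda>k. (- t) ^ k / fact k * (\<Sum>n. c (n + k) / fact n * t ^ n)) sums c 0"
proof -
  define g where "g = (\<lambda>k z. \<Sum>n. c (n + k) / fact n * z ^ n)"
  have g: "(g k has_field_derivative g (Suc k) z) (at z)" for k z
    unfolding g_def by (rule exponential_derivatives(2)[OF assms])
  have "(deriv ^^ k) (g 0) = g k" for k
  proof (induction k)
    case (Suc k)
    have "deriv (g k) = g (Suc k)"
      by (rule ext) (rule DERIV_imp_deriv[OF g])
    then show ?case by (simp add: Suc.IH)
  qed simp
  \<comment> \<open>The radius \<open>norm t + 1\<close> puts 0 inside the disc around t.\<close>
  moreover have "g 0 holomorphic_on ball t (norm t + 1)"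
    using g by (auto simp: holomorphic_on_def field_differentiable_def intro: has_field_derivative_at_within)
  then have "(\<lambda>k. (deriv ^^ k) (g 0) t / fact k * (0 - t) ^ k) sums g 0 0"
    by (rule holomorphic_power_series) simp
  moreover have "g 0 0 = c 0"
    using powser_zero[of "\<lambda>n. c n / fact n"] by (simp add: g_def)
  ultimately show ?thesis by (simp add: g_def mult.commute)
qed

text \<open>For a fixed coefficient, let f(s) be that of exp(s ad a) x. This is an entire function
  whose k-th derivative at t is the coefficient of \<open>adpow a k (\<phi> x)\<close>. The series
  of exp(-t ad a) at \<open>\<phi> x\<close> is thus the Taylor expansion of f around t, evaluated
  at 0.\<close>

lemma exp_ad_inverse:
  assumes ex: "\<And>t. \<exists>\<phi>. is_exp_ad t a \<phi>"
    and \<phi>: "is_exp_ad t a \<phi>" and \<psi>: "is_exp_ad (- t) a \<psi>"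
  shows "\<psi> (\<phi> x) = x"
proof (rule coeff36_eqI)
  fix \<beta>
  define c where "c = (\<lambda>n. coeff36 (adpow a n x) \<beta>)"
  have "summable (\<lambda>n. c n / fact n * z ^ n)" for z
  proof -
    obtain \<theta> where "is_exp_ad z a \<theta>" using ex by blast
    then have "(\<lambda>n. z ^ n / fact n * c n) sums coeff36 (\<theta> x) \<beta>"
      unfolding c_def by (rule is_exp_adD)
    then show ?thesis by (simp add: sums_iff mult.commute)
  qed
  then have "(\<lambda>k. (- t) ^ k / fact k * (\<Sum>n. c (n + k) / fact n * t ^ n)) sums c 0"
    by (rule exponential_taylor)
  moreover have "(\<Sum>n. c (n + k) / fact n * t ^ n) = coeff36 (adpow a k (\<phi> x)) \<beta>" for k
  proof -
    \<comment> \<open>Each bracket loses at most one order, so the coefficient of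
      \<open>adpow a k y\<close> at \<open>\<beta>\<close> is a linear function of the finitely many
      coefficients of y in \<open>F\<close>. Therefore \<open>adpow a k\<close> may be applied to
      the complex series term by term.\<close>
    define F where "F = {\<gamma>. weight 0 (mon_exp \<gamma>) < Suc (weight 0 (mon_exp \<beta>)) + k}"
    define b where "b = (\<lambda>\<gamma>. of_coeffs (\<lambda>\<delta>. if \<delta> = \<gamma> then 1 else 0))"
    have fin: "finite F" by (simp add: F_def finite_mon_exp)
    have eq: "coeff36 (adpow a k y) \<beta> = (\<Sum>\<gamma>\<in>F. coeff36 y \<gamma> * coeff36 (adpow a k (b \<gamma>)) \<beta>)" for y
    proof -
      let ?s = "\<Sum>\<gamma>\<in>F. scale36 (coeff36 y \<gamma>) (b \<gamma>)"
      have "coeff36 ?s \<delta> = coeff36 y \<delta>" if "\<delta> \<in> F" for \<delta>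
      proof -
        have "coeff36 ?s \<delta> = (\<Sum>\<gamma>\<in>F. if \<delta> = \<gamma> then coeff36 y \<gamma> else 0)"
          unfolding coeff36_sum coeff36_scale b_def coeff36_of_coeffs by (rule sum.cong) auto
        then show ?thesis using fin that by simp
      qed
      then have "wge36 0 (Suc (weight 0 (mon_exp \<beta>)) + k) (y - ?s)"
        by (simp add: wge36_iff coeff36_diff F_def)
      then have "wge36 0 (Suc (weight 0 (mon_exp \<beta>))) (adpow a k (y - ?s))"
        by (rule wge36_adpow)
      then have "coeff36 (adpow a k (y - ?s)) \<beta> = 0"
        by (simp add: wge36_iff)
      moreover have "adpow a k y = adpow a k (y - ?s) + adpow a k ?s"
        by (simp flip: adpow_add)
      ultimately show ?thesis
        by (simp add: coeff36_add adpow_sum adpow_scale coeff36_sum coeff36_scale)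
    qed
    have "(\<lambda>n. \<Sum>\<gamma>\<in>F. t ^ n / fact n * coeff36 (adpow a n x) \<gamma> * coeff36 (adpow a k (b \<gamma>)) \<beta>)
        sums (\<Sum>\<gamma>\<in>F. coeff36 (\<phi> x) \<gamma> * coeff36 (adpow a k (b \<gamma>)) \<beta>)"
      using is_exp_adD[OF \<phi>] by (intro sums_sum sums_mult2)
    moreover have "(\<Sum>\<gamma>\<in>F. t ^ n / fact n * coeff36 (adpow a n x) \<gamma> * coeff36 (adpow a k (b \<gamma>)) \<beta>)
        = c (n + k) / fact n * t ^ n" for n
    proof -
      have "c (n + k) = coeff36 (adpow a k (adpow a n x)) \<beta>"
        by (simp only: c_def add.commute[of n] funpow_add comp_apply)
      then show ?thesis
        by (simp add: eq[of "adpow a n x"] sum_distrib_left sum_divide_distrib mult.commute mult.left_commute)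
    qed
    ultimately show ?thesis by (simp add: eq[of "\<phi> x"] sums_iff)
  qed
  moreover have "(\<lambda>k. (- t) ^ k / fact k * coeff36 (adpow a k (\<phi> x)) \<beta>) sums coeff36 (\<psi> (\<phi> x)) \<beta>"
    using \<psi> by (rule is_exp_adD)
  ultimately show "coeff36 (\<psi> (\<phi> x)) \<beta> = coeff36 x \<beta>"
    by (simp add: sums_iff c_def)
qed

lemma (in topologically_nilpotent) continuous_automorphism_exp_ad:
  "continuous_automorphism36 (exp_ad t)"
proof -
  have "exp_ad (- t) (exp_ad t x) = x" for t x
    using is_exp_ad exp_ad_inverse[of a t "exp_ad t" "exp_ad (- t)" x] by blast
  from this[of t] this[of "- t"] have "bij (exp_ad t)"
    by (intro o_bij[of "exp_ad (- t)"]) (auto simp: fun_eq_iff)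
  then show ?thesis
    by (simp add: continuous_automorphism36_def linear_exp_ad exp_ad_even_part exp_ad_bracket
        continuous_exp_ad)
qed

lemma (in topologically_nilpotent) exponentiable: "exponentiable a"
  unfolding exponentiable_def
proof (intro conjI allI)
  show "\<exists>\<phi>. is_exp_ad t a \<phi> \<and> continuous_automorphism36 \<phi>" for t
    using is_exp_ad[of t] continuous_automorphism_exp_ad[of t] by blast
qed (rule even)

text \<open>Row k and column j hold the coefficient of dx_j \<otimes> v_k, so a tensor of rank at
  most one is a matrix with proportional rows.\<close>

definition odd_value :: "e36 \<Rightarrow> complex^3^2" where
  "odd_value x = (\<chi> k j. coeff36 x (MonOdd 0 j k))"

lemma odd_value_eq: "odd_value (X, A, \<theta>) = (\<chi> k j. ev (\<theta> $ k $ j))"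
  by (cases A) (simp add: odd_value_def ev_def vec_eq_iff)

lemma (in topologically_nilpotent) odd_value_exp_ad:
  "odd_value (exp_ad 1 x) $ k $ j = odd_value x $ k $ j + odd_value (adpow a 1 x) $ k $ j
     + odd_value (adpow a 2 x) $ k $ j / 2 + odd_value (adpow a 3 x) $ k $ j / 6"
proof -
  have "(\<Sum>n<4. 1 ^ n / fact n * coeff36 (adpow a n x) (MonOdd 0 j k))
      = odd_value x $ k $ j + odd_value (adpow a 1 x) $ k $ j
     + odd_value (adpow a 2 x) $ k $ j / 2 + odd_value (adpow a 3 x) $ k $ j / 6"
    by (simp add: odd_value_def eval_nat_numeral)
  then show ?thesis
    by (simp add: odd_value_def coeff36_exp_ad[of _ 4] weight_0)
qed

context nilpotent_field
begin

sublocale topologically_nilpotent "(field, 0, 0)"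
proof
  show "bracket36 (field, 0, 0) (bracket36 x y)
      = bracket36 (bracket36 (field, 0, 0) x) y + bracket36 x (bracket36 (field, 0, 0) y)" for x y
    using ad_field_derivation by (simp add: ad_field_def)
  show "wge36 0 n (adpow (field, 0, 0) (n + 3) x)" for n x
    using wge36_ad_field_power[of 0 "n + 2" x] wge36_mono[of 0 "n + 2" _ n]
    by (simp add: ad_field_def numeral_3_eq_3)
qed simp

text \<open>Each row p undergoes the transvection p + (w.p) l: from the second power on, all odd
  components are divisible by \<open>ell\<close> and vanish at the origin.\<close>

lemma odd_value_exp_field:
  "odd_value (exp_ad 1 x) $ k $ j
    = odd_value x $ k $ j + l $ j * (\<Sum>i\<in>UNIV. w $ i * odd_value x $ k $ i)"
proof -
  have ell: "ev ell = 0"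
    by (simp add: ell_def sum_3 ev_simps)
  have "odd_value (adpow (field, 0, 0) n x) $ k $ j = 0" if "2 \<le> n" for n
  proof -
    obtain Y e f h \<eta> where x: "(ad_field ^^ n) x = (Y, (e, f, h), \<eta>)"
      by (cases "(ad_field ^^ n) x") auto
    have "ell dvd ell ^ (n - 1)"
      using that by (intro dvd_power) auto
    then have "ell dvd \<eta> $ k $ j"
      using ell_divisible_ad_field_power[of n x] by (auto simp: x intro: dvd_trans)
    then have "ev (\<eta> $ k $ j) = 0"
      by (auto simp: dvd_def ev_mult ell)
    then show ?thesis
      using x by (simp add: ad_field_def odd_value_eq)
  qed
  moreover have "odd_value (adpow (field, 0, 0) 1 x) $ k $ j
      = l $ j * (\<Sum>i\<in>UNIV. w $ i * odd_value x $ k $ i)"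
  proof -
    obtain Y e f h \<eta> where x: "x = (Y, (e, f, h), \<eta>)"
      by (cases x) auto
    have "adpow (field, 0, 0) 1 x = ad_field x"
      by (simp add: ad_field_def)
    also have "odd_value \<dots> $ k $ j = l $ j * (\<Sum>i\<in>UNIV. w $ i * odd_value x $ k $ i)"
      by (simp add: x ad_field_eq odd_value_eq on_1form_def D_eq sum_3 ev_simps ell)
    finally show ?thesis .
  qed
  ultimately show ?thesis
    by (simp add: odd_value_exp_ad)
qed

end

context nilpotent_matrix
begin

lemma on_odd_twice: "on_odd (on_odd \<zeta>) = 0"
proof -
  have "on_odd (on_odd \<zeta>) = (\<chi> k. (pconst H * pconst H + pconst E * pconst F) *s \<zeta> $ k)"
    by (simp add: on_odd_def vec_eq_iff forall_2 algebra_simps)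
  then show ?thesis
    by (simp add: nilpotent' vec_eq_iff)
qed

text \<open>If the square of N is a scalar d, then (ad N)^3 = 4 d (ad N) on sl_2; here d =
  0.\<close>

lemma adpow_matrix_3: "adpow matrix 3 x = 0"
proof -
  obtain Y e f h \<eta> where x: "x = (Y, (e, f, h), \<eta>)" by (cases x) auto
  let ?N = "(pconst E, pconst F, pconst H)"
  let ?d = "pconst H * pconst H + pconst E * pconst F"
  have "sl2_bracket ?N (sl2_bracket ?N (sl2_bracket ?N (e, f, h)))
      = (?d * (8 * (pconst H * e - h * pconst E)), ?d * (8 * (pconst F * h - f * pconst H)),
         ?d * (4 * (pconst E * f - e * pconst F)))"
    by (simp add: sl2_bracket_eq algebra_simps)
  then show ?thesis
    by (simp add: nilpotent' x numeral_3_eq_3 ad_matrix_eq on_odd_twice zero_prod_def)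
      (simp add: on_odd_def vec_eq_iff forall_2)
qed

sublocale topologically_nilpotent matrix
proof
  show "even_part matrix = matrix"
    by (simp add: matrix_def)
  show "bracket36 matrix (bracket36 x y)
      = bracket36 (bracket36 matrix x) y + bracket36 x (bracket36 matrix y)" for x y
    by (rule ad_matrix_derivation)
  show "wge36 0 n (adpow matrix (n + 3) x)" for n x
    by (simp only: funpow_add comp_apply adpow_matrix_3 adpow_0 wge36_0)
qed

text \<open>On C^2 the exponential of a square-zero matrix N is 1 + N.\<close>

lemma odd_value_exp_matrix:
  "odd_value (exp_ad 1 x) $ 1 $ j
    = odd_value x $ 1 $ j + (H * odd_value x $ 1 $ j + E * odd_value x $ 2 $ j)"
  "odd_value (exp_ad 1 x) $ 2 $ j
    = odd_value x $ 2 $ j + (F * odd_value x $ 1 $ j - H * odd_value x $ 2 $ j)"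
proof -
  obtain Y A \<eta> where x: "x = (Y, A, \<eta>)" by (cases x) auto
  have "odd_value (adpow matrix 3 x) = 0"
    by (simp add: adpow_matrix_3 odd_value_def coeff36_0 vec_eq_iff)
  moreover have "odd_value (adpow matrix 2 x) = 0"
    by (simp add: x numeral_2_eq_2 ad_matrix_eq on_odd_twice odd_value_eq vec_eq_iff ev_0)
  moreover have "odd_value (adpow matrix 1 x) = (\<chi> k j. ev (on_odd \<eta> $ k $ j))"
    by (simp add: x ad_matrix_eq odd_value_eq)
  ultimately show "odd_value (exp_ad 1 x) $ 1 $ j
    = odd_value x $ 1 $ j + (H * odd_value x $ 1 $ j + E * odd_value x $ 2 $ j)"
  "odd_value (exp_ad 1 x) $ 2 $ j
    = odd_value x $ 2 $ j + (F * odd_value x $ 1 $ j - H * odd_value x $ 2 $ j)"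
    by (simp_all add: odd_value_exp_ad) (simp_all add: x odd_value_eq on_odd_def ev_simps)
qed

end

section \<open>The group of inner automorphisms\<close>

lemma continuous_automorphism36D:
  assumes "continuous_automorphism36 \<phi>"
  shows "bij \<phi>" "Vector_Spaces.linear scale36 scale36 \<phi>"
    "\<phi> (even_part x) = even_part (\<phi> x)" "\<phi> (bracket36 x y) = bracket36 (\<phi> x) (\<phi> y)"
    "continuous_map lc_topology lc_topology \<phi>"
  using assms unfolding continuous_automorphism36_def by blast+

lemma continuous_automorphism36I:
  assumes "bij \<phi>" "Vector_Spaces.linear scale36 scale36 \<phi>"
    "\<And>x. \<phi> (even_part x) = even_part (\<phi> x)"
    "\<And>x y. \<phi> (bracket36 x y) = bracket36 (\<phi> x) (\<phi> y)"
    "continuous_map lc_topology lc_topology \<phi>"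
  shows "continuous_automorphism36 \<phi>"
  using assms unfolding continuous_automorphism36_def by blast

lemma continuous_automorphism36_comp:
  assumes "continuous_automorphism36 \<phi>" "continuous_automorphism36 \<psi>"
  shows "continuous_automorphism36 (\<phi> \<circ> \<psi>)"
proof (rule continuous_automorphism36I)
  note D = continuous_automorphism36D[OF assms(1)] continuous_automorphism36D[OF assms(2)]
  show "bij (\<phi> \<circ> \<psi>)" using D(6,1) by (rule bij_comp)
  show "Vector_Spaces.linear scale36 scale36 (\<phi> \<circ> \<psi>)"
    using D(7,2) by (rule Vector_Spaces.linear_compose)
  show "continuous_map lc_topology lc_topology (\<phi> \<circ> \<psi>)"
    using D(10,5) by (rule continuous_map_compose)
qed (simp_all only: comp_apply continuous_automorphism36D[OF assms(1)] continuous_automorphism36D[OF assms(2)])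

lemma continuous_automorphism36_id: "continuous_automorphism36 id"
  by (rule continuous_automorphism36I) (simp_all only: bij_id id_apply continuous_map_id linear36I)

text \<open>Continuity of the inverse makes images of open sets open, and including it lets the
  property pass to the group generated by the exponentials.\<close>

definition homeomorphic_automorphism36 :: "(e36 \<Rightarrow> e36) \<Rightarrow> bool" where
  "homeomorphic_automorphism36 \<phi> \<longleftrightarrow>
     continuous_automorphism36 \<phi> \<and> continuous_automorphism36 (inv_into UNIV \<phi>)"

lemma homeomorphic_automorphism36_bij: "homeomorphic_automorphism36 \<phi> \<Longrightarrow> bij \<phi>"
  by (simp add: homeomorphic_automorphism36_def continuous_automorphism36D(1))

lemma homeomorphic_automorphism36_inv:
  "homeomorphic_automorphism36 \<phi> \<Longrightarrow> homeomorphic_automorphism36 (inv_into UNIV \<phi>)"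
  using homeomorphic_automorphism36_bij[of \<phi>]
  by (simp add: homeomorphic_automorphism36_def inv_inv_eq)

lemma homeomorphic_automorphism36_comp:
  assumes "homeomorphic_automorphism36 \<phi>" "homeomorphic_automorphism36 \<psi>"
  shows "homeomorphic_automorphism36 (\<phi> \<circ> \<psi>)"
  using assms[THEN homeomorphic_automorphism36_bij] assms
  by (simp add: homeomorphic_automorphism36_def continuous_automorphism36_comp o_inv_distrib)

text \<open>The inverse is exp(- ad a), a continuous automorphism because
  \<open>exponentiable\<close> quantifies over all complex t.\<close>

lemma exponential_homeomorphic:
  assumes "exponentiable a" "is_exp_ad 1 a \<phi>"
  shows "homeomorphic_automorphism36 \<phi>"
proof -
  from assms(1) have ex: "\<exists>\<phi>. is_exp_ad t a \<phi> \<and> continuous_automorphism36 \<phi>" for t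
    unfolding exponentiable_def by blast
  then have ex': "\<exists>\<phi>. is_exp_ad t a \<phi>" for t by blast
  obtain \<phi>' where "is_exp_ad 1 a \<phi>'" "continuous_automorphism36 \<phi>'" using ex by blast
  then have \<phi>: "continuous_automorphism36 \<phi>"
    using is_exp_ad_unique assms(2) by blast
  obtain \<psi> where \<psi>: "is_exp_ad (- 1) a \<psi>" "continuous_automorphism36 \<psi>" using ex by blast
  have "inv_into UNIV \<phi> = \<psi>"
  proof (rule inv_equality)
    show "\<psi> (\<phi> x) = x" for x
      by (rule exp_ad_inverse[OF ex' assms(2) \<psi>(1)])
    show "\<phi> (\<psi> x) = x" for x
      by (rule exp_ad_inverse[OF ex' \<psi>(1)]) (simp add: assms(2))
  qed
  then show ?thesis
    using \<phi> \<psi> by (simp add: homeomorphic_automorphism36_def)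
qed

lemma Bij_UNIV: "\<phi> \<in> Bij UNIV \<longleftrightarrow> bij \<phi>"
  by (simp add: Bij_def)

lemma inner_homeomorphic:
  assumes "\<phi> \<in> inner_automorphisms36"
  shows "homeomorphic_automorphism36 \<phi>"
  using assms unfolding inner_automorphisms36_def
proof (induction rule: generate.induct)
  case one
  show ?case
    using continuous_automorphism36_id
    by (simp add: BijGroup_def homeomorphic_automorphism36_def restrict_def id_def[symmetric])
next
  case (incl h)
  then show ?case using exponential_homeomorphic by blast
next
  case (inv h)
  then have h: "homeomorphic_automorphism36 h" using exponential_homeomorphic by blast
  then have "h \<in> Bij UNIV"
    by (simp add: Bij_UNIV homeomorphic_automorphism36_bij)
  then have "inv\<^bsub>BijGroup UNIV\<^esub> h = inv_into UNIV h"
    by (simp add: inv_BijGroup restrict_def)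
  then show ?case using homeomorphic_automorphism36_inv[OF h] by simp
next
  case (eng h1 h2)
  then have "h1 \<in> Bij UNIV" "h2 \<in> Bij UNIV"
    by (simp_all add: Bij_UNIV homeomorphic_automorphism36_bij)
  then have "h1 \<otimes>\<^bsub>BijGroup UNIV\<^esub> h2 = h1 \<circ> h2"
    by (simp add: BijGroup_def compose_def fun_eq_iff)
  then show ?case using homeomorphic_automorphism36_comp eng.IH by (simp only:)
qed

lemma exponentials_subset: "{\<phi>. \<exists>a. exponentiable a \<and> is_exp_ad 1 a \<phi>} \<subseteq> carrier (BijGroup UNIV)"
  using exponential_homeomorphic
  by (auto simp: BijGroup_def Bij_UNIV homeomorphic_automorphism36_bij)

lemma inner_inv:
  assumes "\<phi> \<in> inner_automorphisms36"
  shows "inv_into UNIV \<phi> \<in> inner_automorphisms36"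
proof -
  have "\<phi> \<in> Bij UNIV"
    using inner_homeomorphic[OF assms]
    by (simp add: Bij_UNIV homeomorphic_automorphism36_bij)
  then have "inv\<^bsub>BijGroup UNIV\<^esub> \<phi> = inv_into UNIV \<phi>"
    by (simp add: inv_BijGroup restrict_def)
  then show ?thesis
    using group.generate_m_inv_closed[OF group_BijGroup exponentials_subset, of \<phi>] assms
    unfolding inner_automorphisms36_def by (simp only:)
qed

lemma inner_comp:
  assumes "\<phi> \<in> inner_automorphisms36" "\<psi> \<in> inner_automorphisms36"
  shows "\<phi> \<circ> \<psi> \<in> inner_automorphisms36"
proof -
  have "\<phi> \<in> Bij UNIV" "\<psi> \<in> Bij UNIV"
    using assms[THEN inner_homeomorphic]
    by (simp_all add: Bij_UNIV homeomorphic_automorphism36_bij)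
  then have "\<phi> \<otimes>\<^bsub>BijGroup UNIV\<^esub> \<psi> = \<phi> \<circ> \<psi>"
    by (simp add: BijGroup_def compose_def fun_eq_iff)
  then show ?thesis
    using generate.eng[of \<phi> "BijGroup UNIV" _ \<psi>] assms
    unfolding inner_automorphisms36_def by (simp only:)
qed

lemma inner_id: "id \<in> inner_automorphisms36"
proof -
  have "\<one>\<^bsub>BijGroup UNIV\<^esub> = id"
    by (simp add: BijGroup_def id_def restrict_def)
  then show ?thesis
    using generate.one[of "BijGroup UNIV"] unfolding inner_automorphisms36_def by metis
qed

lemma (in topologically_nilpotent) exp_ad_inner: "exp_ad 1 \<in> inner_automorphisms36"
  unfolding inner_automorphisms36_def
  using exponentiable is_exp_ad[of 1] by (intro generate.incl) blast

section \<open>Open subalgebras and automorphisms\<close>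

definition open_subalgebra36 :: "e36 set \<Rightarrow> bool" where
  "open_subalgebra36 S \<longleftrightarrow> subalgebra36 S \<and> openin lc_topology S \<and> S \<noteq> UNIV"

lemma maximal_open_subalgebra36_iff:
  "maximal_open_subalgebra36 S \<longleftrightarrow> open_subalgebra36 S \<and> (\<forall>T. open_subalgebra36 T \<and> S \<subseteq> T \<longrightarrow> T = S)"
  unfolding maximal_open_subalgebra36_def open_subalgebra36_def by blast

lemma open_subalgebra36_image:
  assumes \<phi>: "homeomorphic_automorphism36 \<phi>" and S: "open_subalgebra36 S"
  shows "open_subalgebra36 (\<phi> ` S)"
proof -
  have bij: "bij \<phi>" and lin: "Vector_Spaces.linear scale36 scale36 \<phi>"
    and even: "\<phi> (even_part x) = even_part (\<phi> x)"
    and br: "\<phi> (bracket36 x y) = bracket36 (\<phi> x) (\<phi> y)"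
    and cont: "continuous_map lc_topology lc_topology (inv_into UNIV \<phi>)" for x y
    using \<phi> unfolding homeomorphic_automorphism36_def by (blast dest: continuous_automorphism36D)+
  interpret Vector_Spaces.linear scale36 scale36 \<phi> by fact
  have odd: "\<phi> (odd_part x) = odd_part (\<phi> x)" for x
  proof -
    have "odd_part z = z - even_part z" for z
      using even_part_plus_odd_part[of z] by (simp add: algebra_simps)
    then show ?thesis by (simp add: diff even)
  qed
  have sub: "subalgebra36 S" and op: "openin lc_topology S" and ne: "S \<noteq> UNIV"
    using S by (auto simp: open_subalgebra36_def)
  have "e36.subspace (\<phi> ` S)"
    using sub by (intro subspace_image) (simp add: subalgebra36_def)
  moreover have "\<forall>x\<in>\<phi> ` S. even_part x \<in> \<phi> ` S \<and> odd_part x \<in> \<phi> ` S"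
    using sub unfolding subalgebra36_def by (metis (no_types, lifting) even odd image_iff)
  moreover have "\<forall>x\<in>\<phi> ` S. \<forall>y\<in>\<phi> ` S. bracket36 x y \<in> \<phi> ` S"
    using sub unfolding subalgebra36_def by (metis (no_types, lifting) br image_iff)
  moreover have "openin lc_topology (\<phi> ` S)"
  proof -
    have "\<phi> ` S = {x \<in> topspace lc_topology. inv_into UNIV \<phi> x \<in> S}"
      using bij by (simp add: topspace_lc_topology bij_image_Collect_eq flip: vimage_def)
        (metis bij_vimage_eq_inv_image inv_inv_eq bij_imp_bij_inv)
    then show ?thesis
      using openin_continuous_map_preimage[OF cont op] by simp
  qed
  moreover have "\<phi> ` S \<noteq> UNIV"
    using ne bij by (metis bij_betw_def inj_image_eq_iff)
  ultimately show ?thesis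
    by (simp add: open_subalgebra36_def subalgebra36_def)
qed

lemma maximal_image:
  assumes \<phi>: "homeomorphic_automorphism36 \<phi>" and S: "maximal_open_subalgebra36 S"
  shows "maximal_open_subalgebra36 (\<phi> ` S)"
  unfolding maximal_open_subalgebra36_iff
proof (intro conjI allI impI)
  show "open_subalgebra36 (\<phi> ` S)"
    using open_subalgebra36_image[OF \<phi>] S by (simp add: maximal_open_subalgebra36_iff)
  fix T assume T: "open_subalgebra36 T \<and> \<phi> ` S \<subseteq> T"
  have bij: "bij \<phi>"
    using \<phi> by (rule homeomorphic_automorphism36_bij)
  then have inv: "inv_into UNIV \<phi> ` \<phi> ` A = A" "\<phi> ` inv_into UNIV \<phi> ` A = A" for A
    by (simp_all add: bij_is_inj bij_is_surj image_f_inv_f)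
  have "open_subalgebra36 (inv_into UNIV \<phi> ` T)"
    using open_subalgebra36_image[OF homeomorphic_automorphism36_inv[OF \<phi>]] T by blast
  moreover have "S \<subseteq> inv_into UNIV \<phi> ` T"
    using T inv by (metis image_mono)
  ultimately have "inv_into UNIV \<phi> ` T = S"
    using S by (simp add: maximal_open_subalgebra36_iff)
  then show "T = \<phi> ` S" using inv by metis
qed

section \<open>Subalgebras that do not fix the origin\<close>

lemma open_subalgebra36D:
  assumes "open_subalgebra36 S"
  shows "e36.subspace S" "\<And>x. x \<in> S \<Longrightarrow> even_part x \<in> S" "\<And>x. x \<in> S \<Longrightarrow> odd_part x \<in> S"
    "\<And>x y. x \<in> S \<Longrightarrow> y \<in> S \<Longrightarrow> bracket36 x y \<in> S"
    "\<exists>n. \<forall>x. wge36 0 n x \<longrightarrow> x \<in> S" "S \<noteq> UNIV"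
  using assms openin_subspace_iff unfolding open_subalgebra36_def subalgebra36_def by blast+

text \<open>Subtracting its value c from \<open>X $ i\<close> gains one weight, and the derivatives
  in the other variables lower the weight only by one, whatever their coefficients.\<close>

lemma wge_vf_apply_leading:
  assumes X: "ev (X $ i) = c" and f: "wge (axis i 1) (n + 2) f"
  shows "wge (axis i 1) (Suc n) (vf_apply X f - pconst c * pdiff i f)"
proof -
  have "wge (axis i 1) (Suc n) ((X $ l - (if l = i then pconst c else 0)) * pdiff l f)" for l
  proof (cases "l = i")
    case True
    have "wge (axis i 1) n (pdiff i f)"
      using f by (intro wge_pdiff) simp
    moreover have "wge (axis i 1) 1 (X $ i - pconst c)"
      unfolding wge_1_iff by (simp add: ev_simps X)
    ultimately show ?thesis
      using wge_mult[of "axis i 1" 1 _ n] True by simp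
  next
    case False
    then have "wge (axis i 1) (Suc n) (pdiff l f)"
      using f by (intro wge_pdiff) (simp add: axis_def)
    then show ?thesis by (rule wge_mult_left)
  qed
  moreover have "vf_apply X f - pconst c * pdiff i f
      = (\<Sum>l\<in>UNIV. (X $ l - (if l = i then pconst c else 0)) * pdiff l f)"
    using exhaust_3[of i] by (auto simp: vf_apply_def sum_3 algebra_simps)
  ultimately show ?thesis by (simp add: wge_sum)
qed

fun map36 :: "(pser \<Rightarrow> pser) \<Rightarrow> e36 \<Rightarrow> e36" where
  "map36 g (Y, (e, f, h), \<eta>) = (\<chi> k. g (Y $ k), (g e, g f, g h), \<chi> k j. g (\<eta> $ k $ j))"

text \<open>As the first argument is even, \<open>z\<close> is differentiated only by
  \<open>X\<close>; all other terms keep the weight of \<open>z\<close>.\<close>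

lemma wge36_bracket_leading:
  assumes X: "ev (X $ i) = c" and z: "wge36 (axis i 1) (n + 2) z"
  shows "wge36 (axis i 1) (Suc n) (bracket36 (X, A, 0) z - map36 (\<lambda>f. pconst c * pdiff i f) z)"
proof -
  let ?s = "axis i 1"
  obtain Y e' f' h' \<eta> where zeq: "z = (Y, (e', f', h'), \<eta>)" by (cases z) auto
  obtain e f h where A: "A = (e, f, h)" by (cases A) auto
  have "\<And>k. wge ?s (n + 2) (Y $ k)" "wge ?s (n + 2) e'" "wge ?s (n + 2) f'" "wge ?s (n + 2) h'"
    "\<And>k j. wge ?s (n + 2) (\<eta> $ k $ j)"
    using z by (auto simp: zeq)
  note W = this
  note L = this[THEN wge_vf_apply_leading[of X i c, OF X]]
  have S: "wge ?s (Suc n) g" if "wge ?s (n + 2) g" for g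
    using that by (rule wge_mono) simp
  note W = W[THEN S]
  have Y: "wge ?s (Suc n) (vf_apply Y g)" for g
    using W by (simp add: vf_apply_def wge_sum wge_mult_right)
  have zero: "odd_odd_vf 0 \<eta> = 0" "odd_odd_sl2 0 \<eta> = 0" "even_on_odd Y (e', f', h') 0 = 0"
    by (simp_all add: odd_odd_vf_eq pcross_def vec_eq_iff forall_3 odd_odd_sl2_eq curl_pairing_def
        curl_def sum_3 pdiff_0 zero_prod_def even_on_odd_nth vf_apply_0)
  have two: "wge ?s (Suc n) (2 * g)" if "wge ?s (Suc n) g" for g
    using that by (rule wge_mult_left)
  have vf: "wge ?s (Suc n) (vf_bracket X Y $ k - pconst c * pdiff i (Y $ k))" for k
    using wge_diff[OF L(1)[of k] Y[of "X $ k"]] by (simp add: vf_bracket_def algebra_simps)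
  have odd: "wge ?s (Suc n) (even_on_odd X (e, f, h) \<eta> $ k $ j - pconst c * pdiff i (\<eta> $ k $ j))" for k j
  proof -
    have "wge ?s (Suc n) ((\<Sum>l\<in>UNIV. \<eta> $ k $ l * pdiff j (X $ l)) - pconst (1 / 2) * divergence X * \<eta> $ k $ j
       + (\<Sum>l\<in>UNIV. sl2_matrix (e, f, h) $ k $ l * \<eta> $ l $ j))"
      using W by (intro wge_intros) (auto intro: wge_mult_left wge_mult_right)
    from wge_add[OF L(5)[of k j] this] show ?thesis
      by (simp add: even_on_odd_nth algebra_simps del: sl2_matrix.simps)
  qed
  have sl2: "wge ?s (Suc n) (vf_apply X g - vf_apply Y g' + d - pconst c * pdiff i g)"
    if "wge ?s (Suc n) (vf_apply X g - pconst c * pdiff i g)" "wge ?s (Suc n) d" for g g' d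
    using wge_add[OF wge_diff[OF that(1) Y[of g']] that(2)] by (simp add: algebra_simps)
  have "wge ?s (Suc n) (vf_apply X e' - vf_apply Y e + (2 * (h * e') - 2 * (h' * e)) - pconst c * pdiff i e')"
    "wge ?s (Suc n) (vf_apply X f' - vf_apply Y f + (2 * (f * h') - 2 * (f' * h)) - pconst c * pdiff i f')"
    "wge ?s (Suc n) (vf_apply X h' - vf_apply Y h + (e * f' - e' * f) - pconst c * pdiff i h')"
    by (intro sl2 L wge_diff two wge_mult_left[OF W(2)] wge_mult_left[OF W(3)] wge_mult_left[OF W(4)]
        wge_mult_right[OF W(2)] wge_mult_right[OF W(3)] wge_mult_right[OF W(4)])+
  then show ?thesis
    using vf odd by (simp add: zeq A zero sl2_bracket_eq)
qed

text \<open>Downward induction on the weight N, starting in large weights by openness. For x of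
  weight N, an antiderivative z of x / c has weight N + 2, and the bracket of the given element with
  z differs from x by weight N + 1. Both z and the difference already lie in S, hence so does x, and
  S would be everything.\<close>

lemma open_subalgebra36_vf_vanishes:
  assumes S: "open_subalgebra36 S" and a: "(X, A, 0) \<in> S"
  shows "ev (X $ i) = 0"
proof (rule ccontr)
  assume c: "ev (X $ i) \<noteq> 0"
  define c where "c = ev (X $ i)"
  let ?s = "axis i 1 :: nat^3"
  note S = open_subalgebra36D[OF S]
  obtain n where n: "\<forall>x. wge36 0 n x \<longrightarrow> x \<in> S" using S(5) by blast
  \<comment> \<open>Doubling the weight of one variable at most doubles the total, so weight
    \<open>2 * n\<close> forces order \<open>n\<close>.\<close>
  have weight: "weight ?s m \<le> 2 * weight 0 m" for m
  proof -
    have "(?s $ j + 1) * m $ j \<le> 2 * m $ j" for j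
      by (rule mult_right_mono) (auto simp: axis_def)
    then show ?thesis
      unfolding weight_def sum_distrib_left by (intro sum_mono) simp
  qed
  have "x \<in> S" if "wge36 ?s N x" for x N
    using that
  proof (induction "2 * n - N" arbitrary: N x)
    case 0
    then have "wge36 ?s (2 * n) x" using wge36_mono by simp
    then have "wge36 0 n x"
      unfolding wge36_iff by (metis weight order_le_less_trans mult_less_cancel1 zero_less_numeral)
    then show ?case using n by blast
  next
    case (Suc d)
    then have IH: "y \<in> S" if "wge36 ?s (Suc N) y" for y
      using that by (metis Suc_diff_Suc diff_Suc_1 zero_less_Suc zero_less_diff)
    define z where "z = map36 (\<lambda>f. pconst (1 / c) * pint i f) x"
    obtain Y e f h \<eta> where x: "x = (Y, (e, f, h), \<eta>)" by (cases x) auto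
    have g: "wge ?s (N + 2) (pconst (1 / c) * pint i g)" if "wge ?s N g" for g
      using wge_pint[OF that, of i] by (intro wge_mult_left) simp
    have z: "wge36 ?s (N + 2) z"
      using Suc.prems g by (simp add: z_def x del: One_nat_def add_2_eq_Suc')
    have "pconst c * pdiff i (pconst (1 / c) * pint i g) = g" for g
    proof -
      have "pconst c * pconst (1 / c) = 1"
        using c by (simp add: c_def pconst_1 flip: pconst_mult)
      then show ?thesis
        by (simp add: pdiff_pconst_mult pdiff_pint flip: mult.assoc)
    qed
    then have zx: "map36 (\<lambda>f. pconst c * pdiff i f) z = x"
      by (simp add: z_def x vec_eq_iff)
    have "bracket36 (X, A, 0) z \<in> S"
      using z by (intro S(4) a IH) (rule wge36_mono[of _ "N + 2"], simp_all)
    moreover have "bracket36 (X, A, 0) z - x \<in> S"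
      using wge36_bracket_leading[OF c_def[symmetric] z, of A] by (intro IH) (simp only: zx)
    ultimately have "bracket36 (X, A, 0) z - (bracket36 (X, A, 0) z - x) \<in> S"
      by (rule e36.subspace_diff[OF S(1)])
    then show ?case by simp
  qed
  then have "x \<in> S" for x
    using wge36_iff[of ?s 0 x] by blast
  then show False using S(6) by blast
qed

section \<open>The three graded subalgebras\<close>

definition "G222 = graded_subalgebra36 (vector [2, 2, 2]) 0"
definition "G211 = graded_subalgebra36 (vector [2, 1, 1]) 0"
definition "G111 = graded_subalgebra36 (vector [1, 1, 1]) (1 / 2)"

section \<open>Monomials of negative degree and the resulting conditions at the origin\<close>

lemma nat3_eq_0_iff: "m = 0 \<longleftrightarrow> m $ 1 = 0 \<and> m $ 2 = 0 \<and> m $ 3 = 0" for m :: "nat^3"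
  by (simp add: vec_eq_iff forall_3)

lemma nat3_eq_axis_iff:
  "m = axis 2 1 \<longleftrightarrow> m $ 1 = 0 \<and> m $ 2 = 1 \<and> m $ 3 = 0"
  "m = axis 3 1 \<longleftrightarrow> m $ 1 = 0 \<and> m $ 2 = 0 \<and> m $ 3 = 1" for m :: "nat^3"
  by (auto simp add: vec_eq_iff forall_3 axis_def)

lemma mem_graded_iff:
  "(X, (e, f, h), \<theta>) \<in> graded_subalgebra36 a \<epsilon> \<longleftrightarrow>
    (\<forall>i m. deg36 a \<epsilon> (MonVF m i) < 0 \<longrightarrow> pcoeff (X $ i) m = 0) \<and>
    (\<forall>m. deg36 a \<epsilon> (MonE m) < 0 \<longrightarrow> pcoeff e m = 0) \<and>
    (\<forall>m. deg36 a \<epsilon> (MonF m) < 0 \<longrightarrow> pcoeff f m = 0) \<and>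
    (\<forall>m. deg36 a \<epsilon> (MonH m) < 0 \<longrightarrow> pcoeff h m = 0) \<and>
    (\<forall>k i m. deg36 a \<epsilon> (MonOdd m i k) < 0 \<longrightarrow> pcoeff (\<theta> $ k $ i) m = 0)" (is "?L \<longleftrightarrow> ?R")
proof
  assume L: ?L
  have "coeff36 (X, (e, f, h), \<theta>) \<beta> = 0" if "deg36 a \<epsilon> \<beta> < 0" for \<beta>
    using L that by (auto simp: graded_subalgebra36_def simp del: coeff36.simps deg36.simps)
  from this[of "MonVF _ _"] this[of "MonE _"] this[of "MonF _"] this[of "MonH _"] this[of "MonOdd _ _ _"]
  show ?R by (simp del: deg36.simps)
next
  assume R: ?R
  have "coeff36 (X, (e, f, h), \<theta>) \<beta> = 0" if "deg36 a \<epsilon> \<beta> < 0" for \<beta>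
    using R that by (cases \<beta>) (simp_all del: deg36.simps)
  then show ?L by (auto simp: graded_subalgebra36_def simp del: coeff36.simps deg36.simps) (metis not_le)
qed

lemma deg36_neg_222:
  "deg36 (vector [2, 2, 2]) 0 (MonVF m i) < 0 \<longleftrightarrow> m = 0"
  "deg36 (vector [2, 2, 2]) 0 (MonE m) < 0 \<longleftrightarrow> False" "deg36 (vector [2, 2, 2]) 0 (MonF m) < 0 \<longleftrightarrow> False"
  "deg36 (vector [2, 2, 2]) 0 (MonH m) < 0 \<longleftrightarrow> False"
  "deg36 (vector [2, 2, 2]) 0 (MonOdd m i k) < 0 \<longleftrightarrow> m = 0"
  using exhaust_3[of i] exhaust_2[of k]
  by (auto simp: deg_x_def deg_d_def sum_3 nat3_eq_0_iff)

lemma deg36_neg_211: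
  "deg36 (vector [2, 1, 1]) 0 (MonVF m i) < 0
    \<longleftrightarrow> m = 0 \<or> i = 1 \<and> (m = axis 2 1 \<or> m = axis 3 1)"
  "deg36 (vector [2, 1, 1]) 0 (MonE m) < 0 \<longleftrightarrow> False" "deg36 (vector [2, 1, 1]) 0 (MonF m) < 0 \<longleftrightarrow> False"
  "deg36 (vector [2, 1, 1]) 0 (MonH m) < 0 \<longleftrightarrow> False"
  "deg36 (vector [2, 1, 1]) 0 (MonOdd m i k) < 0 \<longleftrightarrow> m = 0 \<and> i \<noteq> 1"
proof -
  \<comment> \<open>The comparisons of degrees are moved from the rationals to the natural numbers,
    where they are decidable.\<close>
  have "rat_of_nat (m $ 1) * 2 + rat_of_nat (m $ 2) + rat_of_nat (m $ 3) < 2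
      \<longleftrightarrow> m $ 1 * 2 + m $ 2 + m $ 3 < 2"
    using of_nat_less_iff[where 'a = rat, of "m $ 1 * 2 + m $ 2 + m $ 3" 2] by simp
  moreover have "rat_of_nat (m $ 1) * 2 + rat_of_nat (m $ 2) + rat_of_nat (m $ 3) < 1
      \<longleftrightarrow> m $ 1 * 2 + m $ 2 + m $ 3 < 1"
    using of_nat_less_iff[where 'a = rat, of "m $ 1 * 2 + m $ 2 + m $ 3" 1] by simp
  ultimately show "deg36 (vector [2, 1, 1]) 0 (MonVF m i) < 0
    \<longleftrightarrow> m = 0 \<or> i = 1 \<and> (m = axis 2 1 \<or> m = axis 3 1)"
    using exhaust_3[of i]
    by (elim disjE; simp add: deg_x_def sum_3 nat3_eq_0_iff nat3_eq_axis_iff del: One_nat_def; presburger)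
qed (use exhaust_3[of i] exhaust_2[of k] in
    \<open>auto simp: deg_x_def deg_d_def sum_3 nat3_eq_0_iff\<close>)

lemma deg36_neg_111:
  "deg36 (vector [1, 1, 1]) (1 / 2) (MonVF m i) < 0 \<longleftrightarrow> m = 0"
  "deg36 (vector [1, 1, 1]) (1 / 2) (MonE m) < 0 \<longleftrightarrow> False"
  "deg36 (vector [1, 1, 1]) (1 / 2) (MonF m) < 0 \<longleftrightarrow> m = 0"
  "deg36 (vector [1, 1, 1]) (1 / 2) (MonH m) < 0 \<longleftrightarrow> False"
  "deg36 (vector [1, 1, 1]) (1 / 2) (MonOdd m i k) < 0 \<longleftrightarrow> m = 0 \<and> k = 2"
  using exhaust_3[of i] exhaust_2[of k]
  by (auto simp: deg_x_def deg_d_def sum_3 nat3_eq_0_iff)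

lemma ev_pdiff: "ev (pdiff i f) = pcoeff f (axis i 1)"
  by (simp add: ev_def pcoeff_pdiff)

lemma mem_G222: "(X, (e, f, h), \<theta>) \<in> G222 \<longleftrightarrow> (\<forall>i. ev (X $ i) = 0) \<and> (\<forall>k j. ev (\<theta> $ k $ j) = 0)"
  unfolding G222_def mem_graded_iff deg36_neg_222 by (simp add: ev_def)

lemma mem_G211: "(X, (e, f, h), \<theta>) \<in> G211 \<longleftrightarrow>
    (\<forall>i. ev (X $ i) = 0) \<and> ev (pdiff 2 (X $ 1)) = 0 \<and> ev (pdiff 3 (X $ 1)) = 0 \<and>
    (\<forall>k. ev (\<theta> $ k $ 2) = 0 \<and> ev (\<theta> $ k $ 3) = 0)"
  unfolding G211_def mem_graded_iff deg36_neg_211 ev_pdiff by (auto simp add: ev_def forall_3)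

lemma mem_G111: "(X, (e, f, h), \<theta>) \<in> G111 \<longleftrightarrow>
    (\<forall>i. ev (X $ i) = 0) \<and> ev f = 0 \<and> (\<forall>j. ev (\<theta> $ 2 $ j) = 0)"
  unfolding G111_def mem_graded_iff deg36_neg_111 by (auto simp add: ev_def)

section \<open>The three graded subspaces as proper open subalgebras\<close>

lemma open_subalgebra36I:
  assumes zero: "0 \<in> S"
    and add: "\<And>x y. x \<in> S \<Longrightarrow> y \<in> S \<Longrightarrow> x + y \<in> S"
    and scale: "\<And>c x. x \<in> S \<Longrightarrow> scale36 c x \<in> S"
    and even: "\<And>x. x \<in> S \<Longrightarrow> even_part x \<in> S"
    and bracket: "\<And>x y. x \<in> S \<Longrightarrow> y \<in> S \<Longrightarrow> bracket36 x y \<in> S"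
    and op: "\<And>x. wge36 0 2 x \<Longrightarrow> x \<in> S"
    and "z \<notin> S"
  shows "open_subalgebra36 S"
proof -
  have sub: "e36.subspace S"
    using zero add scale by (rule e36.subspaceI)
  have "odd_part x \<in> S" if "x \<in> S" for x
    using e36.subspace_diff[OF sub that even[OF that]] even_part_plus_odd_part[of x]
    by (metis add_diff_cancel_left')
  then show ?thesis
    unfolding open_subalgebra36_def subalgebra36_def openin_subspace_iff[OF sub]
    using sub even bracket op \<open>z \<notin> S\<close> by blast
qed

text \<open>Order 2 takes care of the first derivatives that occur in the description of
  \<open>G211\<close>.\<close>

lemma wge_2_ev: "wge 0 2 f \<Longrightarrow> ev f = 0" "wge 0 2 f \<Longrightarrow> ev (pdiff i f) = 0"
  using wge_mono[of 0 2 f 1] wge_pdiff_0[of 1 f i] wge_1_iff[of 0]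
  by (simp_all add: numeral_2_eq_2)

lemma ev_vf_apply: "(\<And>i. ev (X $ i) = 0) \<Longrightarrow> ev (vf_apply X f) = 0"
  by (simp add: vf_apply_def sum_3 ev_simps)

lemmas bracket_ev_simps = vf_bracket_def odd_odd_vf_eq pcross_def even_on_odd_nth sl2_bracket_eq
  odd_odd_sl2_eq curl_pairing_def sum_2 sum_3 forall_2 forall_3 ev_simps vf_apply_def

lemma not_mem_translation:
  "((\<chi> i. 1), (0, 0, 0), 0) \<notin> G222" "((\<chi> i. 1), (0, 0, 0), 0) \<notin> G211"
  "((\<chi> i. 1), (0, 0, 0), 0) \<notin> G111"
  by (simp_all add: mem_G222 mem_G211 mem_G111 ev_1)

lemma open_subalgebra36_G222: "open_subalgebra36 G222"
proof (rule open_subalgebra36I[OF _ _ _ _ _ _ not_mem_translation(1)])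
  fix x y :: e36 and c
  obtain X e f h \<theta> where x: "x = (X, (e, f, h), \<theta>)" by (cases x) auto
  obtain Y e' f' h' \<eta> where y: "y = (Y, (e', f', h'), \<eta>)" by (cases y) auto
  show "wge36 0 2 x \<Longrightarrow> x \<in> G222"
    by (simp add: x mem_G222 wge_2_ev)
  assume X: "x \<in> G222"
  then show "scale36 c x \<in> G222" "even_part x \<in> G222"
    by (simp_all add: x mem_G222 ev_simps)
  assume "y \<in> G222"
  with X show "x + y \<in> G222" "bracket36 x y \<in> G222"
    by (simp_all add: x y mem_G222 bracket_ev_simps)
qed (simp add: zero_prod_def mem_G222 ev_simps)

lemma open_subalgebra36_G111: "open_subalgebra36 G111"
proof (rule open_subalgebra36I[OF _ _ _ _ _ _ not_mem_translation(3)])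
  fix x y :: e36 and c
  obtain X e f h \<theta> where x: "x = (X, (e, f, h), \<theta>)" by (cases x) auto
  obtain Y e' f' h' \<eta> where y: "y = (Y, (e', f', h'), \<eta>)" by (cases y) auto
  show "wge36 0 2 x \<Longrightarrow> x \<in> G111"
    by (simp add: x mem_G111 wge_2_ev)
  assume X: "x \<in> G111"
  then show "scale36 c x \<in> G111" "even_part x \<in> G111"
    by (simp_all add: x mem_G111 ev_simps)
  assume "y \<in> G111"
  with X show "x + y \<in> G111" "bracket36 x y \<in> G111"
    by (simp_all add: x y mem_G111 bracket_ev_simps)
qed (simp add: zero_prod_def mem_G111 ev_simps)

lemma open_subalgebra36_G211: "open_subalgebra36 G211"
proof (rule open_subalgebra36I[OF _ _ _ _ _ _ not_mem_translation(2)])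
  fix x y :: e36 and c
  obtain X e f h \<theta> where x: "x = (X, (e, f, h), \<theta>)" by (cases x) auto
  obtain Y e' f' h' \<eta> where y: "y = (Y, (e', f', h'), \<eta>)" by (cases y) auto
  show "wge36 0 2 x \<Longrightarrow> x \<in> G211"
    by (simp add: x mem_G211 wge_2_ev)
  assume X: "x \<in> G211"
  then show "scale36 c x \<in> G211" "even_part x \<in> G211"
    by (simp_all add: x mem_G211 ev_simps pdiff_simps)
  assume "y \<in> G211"
  with X show "x + y \<in> G211" "bracket36 x y \<in> G211"
    by (simp_all add: x y mem_G211 bracket_ev_simps pdiff_simps)
qed (simp add: zero_prod_def mem_G211 ev_simps pdiff_simps)

section \<open>Values of odd elements at the origin\<close>

lemma ev_pcross: "ev (pcross a b $ 1) = ev (a $ 2) * ev (b $ 3) - ev (a $ 3) * ev (b $ 2)"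
    "ev (pcross a b $ 2) = ev (a $ 3) * ev (b $ 1) - ev (a $ 1) * ev (b $ 3)"
    "ev (pcross a b $ 3) = ev (a $ 1) * ev (b $ 2) - ev (a $ 2) * ev (b $ 1)"
  by (simp_all add: pcross_def ev_simps)

text \<open>The odd parts lie in S by parity. The vector field of their bracket is a difference of
  two cross products, and the equations are the vanishing of its three components at the
  origin.\<close>

lemma odd_value_isotropic:
  assumes S: "open_subalgebra36 S" and "x \<in> S" "y \<in> S"
  defines "p \<equiv> odd_value x" and "q \<equiv> odd_value y"
  shows "p $ 1 $ 2 * q $ 2 $ 3 - p $ 1 $ 3 * q $ 2 $ 2 = p $ 2 $ 2 * q $ 1 $ 3 - p $ 2 $ 3 * q $ 1 $ 2"
    "p $ 1 $ 3 * q $ 2 $ 1 - p $ 1 $ 1 * q $ 2 $ 3 = p $ 2 $ 3 * q $ 1 $ 1 - p $ 2 $ 1 * q $ 1 $ 3"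
    "p $ 1 $ 1 * q $ 2 $ 2 - p $ 1 $ 2 * q $ 2 $ 1 = p $ 2 $ 1 * q $ 1 $ 2 - p $ 2 $ 2 * q $ 1 $ 1"
proof -
  obtain X A \<theta> where x: "x = (X, A, \<theta>)" by (cases x) auto
  obtain Y B \<eta> where y: "y = (Y, B, \<eta>)" by (cases y) auto
  have "even_part (bracket36 (odd_part x) (odd_part y)) \<in> S"
    by (intro open_subalgebra36D[OF S] assms)
  moreover have "even_part (bracket36 (odd_part x) (odd_part y))
      = (odd_odd_vf \<theta> \<eta>, sl2_vf_apply 0 0 - sl2_vf_apply 0 0 + sl2_bracket 0 0 + odd_odd_sl2 \<theta> \<eta>, 0)"
    by (simp add: x y vf_bracket_def vf_apply_def vec_eq_iff del: sl2_vf_apply.simps)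
  ultimately have "ev (odd_odd_vf \<theta> \<eta> $ i) = 0" for i
    using open_subalgebra36_vf_vanishes[OF S] by metis
  from this[of 1] this[of 2] this[of 3]
  show "p $ 1 $ 2 * q $ 2 $ 3 - p $ 1 $ 3 * q $ 2 $ 2 = p $ 2 $ 2 * q $ 1 $ 3 - p $ 2 $ 3 * q $ 1 $ 2"
    "p $ 1 $ 3 * q $ 2 $ 1 - p $ 1 $ 1 * q $ 2 $ 3 = p $ 2 $ 3 * q $ 1 $ 1 - p $ 2 $ 1 * q $ 1 $ 3"
    "p $ 1 $ 1 * q $ 2 $ 2 - p $ 1 $ 2 * q $ 2 $ 1 = p $ 2 $ 1 * q $ 1 $ 2 - p $ 2 $ 2 * q $ 1 $ 1"
    by (simp_all add: p_def q_def x y odd_value_eq odd_odd_vf_eq ev_diff ev_pcross)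
qed

text \<open>A field vanishing at the origin acts on values through its linear part alone: an action
  of gl_3 on covectors, twisted by -1/2 of the trace, together with sl_2 acting on C^2.\<close>

lemma odd_value_even_bracket:
  assumes "\<And>i. ev (X $ i) = 0"
  shows "odd_value (bracket36 (X, (e, f, h), 0) y) $ k $ j
    = (\<Sum>l\<in>UNIV. odd_value y $ k $ l * ev (pdiff j (X $ l))) - ev (divergence X) / 2 * odd_value y $ k $ j
      + (if k = 1 then ev h * odd_value y $ 1 $ j + ev e * odd_value y $ 2 $ j
         else ev f * odd_value y $ 1 $ j - ev h * odd_value y $ 2 $ j)"
proof -
  obtain Y B \<eta> where y: "y = (Y, B, \<eta>)" by (cases y) auto
  obtain e' f' h' where B: "B = (e', f', h')" by (cases B) auto
  show ?thesis
    using exhaust_2[of k] assms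
    by (auto simp: y B odd_value_eq even_on_odd_nth vf_apply_0 ev_simps ev_vf_apply sum_2 sum_3)
qed

text \<open>The line of \<open>y\<close> below is that of \<open>dx\<^sub>1 \<otimes> v\<^sub>1\<close>; its stabilizer gives the remaining conditions.\<close>

lemma subset_G111:
  assumes S: "open_subalgebra36 S" and y: "y \<in> S" "odd_value y $ 1 $ 1 \<noteq> 0"
    and second: "\<And>x j. x \<in> S \<Longrightarrow> odd_value x $ 2 $ j = 0"
  shows "S \<subseteq> G111"
proof
  fix x assume x: "x \<in> S"
  obtain X e f h \<theta> where xe: "x = (X, (e, f, h), \<theta>)" by (cases x) auto
  have even: "(X, (e, f, h), 0) \<in> S"
    using open_subalgebra36D(2)[OF S x] by (simp add: xe)
  then have X: "ev (X $ i) = 0" for i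
    by (rule open_subalgebra36_vf_vanishes[OF S])
  have "bracket36 (X, (e, f, h), 0) y \<in> S"
    using even y(1) by (rule open_subalgebra36D(4)[OF S])
  then have "odd_value (bracket36 (X, (e, f, h), 0) y) $ 2 $ 1 = 0"
    by (rule second)
  \<comment> \<open>The second row of \<open>y\<close> is zero, so this entry of the bracket is
    \<open>ev f\<close> times the nonzero entry of \<open>y\<close>.\<close>
  then have "ev f = 0"
    using second[OF y(1)] y(2) by (simp add: odd_value_even_bracket[OF X])
  then show "x \<in> G111"
    using X second[OF x] by (simp add: xe mem_G111 odd_value_eq)
qed

lemma subset_G211:
  assumes S: "open_subalgebra36 S" and y: "y \<in> S" "odd_value y $ 1 $ 1 \<noteq> 0"
    and first: "\<And>x k. x \<in> S \<Longrightarrow> odd_value x $ k $ 2 = 0 \<and> odd_value x $ k $ 3 = 0"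
    and zero: "\<And>j. odd_value y $ 2 $ j = 0"
  shows "S \<subseteq> G211"
proof
  fix x assume x: "x \<in> S"
  obtain X e f h \<theta> where xe: "x = (X, (e, f, h), \<theta>)" by (cases x) auto
  have even: "(X, (e, f, h), 0) \<in> S"
    using open_subalgebra36D(2)[OF S x] by (simp add: xe)
  then have X: "ev (X $ i) = 0" for i
    by (rule open_subalgebra36_vf_vanishes[OF S])
  have "bracket36 (X, (e, f, h), 0) y \<in> S"
    using even y(1) by (rule open_subalgebra36D(4)[OF S])
  then have "odd_value (bracket36 (X, (e, f, h), 0) y) $ 1 $ 2 = 0"
    "odd_value (bracket36 (X, (e, f, h), 0) y) $ 1 $ 3 = 0"
    using first by blast+
  \<comment> \<open>The only nonzero entry of \<open>y\<close> is at dx_1 \<otimes> v_1, so the two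
    entries of the bracket are multiples of it by these derivatives.\<close>
  then have "ev (pdiff 2 (X $ 1)) = 0" "ev (pdiff 3 (X $ 1)) = 0"
    using first[OF y(1)] zero y(2) by (simp_all add: odd_value_even_bracket[OF X] sum_3)
  then show "x \<in> G211"
    using X first[OF x] by (simp add: xe mem_G211 odd_value_eq)
qed

text \<open>Isotropy against dx_1 \<otimes> v_1 confines all second rows to dx_1. If they all
  vanish, the values lie in C^3 \<otimes> v_1. Otherwise an element with nonzero second row confines
  all first rows to dx_1 as well, and the values lie in dx_1 \<otimes> C^2.\<close>

lemma subset_G111_or_G211:
  assumes S: "open_subalgebra36 S" and y: "y \<in> S" "odd_value y $ 1 $ 1 \<noteq> 0"
    and zero: "odd_value y $ 1 $ 2 = 0" "odd_value y $ 1 $ 3 = 0" "\<And>j. odd_value y $ 2 $ j = 0"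
  shows "S \<subseteq> G111 \<or> S \<subseteq> G211"
proof -
  have 2: "odd_value x $ 2 $ 2 = 0" "odd_value x $ 2 $ 3 = 0" if "x \<in> S" for x
    using odd_value_isotropic[OF S y(1) that] y(2) zero by simp_all
  show ?thesis
  proof (cases "\<forall>x\<in>S. odd_value x $ 2 $ 1 = 0")
    case True
    then have "odd_value x $ 2 $ j = 0" if "x \<in> S" for x j
      using 2[OF that] that exhaust_3[of j] by auto
    then show ?thesis using subset_G111[OF S y] by blast
  next
    case False
    then obtain x0 where x0: "x0 \<in> S" "odd_value x0 $ 2 $ 1 \<noteq> 0" by blast
    \<comment> \<open>Isotropy of \<open>x0\<close> against itself says that twice the product of
      its entry at (2, 1) with each of these two entries is zero.\<close>
    have x0': "odd_value x0 $ 1 $ 2 = 0" "odd_value x0 $ 1 $ 3 = 0"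
      using odd_value_isotropic[OF S x0(1) x0(1)] x0(2) 2[OF x0(1)] by simp_all
    have "odd_value x $ k $ 2 = 0 \<and> odd_value x $ k $ 3 = 0" if "x \<in> S" for x k
      using odd_value_isotropic[OF S that x0(1)] x0 x0' 2[OF x0(1)] 2[OF that] exhaust_2[of k] by auto
    then show ?thesis using subset_G211[OF S y _ zero(3)] by blast
  qed
qed

section \<open>Conjugation into the graded subalgebras\<close>

text \<open>The partial sums lie in S since a does, and the remainder has high order, so it lies in
  S by openness.\<close>

lemma (in topologically_nilpotent) exp_ad_mem:
  assumes S: "open_subalgebra36 S" and a: "a \<in> S" and x: "x \<in> S"
  shows "exp_ad t x \<in> S"
proof -
  note D = open_subalgebra36D[OF S]
  obtain n where n: "\<forall>x. wge36 0 n x \<longrightarrow> x \<in> S" using D(5) by blast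
  have "adpow a k x \<in> S" for k
    by (induction k) (auto intro: x a D(4))
  then have "exp_trunc (n + 3) t x \<in> S"
    unfolding exp_trunc_def by (intro e36.subspace_sum e36.subspace_scale D(1))
  moreover have "exp_ad t x - exp_trunc (n + 3) t x \<in> S"
    using n exp_ad_approx[OF order_refl] by blast
  ultimately have "(exp_ad t x - exp_trunc (n + 3) t x) + exp_trunc (n + 3) t x \<in> S"
    by (intro e36.subspace_add D(1))
  then show ?thesis by simp
qed

abbreviation exp_ad36 :: "e36 \<Rightarrow> e36 \<Rightarrow> e36" where
  "exp_ad36 a \<equiv> topologically_nilpotent.exp_ad a 1"

lemma (in nilpotent_matrix) matrix_mem_G222: "matrix \<in> G222"
  by (simp add: matrix_def mem_G222 ev_0)

lemma (in nilpotent_field) field_mem_G222: "(field, 0, 0) \<in> G222"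
  by (simp add: zero_prod_def mem_G222 ev_0 field_def ell_def sum_3 ev_simps)

text \<open>Isotropy of x against itself makes all 2 by 2 minors of its value vanish, so the rows
  are proportional and the second can be cleared. Taking a in \<open>G222\<close> permits the same
  normalization inside any subalgebra containing \<open>G222\<close>.\<close>

lemma normalize_matrix:
  assumes S: "open_subalgebra36 S" and x: "x \<in> S" "odd_value x \<noteq> 0"
  obtains a where "topologically_nilpotent a" "a \<in> G222"
    "odd_value (exp_ad36 a x) $ 1 \<noteq> 0" "odd_value (exp_ad36 a x) $ 2 = 0"
proof (cases "odd_value x $ 1 = 0")
  case True
  \<comment> \<open>Here 1 + N has rows (2, 1) and (-1, 0), so it turns the rows (0, q) into (q,
    0).\<close>
  interpret nilpotent_matrix 1 "- 1" 1 by unfold_locales simp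
  have "odd_value x $ 2 \<noteq> 0"
    using True x(2) by (auto simp: vec_eq_iff forall_2)
  then show ?thesis
    using True odd_value_exp_matrix[of x]
    by (intro that[OF topologically_nilpotent_axioms matrix_mem_G222]) (auto simp: vec_eq_iff)
next
  case False
  then obtain j where j: "odd_value x $ 1 $ j \<noteq> 0" by (auto simp: vec_eq_iff)
  define r where "r = odd_value x $ 2 $ j / odd_value x $ 1 $ j"
  interpret nilpotent_matrix 0 "- r" 0 by unfold_locales simp
  have "odd_value x $ 2 $ i * odd_value x $ 1 $ j = odd_value x $ 2 $ j * odd_value x $ 1 $ i" for i
    using odd_value_isotropic[OF S x(1) x(1)] exhaust_3[of i] exhaust_3[of j]
    by (auto simp: algebra_simps)
  then have "odd_value x $ 2 $ i = r * odd_value x $ 1 $ i" for i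
    using j by (simp add: r_def field_simps)
  then show ?thesis
    using False odd_value_exp_matrix[of x]
    by (intro that[OF topologically_nilpotent_axioms matrix_mem_G222]) (auto simp: vec_eq_iff)
qed

lemma normalize_field:
  assumes x: "odd_value x $ 1 \<noteq> 0" "odd_value x $ 2 = 0"
  obtains a where "topologically_nilpotent a" "a \<in> G222"
    "odd_value (exp_ad36 a x) $ 1 $ 1 \<noteq> 0" "odd_value (exp_ad36 a x) $ 1 $ 2 = 0"
    "odd_value (exp_ad36 a x) $ 1 $ 3 = 0" "odd_value (exp_ad36 a x) $ 2 = 0"
proof -
  define p where "p = odd_value x $ 1"
  \<comment> \<open>The transvection p + (w.p) l has to end on the first axis. If p_1 is nonzero, w
    = e_1 does this. If p_1 = 0, then w is chosen with w.p = 1 and l = e_1 - p, so that the image is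
    e_1; the first entry 1 of w ensures l(w) = 0.\<close>
  have "\<exists>(l :: complex^3) (w :: complex^3). l $ 1 * w $ 1 + l $ 2 * w $ 2 + l $ 3 * w $ 3 = 0 \<and>
      (let c = w $ 1 * p $ 1 + w $ 2 * p $ 2 + w $ 3 * p $ 3
       in p $ 1 + l $ 1 * c \<noteq> 0 \<and> p $ 2 + l $ 2 * c = 0 \<and> p $ 3 + l $ 3 * c = 0)"
  proof (cases "p $ 1 = 0")
    case False
    then show ?thesis
      by - (rule exI[of _ "vector [0, - p $ 2 / p $ 1, - p $ 3 / p $ 1]"],
          rule exI[of _ "vector [1, 0, 0]"], simp add: Let_def)
  next
    case 1: True
    show ?thesis
    proof (cases "p $ 2 = 0")
      case False
      then show ?thesis using 1
        by - (rule exI[of _ "vector [1, - p $ 2, - p $ 3]"],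
          rule exI[of _ "vector [1, 1 / p $ 2, 0]"], simp add: Let_def)
    next
      case True
      then have "p $ 3 \<noteq> 0"
        using 1 x(1) by (auto simp: p_def vec_eq_iff forall_3)
      then show ?thesis using 1 True
        by - (rule exI[of _ "vector [1, - p $ 2, - p $ 3]"],
          rule exI[of _ "vector [1, 0, 1 / p $ 3]"], simp add: Let_def)
    qed
  qed
  then obtain l w :: "complex^3" where ortho: "l $ 1 * w $ 1 + l $ 2 * w $ 2 + l $ 3 * w $ 3 = 0"
    and lw: "p $ 1 + l $ 1 * (w $ 1 * p $ 1 + w $ 2 * p $ 2 + w $ 3 * p $ 3) \<noteq> 0"
      "p $ 2 + l $ 2 * (w $ 1 * p $ 1 + w $ 2 * p $ 2 + w $ 3 * p $ 3) = 0"
      "p $ 3 + l $ 3 * (w $ 1 * p $ 1 + w $ 2 * p $ 2 + w $ 3 * p $ 3) = 0"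
    unfolding Let_def by blast
  interpret nilpotent_field l w
    using ortho by unfold_locales (simp add: sum_3)
  show ?thesis
    using lw x(2)
    by (intro that[OF topologically_nilpotent_axioms field_mem_G222])
      (simp_all add: odd_value_exp_field sum_3 vec_eq_iff flip: p_def)
qed

lemma conjugate_into_graded:
  assumes S: "open_subalgebra36 S"
  shows "\<exists>\<phi>\<in>inner_automorphisms36. \<phi> ` S \<subseteq> G222 \<or> \<phi> ` S \<subseteq> G111 \<or> \<phi> ` S \<subseteq> G211"
proof (cases "\<exists>x\<in>S. odd_value x \<noteq> 0")
  case True
  then obtain x where x: "x \<in> S" "odd_value x \<noteq> 0" by blast
  obtain a where a: "topologically_nilpotent a"
    "odd_value (exp_ad36 a x) $ 1 \<noteq> 0" "odd_value (exp_ad36 a x) $ 2 = 0"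
    using normalize_matrix[OF S x] by blast
  define y where "y = exp_ad36 a x"
  obtain b where b: "topologically_nilpotent b"
    "odd_value (exp_ad36 b y) $ 1 $ 1 \<noteq> 0" "odd_value (exp_ad36 b y) $ 1 $ 2 = 0"
    "odd_value (exp_ad36 b y) $ 1 $ 3 = 0" "odd_value (exp_ad36 b y) $ 2 = 0"
    using normalize_field[OF a(2,3)] unfolding y_def by blast
  let ?\<phi> = "exp_ad36 b \<circ> exp_ad36 a"
  have \<phi>: "?\<phi> \<in> inner_automorphisms36"
    using a(1) b(1) by (intro inner_comp topologically_nilpotent.exp_ad_inner)
  then have "open_subalgebra36 (?\<phi> ` S)"
    using open_subalgebra36_image inner_homeomorphic S by blast
  moreover have "exp_ad36 b y \<in> ?\<phi> ` S"
    using x(1) by (auto simp: y_def)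
  ultimately have "?\<phi> ` S \<subseteq> G111 \<or> ?\<phi> ` S \<subseteq> G211"
    using b by (intro subset_G111_or_G211) auto
  then show ?thesis using \<phi> by blast
next
  case False
  have "S \<subseteq> G222"
  proof
    fix x assume x: "x \<in> S"
    obtain X e f h \<theta> where xe: "x = (X, (e, f, h), \<theta>)" by (cases x) auto
    have "(X, (e, f, h), 0) \<in> S"
      using open_subalgebra36D(2)[OF S x] by (simp add: xe)
    then have "ev (X $ i) = 0" for i
      by (rule open_subalgebra36_vf_vanishes[OF S])
    moreover have "odd_value x = 0" using False x by blast
    ultimately show "x \<in> G222"
      by (simp add: xe mem_G222 odd_value_eq vec_eq_iff)
  qed
  then show ?thesis by (intro bexI[OF _ inner_id]) simp
qed

section \<open>Maximality of the graded subalgebras\<close>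

lemma odd_value_constant: "odd_value (0, (0, 0, 0), \<chi> k j. pconst (p $ k $ j)) = p"
  by (simp add: odd_value_eq ev_pconst vec_eq_iff)

text \<open>A nonzero odd value in a larger subalgebra can be brought to c dx_1 \<otimes> v_1 by
  exponentials of elements of \<open>G222\<close>. Exponentials of F and of x_2 d/dx_1 then yield c
  dx_1 \<otimes> (v_1 + v_2) and c (dx_1 + dx_2) \<otimes> v_1, which violate isotropy.\<close>

lemma maximal_G222: "maximal_open_subalgebra36 G222"
  unfolding maximal_open_subalgebra36_iff
proof (intro conjI allI impI)
  fix T assume T: "open_subalgebra36 T \<and> G222 \<subseteq> T"
  then have S: "open_subalgebra36 T" and sub: "G222 \<subseteq> T" by auto
  have "odd_value x = 0" if x: "x \<in> T" for x
  proof (rule ccontr)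
    assume "odd_value x \<noteq> 0"
    then obtain a where a: "topologically_nilpotent a" "a \<in> T"
      "odd_value (exp_ad36 a x) $ 1 \<noteq> 0" "odd_value (exp_ad36 a x) $ 2 = 0"
      using normalize_matrix[OF S x] sub by blast
    define y where "y = exp_ad36 a x"
    obtain b where b: "topologically_nilpotent b" "b \<in> T"
      "odd_value (exp_ad36 b y) $ 1 $ 1 \<noteq> 0" "odd_value (exp_ad36 b y) $ 1 $ 2 = 0"
      "odd_value (exp_ad36 b y) $ 1 $ 3 = 0" "odd_value (exp_ad36 b y) $ 2 = 0"
      using normalize_field[OF a(3,4)] sub unfolding y_def by blast
    define z where "z = exp_ad36 b y"
    have z: "z \<in> T"
      unfolding z_def y_def
      by (intro topologically_nilpotent.exp_ad_mem[OF _ S] a(1,2) b(1,2) x)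
    interpret M: nilpotent_matrix 0 1 0 by unfold_locales simp
    interpret N: nilpotent_field "vector [0, 1, 0]" "vector [1, 0, 0]"
      by unfold_locales (simp add: sum_3)
    have "M.exp_ad 1 z \<in> T" "N.exp_ad 1 z \<in> T"
      using M.matrix_mem_G222 N.field_mem_G222 sub z by (blast intro: M.exp_ad_mem[OF S] N.exp_ad_mem[OF S])+
    \<comment> \<open>For these two values the third isotropy equation reads 0 = c * c.\<close>
    from odd_value_isotropic(3)[OF S this] show False
      using b(3-6) by (simp add: M.odd_value_exp_matrix N.odd_value_exp_field sum_3 flip: z_def)
  qed
  moreover have "ev (X $ i) = 0" if "(X, (e, f, h), \<theta>) \<in> T" for X e f h \<theta> i
    using open_subalgebra36D(2)[OF S that] open_subalgebra36_vf_vanishes[OF S] by simp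
  ultimately have "T \<subseteq> G222"
    by (auto simp: mem_G222 odd_value_eq vec_eq_iff)
  then show "T = G222" using sub by blast
qed (rule open_subalgebra36_G222)

text \<open>The constant forms dx_1 \<otimes> v_1 and dx_2 \<otimes> v_1 lie in \<open>G111\<close>,
  and isotropy against both forces the second row of a value to vanish.\<close>

lemma maximal_G111: "maximal_open_subalgebra36 G111"
  unfolding maximal_open_subalgebra36_iff
proof (intro conjI allI impI)
  fix T assume T: "open_subalgebra36 T \<and> G111 \<subseteq> T"
  then have S: "open_subalgebra36 T" and sub: "G111 \<subseteq> T" by auto
  define y where "y = (\<lambda>i. (0, (0, 0, 0), \<chi> k j. pconst (axis 1 (axis i 1) $ k $ j)) :: e36)"
  have y: "y i \<in> T" for i
    using sub by (auto simp: y_def mem_G111 ev_simps axis_def)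
  have v: "odd_value (y i) = axis 1 (axis i 1)" for i
    unfolding y_def by (rule odd_value_constant)
  have "odd_value x $ 2 $ j = 0" if "x \<in> T" for x j
    using odd_value_isotropic[OF S y[of 1] that] odd_value_isotropic[OF S y[of 2] that] exhaust_3[of j]
    by (auto simp: v axis_def)
  then have "T \<subseteq> G111"
    using y[of 1] by (intro subset_G111[OF S]) (auto simp: v axis_def)
  then show "T = G111" using sub by blast
qed (rule open_subalgebra36_G111)

text \<open>Isotropy against dx_1 \<otimes> v_1 restricts the second row of a value to dx_1, and
  isotropy against dx_1 \<otimes> v_2 the first row.\<close>

lemma maximal_G211: "maximal_open_subalgebra36 G211"
  unfolding maximal_open_subalgebra36_iff
proof (intro conjI allI impI)
  fix T assume T: "open_subalgebra36 T \<and> G211 \<subseteq> T"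
  then have S: "open_subalgebra36 T" and sub: "G211 \<subseteq> T" by auto
  define y where "y = (\<lambda>i. (0, (0, 0, 0), \<chi> k j. pconst (axis i (axis 1 1) $ k $ j)) :: e36)"
  have y: "y i \<in> T" for i
    using sub by (auto simp: y_def mem_G211 ev_simps axis_def pdiff_0)
  have v: "odd_value (y i) = axis i (axis 1 1)" for i
    unfolding y_def by (rule odd_value_constant)
  have "odd_value x $ k $ 2 = 0 \<and> odd_value x $ k $ 3 = 0" if "x \<in> T" for x k
    using odd_value_isotropic[OF S y[of 1] that] odd_value_isotropic[OF S y[of 2] that] exhaust_2[of k]
    by (auto simp: v axis_def)
  then have "T \<subseteq> G211"
    using y[of 1] by (intro subset_G211[OF S]) (auto simp: v axis_def)
  then show "T = G211" using sub by blast
qed (rule open_subalgebra36_G211)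

lemma maximal_conjugate: "maximal_open_subalgebra36 T \<Longrightarrow> conjugate36 S T \<Longrightarrow> maximal_open_subalgebra36 S"
  unfolding conjugate36_def using inner_homeomorphic maximal_image by blast

text \<open>Pulling T back along \<open>\<phi>\<close> gives a proper open subalgebra containing S,
  so maximality of S turns the inclusion into an equality.\<close>

lemma conjugate36I:
  assumes S: "maximal_open_subalgebra36 S" and \<phi>: "\<phi> \<in> inner_automorphisms36"
    and T: "open_subalgebra36 T" "\<phi> ` S \<subseteq> T"
  shows "conjugate36 S T"
proof -
  have "bij \<phi>"
    using \<phi> by (intro homeomorphic_automorphism36_bij inner_homeomorphic)
  then have "S = inv_into UNIV \<phi> ` \<phi> ` S"
    by (simp add: bij_is_inj)
  also have "\<dots> \<subseteq> inv_into UNIV \<phi> ` T"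
    using T(2) by (rule image_mono)
  finally have "S \<subseteq> inv_into UNIV \<phi> ` T" .
  moreover have "open_subalgebra36 (inv_into UNIV \<phi> ` T)"
    using open_subalgebra36_image[OF inner_homeomorphic[OF inner_inv[OF \<phi>]] T(1)] .
  ultimately have "S = inv_into UNIV \<phi> ` T"
    using S unfolding maximal_open_subalgebra36_iff by metis
  then show ?thesis
    using inner_inv[OF \<phi>] unfolding conjugate36_def by blast
qed

theorem theorem7p6:
  fixes S :: "e36 set"
  shows "maximal_open_subalgebra36 S \<longleftrightarrow>
    conjugate36 S (graded_subalgebra36 (vector [2, 2, 2]) 0) \<or>
    conjugate36 S (graded_subalgebra36 (vector [2, 1, 1]) 0) \<or>
    conjugate36 S (graded_subalgebra36 (vector [1, 1, 1]) (1 / 2))"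
  unfolding G222_def[symmetric] G211_def[symmetric] G111_def[symmetric]
proof
  assume S: "maximal_open_subalgebra36 S"
  then have "open_subalgebra36 S" by (simp add: maximal_open_subalgebra36_iff)
  then obtain \<phi> where "\<phi> \<in> inner_automorphisms36"
    "\<phi> ` S \<subseteq> G222 \<or> \<phi> ` S \<subseteq> G111 \<or> \<phi> ` S \<subseteq> G211"
    using conjugate_into_graded by blast
  then show "conjugate36 S G222 \<or> conjugate36 S G211 \<or> conjugate36 S G111"
    using conjugate36I[OF S] open_subalgebra36_G222 open_subalgebra36_G111 open_subalgebra36_G211 by blast
next
  assume "conjugate36 S G222 \<or> conjugate36 S G211 \<or> conjugate36 S G111"
  then show "maximal_open_subalgebra36 S"
    using maximal_conjugate maximal_G222 maximal_G211 maximal_G111 by blast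
qed

end
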